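(* Let $M$ be a connected gridding matrix. Then the (deterministic) permuton $\mu_M$ defined in the context is the limit shape of $\mathrm{Grid}(M)$. That is, if for each $n\geq1$, $\boldsymbol\sigma_n$ is drawn uniformly at random from $\mathrm{Grid}_n(M)$, then the sequence of random permutons $(\mu_{\boldsymbol\sigma_n})_{n\geq1}$ converges in distribution, for the weak topology, to the deterministic permuton $\mu_M$.
   Context: Gridding matrices. A permutation $\sigma$ of length $n$ is identified with its plot $\{(i,\sigma_i)\}$. A gridding matrix $M$ is a matrix each of whose entries (cells) is "increasing", "decreasing" or "blank". Here matrices are indexed in the Euclidean manner: $M_{i,j}$ is the entry in the $i$th column from the left and the $j$th row from the bottom. If $M$ has $t$ columns and $u$ rows, an $M$-gridding of $\sigma$ is a pair of integer sequences $0=c_0\leq\dots\leq c_t=n$ and $0=r_0\leq\dots\leq r_u=n$ such that for all $i,j$ the subsequence of $\sigma$ with indices in $(c_{i-1},c_i]$ and values in $(r_{j-1},r_j]$ is increasing, decreasing or empty according to whether $M_{i,j}$ is increasing, decreasing or blank. $\mathrm{Grid}_n(M)$ is the set of permutations of length $n$ having at least one $M$-gridding, and $\mathrm{Grid}(M)=\bigcup_n\mathrm{Grid}_n(M)$. The cell graph of $M$ has the non-blank cells as vertices, two being adjacent if they share a row or column and all the cells between them are blank; $M$ is connected if its cell graph is connected. Maximal distribution. An $M$-distribution matrix is a nonnegative real matrix $\Gamma=(\gamma_{i,j})$ of the same dimensions as $M$, zero wherever $M$ is blank, with entries summing to $1$. Let $g(\Gamma)=\dfrac{\prod_{\text{lines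 }\ell}s_\ell^{\,s_\ell}}{\prod_{i,j}\gamma_{i,j}^{2\gamma_{i,j}}}$, where the numerator is over all rows and all columns $\ell$ of $\Gamma$, $s_\ell$ is the sum of the entries of $\ell$, and $0^0=1$. When $M$ is connected there is a unique $M$-distribution matrix $\Gamma_M=(\gamma_{i,j})$ maximising $g$. Permutons. A permuton is a probability measure $\mu$ on $[0,1]^2$ with uniform marginals: $\mu([a,b]\times[0,1])=\mu([0,1]\times[a,b])=b-a$ for $0\leq a\leq b\leq1$. The space of permutons carries the weak topology. For a rectangular region or line segment $A\subset[0,1]^2$, $\lambda_A$ is the probability measure supported on $A$ with mass uniformly distributed on $A$. For a permutation $\sigma$ of length $n$, let $S_\sigma(i)=[(i-1)/n,i/n]\times[(\sigma(i)-1)/n,\sigma(i)/n]$ and $\mu_\sigma=\sum_{i=1}^n\frac1n\lambda_{S_\sigma(i)}$. Definition of $\mu_M$. With $\Gamma_M=(\gamma_{i,j})$ (column index first, rows counted from the bottom), let $c_i=\sum_{i'\leq i}\sum_j\gamma_{i',j}$, $r_j=\sum_{j'\leq j}\sum_i\gamma_{i,j'}$ and $p_{i,j}=(c_i,r_j)$. For a non-blank cell $(i,j)$ let $$L(i,j)=\begin{cases}\{(1-x)p_{i-1,j-1}+x\,p_{i,j}:x\in[0,1]\},&\text{if }M_{i,j}\text{ is increasing},\\ \{(1-x)p_{i-1,j}+x\,p_{i,j-1}:x\in[0,1]\},&\text{if }M_{i,j}\text{ is decreasing}.\end{cases}$$ Then $\mu_M=\sum_{\gamma_{i,j}>0}\gamma_{i,j}\,\lambda_{L(i,j)}$.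 *)

theory Defs
  imports "HOL-Probability.Probability" "HOL-Combinatorics.Permutations"
begin

datatype cell = Increasing | Decreasing | Blank

text \<open>
  Matrices use Euclidean indexing: \<open>entry M i j\<close> is the entry in the \<open>i\<close>th column from the left
  and the \<open>j\<close>th row from the bottom, where \<open>1 \<le> i \<le> ncols M\<close> and \<open>1 \<le> j \<le> nrows M\<close>.
  Values of \<open>entry M\<close> outside this range are never used.
\<close>

datatype gridding_matrix =
  Gridding_Matrix (ncols: nat) (nrows: nat) (entry: "nat \<Rightarrow> nat \<Rightarrow> cell")

definition nonblank_cells :: "gridding_matrix \<Rightarrow> (nat \<times> nat) set" where
  "nonblank_cells M = {(i, j). i \<in> {1..ncols M} \<and> j \<in> {1..nrows M} \<and> entry M i j \<noteq> Blank}"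

text \<open>A permutation of length \<open>n\<close> is a function \<open>\<sigma>\<close> with \<open>\<sigma> permutes {1..n}\<close>.\<close>

definition is_gridding ::
  "gridding_matrix \<Rightarrow> nat \<Rightarrow> (nat \<Rightarrow> nat) \<Rightarrow> (nat \<Rightarrow> nat) \<Rightarrow> (nat \<Rightarrow> nat) \<Rightarrow> bool" where
  "is_gridding M n \<sigma> c r \<longleftrightarrow>
     c 0 = 0 \<and> c (ncols M) = n \<and> (\<forall>i<ncols M. c i \<le> c (Suc i)) \<and>
     r 0 = 0 \<and> r (nrows M) = n \<and> (\<forall>j<nrows M. r j \<le> r (Suc j)) \<and>
     (\<forall>i\<in>{1..ncols M}. \<forall>j\<in>{1..nrows M}.
        let K = {k \<in> {c (i - 1)<..c i}. \<sigma> k \<in> {r (j - 1)<..r j}} in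
        case entry M i j of
          Increasing \<Rightarrow> strict_mono_on K \<sigma>
        | Decreasing \<Rightarrow> strict_antimono_on K \<sigma>
        | Blank \<Rightarrow> K = {})"

definition Grid :: "gridding_matrix \<Rightarrow> nat \<Rightarrow> (nat \<Rightarrow> nat) set" where
  "Grid M n = {\<sigma>. \<sigma> permutes {1..n} \<and> (\<exists>c r. is_gridding M n \<sigma> c r)}"

definition cell_graph_edges :: "gridding_matrix \<Rightarrow> ((nat \<times> nat) \<times> (nat \<times> nat)) set" where
  "cell_graph_edges M = {((i, j), (i', j')).
     (i, j) \<in> nonblank_cells M \<and> (i', j') \<in> nonblank_cells M \<and> (i, j) \<noteq> (i', j') \<and>
     (i = i' \<and> (\<forall>k. min j j' < k \<and> k < max j j' \<longrightarrow> entry M i k = Blank) \<or>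
      j = j' \<and> (\<forall>k. min i i' < k \<and> k < max i i' \<longrightarrow> entry M k j = Blank))}"

text \<open>
  As usual, a connected graph has at least one vertex; an entirely blank matrix, which has no
  distribution matrix at all, is therefore not connected.
\<close>

definition connected_gridding_matrix :: "gridding_matrix \<Rightarrow> bool" where
  "connected_gridding_matrix M \<longleftrightarrow>
     nonblank_cells M \<noteq> {} \<and>
     (\<forall>v\<in>nonblank_cells M. \<forall>w\<in>nonblank_cells M. (v, w) \<in> (cell_graph_edges M)\<^sup>*)"

text \<open>
  Distribution matrices are zero at every position that is not a non-blank cell, including the
  positions outside the dimensions of the matrix; this makes the representing function unique.
\<close>

definition distribution_matrix :: "gridding_matrix \<Rightarrow> (nat \<Rightarrow> nat \<Rightarrow> real) \<Rightarrow> bool" where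
  "distribution_matrix M \<Gamma> \<longleftrightarrow>
     (\<forall>i j. 0 \<le> \<Gamma> i j) \<and>
     (\<forall>i j. (i, j) \<notin> nonblank_cells M \<longrightarrow> \<Gamma> i j = 0) \<and>
     (\<Sum>i=1..ncols M. \<Sum>j=1..nrows M. \<Gamma> i j) = 1"

text \<open>Real powers with \<open>0\<^sup>0 = 1\<close>; the library has \<open>0 powr 0 = 0\<close>.\<close>

definition rpow :: "real \<Rightarrow> real \<Rightarrow> real" where
  "rpow x a = (if a = 0 then 1 else x powr a)"

definition col_sum :: "gridding_matrix \<Rightarrow> (nat \<Rightarrow> nat \<Rightarrow> real) \<Rightarrow> nat \<Rightarrow> real" where
  "col_sum M \<Gamma> i = (\<Sum>j=1..nrows M. \<Gamma> i j)"

definition row_sum :: "gridding_matrix \<Rightarrow> (nat \<Rightarrow> nat \<Rightarrow> real) \<Rightarrow> nat \<Rightarrow> real" where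
  "row_sum M \<Gamma> j = (\<Sum>i=1..ncols M. \<Gamma> i j)"

definition grid_weight :: "gridding_matrix \<Rightarrow> (nat \<Rightarrow> nat \<Rightarrow> real) \<Rightarrow> real" where
  "grid_weight M \<Gamma> =
     (\<Prod>i=1..ncols M. rpow (col_sum M \<Gamma> i) (col_sum M \<Gamma> i)) *
     (\<Prod>j=1..nrows M. rpow (row_sum M \<Gamma> j) (row_sum M \<Gamma> j)) /
     (\<Prod>i=1..ncols M. \<Prod>j=1..nrows M. rpow (\<Gamma> i j) (2 * \<Gamma> i j))"

definition max_distribution :: "gridding_matrix \<Rightarrow> nat \<Rightarrow> nat \<Rightarrow> real" where
  "max_distribution M = (THE \<Gamma>. is_arg_max (grid_weight M) (distribution_matrix M) \<Gamma>)"

text \<open>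
  A probability measure on the unit square is represented as a Borel probability measure on the
  plane that gives the square full mass.
\<close>

definition permuton :: "(real \<times> real) measure \<Rightarrow> bool" where
  "permuton \<mu> \<longleftrightarrow>
     prob_space \<mu> \<and> sets \<mu> = sets borel \<and> measure \<mu> ({0..1} \<times> {0..1}) = 1 \<and>
     (\<forall>a b. 0 \<le> a \<and> a \<le> b \<and> b \<le> 1 \<longrightarrow>
        measure \<mu> ({a..b} \<times> {0..1}) = b - a \<and> measure \<mu> ({0..1} \<times> {a..b}) = b - a)"

text \<open>
  The initial topology for the maps \<open>\<mu> \<mapsto> \<integral>f \<partial>\<mu>\<close>, where \<open>f\<close> ranges over the bounded continuous functions
  on the plane; function types carry the product topology. By Tietze's theorem the
  restrictions of these \<open>f\<close> to the unit square are all the continuous functions on it.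
\<close>

definition weak_permuton_topology :: "(real \<times> real) measure topology" where
  "weak_permuton_topology =
     pullback_topology {\<mu>. permuton \<mu>}
       (\<lambda>\<mu> (f :: (real \<times> real) \<Rightarrow>\<^sub>C real). LINT x|\<mu>. apply_bcontfun f x) euclidean"

definition weighted_sum_measure ::
  "'i set \<Rightarrow> ('i \<Rightarrow> real) \<Rightarrow> ('i \<Rightarrow> 'a::topological_space measure) \<Rightarrow> 'a measure" where
  "weighted_sum_measure I w \<nu> =
     measure_of UNIV (sets borel) (\<lambda>A. \<Sum>i\<in>I. ennreal (w i) * emeasure (\<nu> i) A)"

lemma sets_weighted_sum_measure [simp]: "sets (weighted_sum_measure I w \<nu>) = sets borel"
  by (metis sets.sets_measure_of_eq space_borel weighted_sum_measure_def)

lemma emeasure_weighted_sum_measure: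
  assumes "\<And>i. i \<in> I \<Longrightarrow> sets (\<nu> i) = sets borel" and "A \<in> sets borel"
  shows "emeasure (weighted_sum_measure I w \<nu>) A = (\<Sum>i\<in>I. ennreal (w i) * emeasure (\<nu> i) A)"
proof (rule emeasure_measure_of[OF weighted_sum_measure_def])
  show "countably_additive (sets (weighted_sum_measure I w \<nu>))
          (\<lambda>A. \<Sum>i\<in>I. ennreal (w i) * emeasure (\<nu> i) A)"
  proof (rule countably_additiveI)
    fix B :: "nat \<Rightarrow> 'b set"
    assume B: "range B \<subseteq> sets (weighted_sum_measure I w \<nu>)" "disjoint_family B"
    have "(\<Sum>k. \<Sum>i\<in>I. ennreal (w i) * emeasure (\<nu> i) (B k)) =
          (\<Sum>i\<in>I. \<Sum>k. ennreal (w i) * emeasure (\<nu> i) (B k))"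
      by (rule suminf_sum) simp
    also have "\<dots> = (\<Sum>i\<in>I. ennreal (w i) * emeasure (\<nu> i) (\<Union>k. B k))"
      using assms(1) B by (intro sum.cong refl) (simp add: suminf_emeasure)
    finally show "(\<Sum>k. \<Sum>i\<in>I. ennreal (w i) * emeasure (\<nu> i) (B k)) =
          (\<Sum>i\<in>I. ennreal (w i) * emeasure (\<nu> i) (\<Union>k. B k))" .
  qed
qed (use assms(2) in \<open>auto simp: positive_def\<close>)

definition perm_permuton :: "nat \<Rightarrow> (nat \<Rightarrow> nat) \<Rightarrow> (real \<times> real) measure" where
  "perm_permuton n \<sigma> =
     weighted_sum_measure {1..n} (\<lambda>_. 1 / real n)
       (\<lambda>i. uniform_measure lborel
              ({(real i - 1) / real n..real i / real n} \<times>
               {(real (\<sigma> i) - 1) / real n..real (\<sigma> i) / real n}))"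

text \<open>\<open>linepath\<close> has constant speed, so for distinct \<open>p\<close>, \<open>q\<close> this is normalised length on the segment.\<close>

definition segment_measure :: "real \<times> real \<Rightarrow> real \<times> real \<Rightarrow> (real \<times> real) measure" where
  "segment_measure p q = distr (uniform_measure lborel {0..1}) borel (linepath p q)"

definition grid_point :: "gridding_matrix \<Rightarrow> nat \<Rightarrow> nat \<Rightarrow> real \<times> real" where
  "grid_point M i j =
     (\<Sum>i'=1..i. col_sum M (max_distribution M) i', \<Sum>j'=1..j. row_sum M (max_distribution M) j')"

text \<open>Only cells with positive weight are used below, so a cell that is not increasing is decreasing.\<close>

definition cell_measure :: "gridding_matrix \<Rightarrow> nat \<times> nat \<Rightarrow> (real \<times> real) measure" where
  "cell_measure M = (\<lambda>(i, j).
     if entry M i j = Increasing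
     then segment_measure (grid_point M (i - 1) (j - 1)) (grid_point M i j)
     else segment_measure (grid_point M (i - 1) j) (grid_point M i (j - 1)))"

definition limit_permuton :: "gridding_matrix \<Rightarrow> (real \<times> real) measure" where
  "limit_permuton M =
     weighted_sum_measure
       {(i, j). i \<in> {1..ncols M} \<and> j \<in> {1..nrows M} \<and> max_distribution M i j > 0}
       (\<lambda>(i, j). max_distribution M i j) (cell_measure M)"

text \<open>
  Convergence of the laws of discrete random elements of a topological space: the expectations of
  every bounded continuous real function converge. A deterministic limit \<open>x\<close> has the law
  \<open>return_pmf x\<close>.
\<close>

definition converges_in_distribution ::
  "'a topology \<Rightarrow> (nat \<Rightarrow> 'a pmf) \<Rightarrow> 'a pmf \<Rightarrow> bool" where
  "converges_in_distribution T P Q \<longleftrightarrow>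
     (\<forall>n. set_pmf (P n) \<subseteq> topspace T) \<and> set_pmf Q \<subseteq> topspace T \<and>
     (\<forall>F. continuous_map T euclideanreal F \<and> bounded (F ` topspace T) \<longrightarrow>
        (\<lambda>n. measure_pmf.expectation (P n) F) \<longlonglongrightarrow> measure_pmf.expectation Q F)"

end

theory Submission
  imports Defs "HOL-Real_Asymp.Real_Asymp"
begin

text \<open>
  A gridding of a permutation \<open>\<sigma>\<close> of length \<open>n\<close> turns it into two words. The first lists, from left to right,
  the row of the grid that contains each point; the second lists, from bottom to top, the column. Given the
  cuts, the two words determine \<open>\<sigma>\<close>, because a cell is filled monotonically
  (\<open>words_determine_permutation\<close>); and any two words whose letter counts fit together come from a
  gridded permutation (\<open>permutation_with_words\<close>).

  Let \<open>\<Gamma> = (\<gamma>\<^sub>i\<^sub>j)\<close> be the maximal distribution, with column sums \<open>c\<^sub>i\<close> and row sums \<open>r\<^sub>j\<close>, and let \<open>S\<close> be the logarithm of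
  the maximum of \<open>g\<close>. Stationarity says that \<open>c\<^sub>i r\<^sub>j = exp S * \<gamma>\<^sub>i\<^sub>j\<^sup>2\<close> in every non-blank cell
  (\<open>max_entropy_balanced\<close>). Choose the letters of the words independently: a point in column \<open>i\<close> gets row \<open>j\<close>
  with probability \<open>\<gamma>\<^sub>i\<^sub>j / c\<^sub>i\<close>, a point in row \<open>j\<close> gets column \<open>i\<close> with probability \<open>\<gamma>\<^sub>i\<^sub>j / r\<^sub>j\<close>. Each point
  contributes one letter to each word, and the product of its two probabilities is \<open>exp (- S)\<close>, whatever its
  cell. So every gridded permutation has weight exactly \<open>exp (- n S)\<close> (\<open>weight_of_words\<close>), and for
  given cuts the number of gridded permutations with some property is at most \<open>exp (n S)\<close> times the probability that independent words have it.

  By a Chernoff bound, outside a set of probability \<open>exp (- \<kappa> n)\<close> up to polynomial factors, every prefix of the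
  words contains each letter about as often as expected; call such gridded permutations evenly spread. There are
  only polynomially many choices of cuts, so at most \<open>exp (n (S - \<kappa>))\<close> permutations, again up to polynomial
  factors, lack an evenly spread gridding (\<open>card_uneven\<close>). On the other hand the multinomial count of the words with
  letter counts close to \<open>n \<Gamma>\<close> gives \<open>exp (n (S - \<delta>))\<close> permutations for every \<open>\<delta> > 0\<close> (\<open>card_Grid_lower_bound\<close>).
  Hence a random permutation of \<open>Grid M n\<close> has an evenly spread gridding with probability tending to one.

  Even spread forces the shape. Within a column or a row the numbers of points in the cells are nearly
  proportional to the entries of \<open>\<Gamma>\<close>; as \<open>M\<close> is connected, the factor of proportionality is the same everywhere, so
  it is \<open>n\<close> (\<open>ratio_lim\<close>) and the cuts are close to those of \<open>\<mu>\<^sub>M\<close>. The prefix counts then place the \<open>k\<close>th of the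
  \<open>a\<close> points of a cell near the point of the segment \<open>L(i, j)\<close> with parameter \<open>k / a\<close> (\<open>point_close\<close>), and integrals of
  continuous functions converge as Riemann sums (\<open>integral_perm_permuton_lim\<close>). A weak neighbourhood of \<open>\<mu>\<^sub>M\<close> involves
  finitely many such integrals, so convergence in distribution follows.
\<close>

section \<open>Entropy and the maximal distribution\<close>

lemma continuous_on_mult_ln: "continuous_on {0..} (\<lambda>x::real. x * ln x)"
proof -
  have "continuous (at x within {0..}) (\<lambda>x::real. x * ln x)" if "x \<ge> 0" for x
  proof (cases "x = 0")
    case True
    have "((\<lambda>x::real. x * ln x) \<longlongrightarrow> 0) (at_right 0)"
      by real_asymp
    moreover have "at (0::real) within {0..} = at_right 0"
    proof (rule at_within_nhd[where S = UNIV])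
      show "{0..} \<inter> UNIV - {0::real} = {0<..} \<inter> UNIV - {0}" by auto
    qed auto
    ultimately show ?thesis
      using True by (simp add: continuous_within)
  qed (use that in \<open>auto intro!: continuous_intros\<close>)
  then show ?thesis
    by (simp add: continuous_on_eq_continuous_within)
qed

text \<open>
  The function \<open>x ln x\<close> is convex, so its graph lies above its tangents. At \<open>y = 0\<close> this uses \<open>ln 0 = 0\<close>.
\<close>

lemma mult_ln_tangent:
  assumes "x > 0" "y \<ge> (0::real)"
  shows "x * ln x + (y - x) * (ln x + 1) \<le> y * ln y"
proof (cases "y = 0")
  case False
  then have "ln (x / y) \<le> x / y - 1"
    using assms by (intro ln_le_minus_one) auto
  then have "y * (ln x - ln y) \<le> y * (x / y - 1)"
    using assms False by (intro mult_left_mono) (auto simp: ln_div)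
  then show ?thesis
    using False assms by (simp add: algebra_simps)
qed (use assms in \<open>auto simp: algebra_simps\<close>)

text \<open>
  This is \<open>ln g(\<Gamma>)\<close>. As \<open>0 * ln 0 = 0\<close> in HOL, empty lines and cells contribute nothing, as \<open>0\<^sup>0 = 1\<close> requires.
\<close>

definition grid_entropy :: "gridding_matrix \<Rightarrow> (nat \<Rightarrow> nat \<Rightarrow> real) \<Rightarrow> real" where
  "grid_entropy M \<Gamma> =
     (\<Sum>i=1..ncols M. col_sum M \<Gamma> i * ln (col_sum M \<Gamma> i)) +
     (\<Sum>j=1..nrows M. row_sum M \<Gamma> j * ln (row_sum M \<Gamma> j)) -
     2 * (\<Sum>i=1..ncols M. \<Sum>j=1..nrows M. \<Gamma> i j * ln (\<Gamma> i j))"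

lemma rpow_mult_self: "0 \<le> x \<Longrightarrow> rpow x (k * x) = exp (k * (x * ln x))"
  by (auto simp: rpow_def powr_def)

lemma col_sum_nonneg: "(\<And>i j. 0 \<le> \<Gamma> i j) \<Longrightarrow> 0 \<le> col_sum M \<Gamma> i"
  by (simp add: col_sum_def sum_nonneg)

lemma row_sum_nonneg: "(\<And>i j. 0 \<le> \<Gamma> i j) \<Longrightarrow> 0 \<le> row_sum M \<Gamma> j"
  by (simp add: row_sum_def sum_nonneg)

lemma grid_weight_eq_exp_grid_entropy:
  assumes "\<And>i j. 0 \<le> \<Gamma> i j"
  shows "grid_weight M \<Gamma> = exp (grid_entropy M \<Gamma>)"
  using rpow_mult_self[OF col_sum_nonneg[of \<Gamma>, OF assms], where k = 1]
    rpow_mult_self[OF row_sum_nonneg[of \<Gamma>, OF assms], where k = 1]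
    rpow_mult_self[of "\<Gamma> _ _", OF assms, where k = 2]
  by (simp add: grid_weight_def grid_entropy_def exp_add exp_diff exp_sum sum_distrib_left)

lemma sum_row_sum: "(\<Sum>j=1..nrows M. row_sum M \<Gamma> j) = (\<Sum>i=1..ncols M. \<Sum>j=1..nrows M. \<Gamma> i j)"
  unfolding row_sum_def by (rule sum.swap)

text \<open>
  Scaling by \<open>k\<close> adds \<open>k ln k\<close> times the total once for the columns, once for the rows and subtracts it twice for the
  entries. Homogeneity of degree one allows \<open>\<Gamma>\<close> to be compared with matrices whose entries do not sum to one,
  which replaces a Lagrange multiplier.
\<close>

lemma grid_entropy_scale:
  assumes "k > 0" "\<And>i j. 0 \<le> \<Gamma> i j"
  shows "grid_entropy M (\<lambda>i j. k * \<Gamma> i j) = k * grid_entropy M \<Gamma>"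
proof -
  have *: "(k * x) * ln (k * x) = k * (x * ln x) + k * ln k * x" if "x \<ge> 0" for x
    using that assms(1) by (cases "x = 0") (auto simp: ln_mult algebra_simps)
  have c: "col_sum M (\<lambda>i j. k * \<Gamma> i j) i = k * col_sum M \<Gamma> i" for i
    by (simp add: col_sum_def sum_distrib_left)
  have r: "row_sum M (\<lambda>i j. k * \<Gamma> i j) j = k * row_sum M \<Gamma> j" for j
    by (simp add: row_sum_def sum_distrib_left)
  have "(\<Sum>i=1..ncols M. col_sum M \<Gamma> i) = (\<Sum>i=1..ncols M. \<Sum>j=1..nrows M. \<Gamma> i j)"
    by (simp add: col_sum_def)
  then show ?thesis
    unfolding grid_entropy_def c r
    by (simp add: * assms(2) col_sum_nonneg row_sum_nonneg sum.distrib flip: sum_distrib_left)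
       (simp add: sum_row_sum[unfolded One_nat_def] algebra_simps)
qed

lemma sum_bump:
  fixes h :: "real \<Rightarrow> real"
  assumes "finite A" "a \<in> A"
  shows "(\<Sum>x\<in>A. h (f x + (if x = a then \<tau> else 0))) = (\<Sum>x\<in>A. h (f x)) + (h (f a + \<tau>) - h (f a))"
proof -
  have "(\<Sum>x\<in>A. h (f x + (if x = a then \<tau> else 0))) =
        (\<Sum>x\<in>A. h (f x) + (if x = a then h (f a + \<tau>) - h (f a) else 0))"
    by (intro sum.cong) auto
  then show ?thesis
    using assms by (simp add: sum.distrib)
qed

text \<open>
  The two conditions are nested, not joined by a conjunction, so that sums over either index simplify.
\<close>

definition add_mass :: "(nat \<Rightarrow> nat \<Rightarrow> real) \<Rightarrow> nat \<Rightarrow> nat \<Rightarrow> real \<Rightarrow> nat \<Rightarrow> nat \<Rightarrow> real" where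
  "add_mass \<Gamma> i j \<tau> = (\<lambda>i' j'. \<Gamma> i' j' + (if i' = i then if j' = j then \<tau> else 0 else 0))"

lemma
  assumes "(i, j) \<in> nonblank_cells M"
  shows col_sum_add_mass:
      "col_sum M (add_mass \<Gamma> i j \<tau>) i' = col_sum M \<Gamma> i' + (if i' = i then \<tau> else 0)"
    and row_sum_add_mass:
      "row_sum M (add_mass \<Gamma> i j \<tau>) j' = row_sum M \<Gamma> j' + (if j' = j then \<tau> else 0)"
proof -
  have ij: "i \<in> {1..ncols M}" "j \<in> {1..nrows M}"
    using assms by (auto simp: nonblank_cells_def)
  show "col_sum M (add_mass \<Gamma> i j \<tau>) i' = col_sum M \<Gamma> i' + (if i' = i then \<tau> else 0)"
    using ij by (simp add: col_sum_def add_mass_def sum.distrib)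
  show "row_sum M (add_mass \<Gamma> i j \<tau>) j' = row_sum M \<Gamma> j' + (if j' = j then \<tau> else 0)"
    using ij by (simp add: row_sum_def add_mass_def sum.distrib)
qed

lemma total_add_mass:
  assumes "(i, j) \<in> nonblank_cells M"
  shows "(\<Sum>i'=1..ncols M. \<Sum>j'=1..nrows M. add_mass \<Gamma> i j \<tau> i' j') =
         (\<Sum>i'=1..ncols M. \<Sum>j'=1..nrows M. \<Gamma> i' j') + \<tau>"
  using col_sum_add_mass[OF assms, of \<Gamma> \<tau>] assms
  by (auto simp: col_sum_def nonblank_cells_def sum.distrib)

lemma grid_entropy_add_mass:
  assumes "(i, j) \<in> nonblank_cells M"
  defines "h \<equiv> \<lambda>x::real. x * ln x"
  shows "grid_entropy M (add_mass \<Gamma> i j \<tau>) = grid_entropy M \<Gamma> +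
    (h (col_sum M \<Gamma> i + \<tau>) - h (col_sum M \<Gamma> i)) + (h (row_sum M \<Gamma> j + \<tau>) - h (row_sum M \<Gamma> j)) -
    2 * (h (\<Gamma> i j + \<tau>) - h (\<Gamma> i j))"
proof -
  have ij: "i \<in> {1..ncols M}" "j \<in> {1..nrows M}"
    using assms by (auto simp: nonblank_cells_def)
  have "(\<Sum>i'=1..ncols M. \<Sum>j'=1..nrows M. h (add_mass \<Gamma> i j \<tau> i' j')) =
        (\<Sum>i'=1..ncols M. (\<Sum>j'=1..nrows M. h (\<Gamma> i' j')) + (if i' = i then h (\<Gamma> i j + \<tau>) - h (\<Gamma> i j) else 0))"
  proof (intro sum.cong refl)
    fix i'
    show "(\<Sum>j'=1..nrows M. h (add_mass \<Gamma> i j \<tau> i' j')) = (\<Sum>j'=1..nrows M. h (\<Gamma> i' j')) +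
            (if i' = i then h (\<Gamma> i j + \<tau>) - h (\<Gamma> i j) else 0)"
      using sum_bump[OF finite_atLeastAtMost ij(2), of h "\<Gamma> i" \<tau>] by (auto simp: add_mass_def)
  qed
  then have "(\<Sum>i'=1..ncols M. \<Sum>j'=1..nrows M. h (add_mass \<Gamma> i j \<tau> i' j')) =
             (\<Sum>i'=1..ncols M. \<Sum>j'=1..nrows M. h (\<Gamma> i' j')) + (h (\<Gamma> i j + \<tau>) - h (\<Gamma> i j))"
    using ij by (simp add: sum.distrib)
  moreover have "(\<Sum>i'=1..ncols M. h (col_sum M (add_mass \<Gamma> i j \<tau>) i')) =
      (\<Sum>i'=1..ncols M. h (col_sum M \<Gamma> i')) + (h (col_sum M \<Gamma> i + \<tau>) - h (col_sum M \<Gamma> i))"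
    unfolding col_sum_add_mass[OF assms(1)] by (rule sum_bump[OF finite_atLeastAtMost ij(1)])
  moreover have "(\<Sum>j'=1..nrows M. h (row_sum M (add_mass \<Gamma> i j \<tau>) j')) =
      (\<Sum>j'=1..nrows M. h (row_sum M \<Gamma> j')) + (h (row_sum M \<Gamma> j + \<tau>) - h (row_sum M \<Gamma> j))"
    unfolding row_sum_add_mass[OF assms(1)] by (rule sum_bump[OF finite_atLeastAtMost ij(2)])
  ultimately show ?thesis
    unfolding grid_entropy_def h_def by simp
qed

lemma distribution_matrix_normalise:
  assumes "\<And>i j. 0 \<le> \<Gamma> i j" "\<And>i j. (i, j) \<notin> nonblank_cells M \<Longrightarrow> \<Gamma> i j = 0"
    and "(\<Sum>i=1..ncols M. \<Sum>j=1..nrows M. \<Gamma> i j) = s" "s > 0"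
  shows "distribution_matrix M (\<lambda>i j. (1 / s) * \<Gamma> i j)"
  using assms by (auto simp: distribution_matrix_def simp flip: sum_divide_distrib)

definition max_entropy :: "gridding_matrix \<Rightarrow> (nat \<Rightarrow> nat \<Rightarrow> real) \<Rightarrow> bool" where
  "max_entropy M \<Gamma> \<longleftrightarrow> distribution_matrix M \<Gamma> \<and>
     (\<forall>\<Gamma>'. distribution_matrix M \<Gamma>' \<longrightarrow> grid_entropy M \<Gamma>' \<le> grid_entropy M \<Gamma>)"

lemma max_entropy_iff_arg_max:
  "max_entropy M \<Gamma> \<longleftrightarrow> is_arg_max (grid_weight M) (distribution_matrix M) \<Gamma>"
proof -
  have "grid_weight M \<Gamma>' = exp (grid_entropy M \<Gamma>')" if "distribution_matrix M \<Gamma>'" for \<Gamma>'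
    using that by (intro grid_weight_eq_exp_grid_entropy) (auto simp: distribution_matrix_def)
  then show ?thesis
    unfolding max_entropy_def is_arg_max_linorder by (metis exp_le_cancel_iff)
qed

text \<open>
  The enlarged matrix has total \<open>1 + \<tau>\<close>; maximality applies after division by \<open>1 + \<tau>\<close>, and homogeneity undoes it.
\<close>

lemma max_entropy_add_mass_le:
  assumes "max_entropy M \<Gamma>" "(i, j) \<in> nonblank_cells M" "\<tau> > 0"
  shows "grid_entropy M (add_mass \<Gamma> i j \<tau>) \<le> (1 + \<tau>) * grid_entropy M \<Gamma>"
proof -
  have D: "distribution_matrix M \<Gamma>" using assms(1) by (simp add: max_entropy_def)
  let ?G = "add_mass \<Gamma> i j \<tau>"
  have nn: "0 \<le> ?G i' j'" for i' j'
    using D assms(3) by (auto simp: distribution_matrix_def add_mass_def)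
  have "distribution_matrix M (\<lambda>i' j'. 1 / (1 + \<tau>) * ?G i' j')"
  proof (rule distribution_matrix_normalise[OF nn])
    show "?G i' j' = 0" if "(i', j') \<notin> nonblank_cells M" for i' j'
      using that D assms(2) by (auto simp: distribution_matrix_def add_mass_def)
  qed (use D assms(3) total_add_mass[OF assms(2)] in \<open>auto simp: distribution_matrix_def\<close>)
  then have "grid_entropy M (\<lambda>i' j'. 1 / (1 + \<tau>) * ?G i' j') \<le> grid_entropy M \<Gamma>"
    using assms(1) by (auto simp: max_entropy_def)
  then have "1 / (1 + \<tau>) * grid_entropy M ?G \<le> grid_entropy M \<Gamma>"
    using grid_entropy_scale[of "1 / (1 + \<tau>)" ?G M] nn assms(3) by simp
  then show ?thesis
    using assms(3) by (simp add: pos_divide_le_eq mult.commute)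
qed

lemma le_sum_line:
  assumes "distribution_matrix M \<Gamma>" "(i, j) \<in> nonblank_cells M"
  shows "\<Gamma> i j \<le> col_sum M \<Gamma> i" "\<Gamma> i j \<le> row_sum M \<Gamma> j"
proof -
  have "i \<in> {1..ncols M}" "j \<in> {1..nrows M}" "\<And>i j. 0 \<le> \<Gamma> i j"
    using assms by (auto simp: nonblank_cells_def distribution_matrix_def)
  then show "\<Gamma> i j \<le> col_sum M \<Gamma> i" "\<Gamma> i j \<le> row_sum M \<Gamma> j"
    unfolding col_sum_def row_sum_def
    using member_le_sum[of j "{1..nrows M}" "\<Gamma> i"] member_le_sum[of i "{1..ncols M}" "\<lambda>i. \<Gamma> i j"]
    by auto
qed

text \<open>
  A small mass \<open>\<tau>\<close> put into an empty cell on an occupied line raises the entropy by at least \<open>- \<tau> ln \<tau>\<close> up to terms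
  linear in \<open>\<tau>\<close>, more than the \<open>\<tau> S\<close> that maximality permits. The cell lies on two lines: if both are
  occupied the gain is twice that, and if one is empty its own term \<open>\<tau> ln \<tau>\<close> cancels half of it.
\<close>

lemma max_entropy_pos_step:
  assumes max: "max_entropy M \<Gamma>" and cell: "(i, j) \<in> nonblank_cells M"
    and line: "col_sum M \<Gamma> i > 0 \<or> row_sum M \<Gamma> j > 0"
  shows "\<Gamma> i j > 0"
proof (rule ccontr)
  assume "\<not> \<Gamma> i j > 0"
  have D: "distribution_matrix M \<Gamma>" using max by (simp add: max_entropy_def)
  have "0 \<le> \<Gamma> i j" using D by (simp add: distribution_matrix_def)
  then have 0: "\<Gamma> i j = 0" using \<open>\<not> \<Gamma> i j > 0\<close> by simp
  define S where "S = grid_entropy M \<Gamma>"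
  define h where "h = (\<lambda>x::real. x * ln x)"
  have nn: "0 \<le> col_sum M \<Gamma> i" "0 \<le> row_sum M \<Gamma> j"
    using D by (auto simp: distribution_matrix_def intro!: col_sum_nonneg row_sum_nonneg)
  have gain: "(h (col_sum M \<Gamma> i + \<tau>) - h (col_sum M \<Gamma> i)) +
      (h (row_sum M \<Gamma> j + \<tau>) - h (row_sum M \<Gamma> j)) - 2 * h \<tau> \<le> \<tau> * S" if "\<tau> > 0" for \<tau>
    using max_entropy_add_mass_le[OF max cell that] grid_entropy_add_mass[OF cell, of \<Gamma> \<tau>] 0
    by (simp add: S_def h_def algebra_simps)
  have lower: "\<tau> * (ln x + 1) \<le> h (x + \<tau>) - h x" if "x > 0" "\<tau> > 0" for x \<tau>
    using mult_ln_tangent[of x "x + \<tau>"] that by (simp add: h_def algebra_simps)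
  \<comment> \<open>\<open>B = - ln \<tau>\<close> exceeds all other terms of the rate of change\<close>
  define B where "B = \<bar>S\<bar> + \<bar>ln (col_sum M \<Gamma> i)\<bar> + \<bar>ln (row_sum M \<Gamma> j)\<bar> + 3"
  have B: "S < ln (col_sum M \<Gamma> i) + ln (row_sum M \<Gamma> j) + 2 + 2 * B"
    "S < ln (col_sum M \<Gamma> i) + 1 + B" "S < ln (row_sum M \<Gamma> j) + 1 + B"
    by (simp_all add: B_def)
  define \<tau> where "\<tau> = exp (- B)"
  have \<tau>: "\<tau> > 0" "ln \<tau> = - B" "h \<tau> = - \<tau> * B" by (auto simp: \<tau>_def h_def)
  have h0: "h 0 = 0" by (simp add: h_def)
  have cancel: "x \<le> S" if "\<tau> * x \<le> \<tau> * S" for x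
    using that \<tau>(1) by (simp add: mult_le_cancel_left_pos)
  consider "col_sum M \<Gamma> i > 0" "row_sum M \<Gamma> j > 0" | "col_sum M \<Gamma> i > 0" "row_sum M \<Gamma> j = 0"
    | "col_sum M \<Gamma> i = 0" "row_sum M \<Gamma> j > 0"
    using nn line by fastforce
  then show False
  proof cases
    case 1
    have "\<tau> * (ln (col_sum M \<Gamma> i) + ln (row_sum M \<Gamma> j) + 2 + 2 * B) =
          \<tau> * (ln (col_sum M \<Gamma> i) + 1) + \<tau> * (ln (row_sum M \<Gamma> j) + 1) - 2 * h \<tau>"
      unfolding \<tau>(3) by (simp add: algebra_simps)
    also have "\<dots> \<le> \<tau> * S"
      using gain[OF \<tau>(1)] lower[OF 1(1) \<tau>(1)] lower[OF 1(2) \<tau>(1)] by linarith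
    finally show False using B by (auto dest: cancel)
  next
    case 2
    have "\<tau> * (ln (col_sum M \<Gamma> i) + 1 + B) = \<tau> * (ln (col_sum M \<Gamma> i) + 1) - h \<tau>"
      unfolding \<tau>(3) by (simp add: algebra_simps)
    also have "\<dots> \<le> \<tau> * S"
      using gain[OF \<tau>(1)] lower[OF 2(1) \<tau>(1)] h0 2(2) by simp
    finally show False using B by (auto dest: cancel)
  next
    case 3
    have "\<tau> * (ln (row_sum M \<Gamma> j) + 1 + B) = \<tau> * (ln (row_sum M \<Gamma> j) + 1) - h \<tau>"
      unfolding \<tau>(3) by (simp add: algebra_simps)
    also have "\<dots> \<le> \<tau> * S"
      using gain[OF \<tau>(1)] lower[OF 3(2) \<tau>(1)] h0 3(1) by simp
    finally show False using B by (auto dest: cancel)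
  qed
qed

text \<open>
  The form in which connectedness is used: adjacent cells share a line, so a property that passes between
  any two non-blank cells of a column, and of a row, passes from one non-blank cell to all of them.
\<close>

lemma nonblank_walk_induct:
  assumes "connected_gridding_matrix M" "(i\<^sub>0, j\<^sub>0) \<in> nonblank_cells M" "P i\<^sub>0 j\<^sub>0"
    and "\<And>i j j'. (i, j) \<in> nonblank_cells M \<Longrightarrow> (i, j') \<in> nonblank_cells M \<Longrightarrow> P i j \<Longrightarrow> P i j'"
    and "\<And>i i' j. (i, j) \<in> nonblank_cells M \<Longrightarrow> (i', j) \<in> nonblank_cells M \<Longrightarrow> P i j \<Longrightarrow> P i' j"
    and "(k, l) \<in> nonblank_cells M"
  shows "P k l"
proof -
  have "((i\<^sub>0, j\<^sub>0), (k, l)) \<in> (cell_graph_edges M)\<^sup>*"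
    using assms(1,2,6) by (simp add: connected_gridding_matrix_def)
  then show ?thesis
  proof (induction rule: rtrancl_induct2)
    case (step i j i' j')
    then have "(i, j) \<in> nonblank_cells M" "(i', j') \<in> nonblank_cells M" "i = i' \<or> j = j'"
      by (auto simp: cell_graph_edges_def)
    then show ?case
      using assms(4)[of i j j'] assms(5)[of i j i'] step.IH by blast
  qed (rule assms(3))
qed

lemma distribution_sum_cells:
  "(\<Sum>i=1..ncols M. \<Sum>j=1..nrows M. h i j) = (\<Sum>(i, j)\<in>{1..ncols M} \<times> {1..nrows M}. h i j)"
  by (simp add: sum.cartesian_product)

lemma max_entropy_pos:
  assumes con: "connected_gridding_matrix M" and max: "max_entropy M \<Gamma>"
    and cell: "(i, j) \<in> nonblank_cells M"
  shows "\<Gamma> i j > 0"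
proof -
  have D: "distribution_matrix M \<Gamma>" using max by (simp add: max_entropy_def)
  have "\<exists>i j. (i, j) \<in> nonblank_cells M \<and> \<Gamma> i j > 0"
  proof (rule ccontr)
    assume none: "\<not> ?thesis"
    have "\<Gamma> i j = 0" for i j
    proof (cases "(i, j) \<in> nonblank_cells M")
      case True
      then have "\<not> 0 < \<Gamma> i j" "0 \<le> \<Gamma> i j"
        using none D by (auto simp: distribution_matrix_def)
      then show ?thesis by simp
    qed (use D in \<open>simp add: distribution_matrix_def\<close>)
    then show False
      using D by (simp add: distribution_matrix_def)
  qed
  then obtain k l where v: "(k, l) \<in> nonblank_cells M" "\<Gamma> k l > 0" by auto
  show ?thesis
  proof (rule nonblank_walk_induct[where P = "\<lambda>i j. \<Gamma> i j > 0", OF con v _ _ cell])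
    fix i j j' assume *: "(i, j) \<in> nonblank_cells M" "(i, j') \<in> nonblank_cells M" "\<Gamma> i j > 0"
    show "\<Gamma> i j' > 0"
      using le_sum_line(1)[OF D *(1)] *(3) by (intro max_entropy_pos_step[OF max *(2)]) auto
  next
    fix i i' j assume *: "(i, j) \<in> nonblank_cells M" "(i', j) \<in> nonblank_cells M" "\<Gamma> i j > 0"
    show "\<Gamma> i' j > 0"
      using le_sum_line(2)[OF D *(1)] *(3) by (intro max_entropy_pos_step[OF max *(2)]) auto
  qed
qed

text \<open>
  Adding mass to the cell \<open>(i, j)\<close> changes the entropy at the rate \<open>d i j = ln (c\<^sub>i r\<^sub>j / \<gamma>\<^sub>i\<^sub>j\<^sup>2)\<close>, which is at most \<open>S\<close> by
  \<open>max_entropy_add_mass_le\<close>. The average of the rates with weights \<open>\<gamma>\<^sub>i\<^sub>j\<close> is the entropy \<open>S\<close> itself, and all weights are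
  positive, so every rate equals \<open>S\<close>.
\<close>

lemma max_entropy_balanced:
  assumes con: "connected_gridding_matrix M" and max: "max_entropy M \<Gamma>"
    and cell: "(i, j) \<in> nonblank_cells M"
  shows "col_sum M \<Gamma> i * row_sum M \<Gamma> j = exp (grid_entropy M \<Gamma>) * (\<Gamma> i j)\<^sup>2"
proof -
  have D: "distribution_matrix M \<Gamma>" using max by (simp add: max_entropy_def)
  define S where "S = grid_entropy M \<Gamma>"
  define h where "h = (\<lambda>x::real. x * ln x)"
  define d where "d = (\<lambda>i j. ln (col_sum M \<Gamma> i) + ln (row_sum M \<Gamma> j) - 2 * ln (\<Gamma> i j))"
  have pos: "\<Gamma> i j > 0" "col_sum M \<Gamma> i > 0" "row_sum M \<Gamma> j > 0" if "(i, j) \<in> nonblank_cells M" for i j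
    using max_entropy_pos[OF con max that] le_sum_line[OF D that] by auto
  \<comment> \<open>the one-sided derivative of the entropy in the direction of a cell is at most \<open>S\<close>\<close>
  have le: "d i j \<le> S" if cell: "(i, j) \<in> nonblank_cells M" for i j
  proof -
    note p = pos[OF cell]
    have bound: "ln (col_sum M \<Gamma> i) + ln (row_sum M \<Gamma> j) - 2 * ln (\<Gamma> i j + \<tau>) \<le> S" if "\<tau> > 0" for \<tau>
    proof -
      have arith: "\<Delta> \<le> D \<Longrightarrow> C + R - 2 * \<Delta> \<le> s \<Longrightarrow> x \<le> C \<Longrightarrow> y \<le> R \<Longrightarrow> x + y - 2 * D \<le> s"
        for C R D \<Delta> s x y :: real by linarith
      have tangent: "\<tau> * (ln x + 1) \<le> h (x + \<tau>) - h x" if "x > 0" for x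
        using mult_ln_tangent[of x "x + \<tau>"] that \<open>\<tau> > 0\<close> by (simp add: h_def)
      have "h (\<Gamma> i j + \<tau>) - h (\<Gamma> i j) \<le> \<tau> * (ln (\<Gamma> i j + \<tau>) + 1)"
        using mult_ln_tangent[of "\<Gamma> i j + \<tau>" "\<Gamma> i j"] p(1) that by (simp add: h_def)
      moreover have "(h (col_sum M \<Gamma> i + \<tau>) - h (col_sum M \<Gamma> i)) +
        (h (row_sum M \<Gamma> j + \<tau>) - h (row_sum M \<Gamma> j)) - 2 * (h (\<Gamma> i j + \<tau>) - h (\<Gamma> i j)) \<le> \<tau> * S"
        using max_entropy_add_mass_le[OF max cell that] grid_entropy_add_mass[OF cell, of \<Gamma> \<tau>]
        unfolding S_def h_def by (simp only: distrib_right mult_1_left)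
      ultimately have "\<tau> * (ln (col_sum M \<Gamma> i) + 1) + \<tau> * (ln (row_sum M \<Gamma> j) + 1) -
          2 * (\<tau> * (ln (\<Gamma> i j + \<tau>) + 1)) \<le> \<tau> * S"
        using arith[OF _ _ tangent[OF p(2)] tangent[OF p(3)]] by blast
      then have "\<tau> * (ln (col_sum M \<Gamma> i) + ln (row_sum M \<Gamma> j) - 2 * ln (\<Gamma> i j + \<tau>)) \<le> \<tau> * S"
        by (simp add: algebra_simps)
      then show ?thesis by (rule mult_left_le_imp_le[OF _ that])
    qed
    have "((\<lambda>\<tau>. ln (col_sum M \<Gamma> i) + ln (row_sum M \<Gamma> j) - 2 * ln (\<Gamma> i j + \<tau>)) \<longlongrightarrow>
        ln (col_sum M \<Gamma> i) + ln (row_sum M \<Gamma> j) - 2 * ln (\<Gamma> i j + 0)) (at_right 0)"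
      using p by (intro tendsto_intros) auto
    moreover have "\<forall>\<^sub>F \<tau> in at_right 0. ln (col_sum M \<Gamma> i) + ln (row_sum M \<Gamma> j) - 2 * ln (\<Gamma> i j + \<tau>) \<le> S"
      using eventually_at_right_less by (rule eventually_mono) (rule bound)
    ultimately have "ln (col_sum M \<Gamma> i) + ln (row_sum M \<Gamma> j) - 2 * ln (\<Gamma> i j + 0) \<le> S"
      by (rule tendsto_upperbound) simp
    then show ?thesis by (simp add: d_def)
  qed
  \<comment> \<open>but the average of these derivatives is \<open>S\<close>\<close>
  have "(\<Sum>i=1..ncols M. h (col_sum M \<Gamma> i)) = (\<Sum>i=1..ncols M. \<Sum>j=1..nrows M. \<Gamma> i j * ln (col_sum M \<Gamma> i))"
    by (simp add: h_def col_sum_def sum_distrib_right)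
  moreover have "(\<Sum>j=1..nrows M. h (row_sum M \<Gamma> j)) = (\<Sum>i=1..ncols M. \<Sum>j=1..nrows M. \<Gamma> i j * ln (row_sum M \<Gamma> j))"
    unfolding h_def row_sum_def sum_distrib_right by (rule sum.swap)
  ultimately have "S = (\<Sum>i=1..ncols M. \<Sum>j=1..nrows M. \<Gamma> i j * d i j)"
    unfolding S_def grid_entropy_def d_def h_def
    by (simp add: distrib_left right_diff_distrib sum.distrib sum_subtractf sum_distrib_left mult.left_commute)
  moreover have "S = (\<Sum>i=1..ncols M. \<Sum>j=1..nrows M. \<Gamma> i j * S)"
    using D by (simp add: distribution_matrix_def flip: sum_distrib_right)
  ultimately have "(\<Sum>i=1..ncols M. \<Sum>j=1..nrows M. \<Gamma> i j * (S - d i j)) = 0"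
    by (simp add: right_diff_distrib sum_subtractf)
  moreover have nn: "0 \<le> \<Gamma> i j * (S - d i j)" for i j
    using D le[of i j] by (cases "(i, j) \<in> nonblank_cells M") (auto simp: distribution_matrix_def)
  ultimately have "\<Gamma> i j * (S - d i j) = 0"
    using cell unfolding distribution_sum_cells
    by (subst (asm) sum_nonneg_eq_0_iff) (auto simp: nonblank_cells_def)
  then have "ln (col_sum M \<Gamma> i) + ln (row_sum M \<Gamma> j) - 2 * ln (\<Gamma> i j) = S"
    using pos[OF cell] by (simp add: d_def)
  then have "ln (col_sum M \<Gamma> i * row_sum M \<Gamma> j) = ln (exp S * (\<Gamma> i j)\<^sup>2)"
    using pos[OF cell] by (simp add: ln_mult ln_realpow)
  then show ?thesis
    using pos[OF cell] unfolding S_def by (subst (asm) ln_inj_iff) auto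
qed

text \<open>
  A maximum principle for the ratios \<open>\<gamma>'\<^sub>i\<^sub>j / \<gamma>\<^sub>i\<^sub>j\<close> of two maximisers. By the balance equation the square of a ratio is
  the product of the ratios of the two line sums, and these are averages of ratios along the lines. So where
  the ratio is largest it equals the averages over its column and row, hence it is constant on both lines,
  and by connectedness constant on all cells.
\<close>

lemma max_entropy_unique:
  assumes con: "connected_gridding_matrix M" and max: "max_entropy M \<Gamma>" "max_entropy M \<Gamma>'"
  shows "\<Gamma>' = \<Gamma>"
proof -
  have D: "distribution_matrix M \<Gamma>" "distribution_matrix M \<Gamma>'"
    using max by (auto simp: max_entropy_def)
  have S: "grid_entropy M \<Gamma>' = grid_entropy M \<Gamma>"
    using max by (auto simp: max_entropy_def intro: antisym)
  note pos = max_entropy_pos[OF con max(1)] max_entropy_pos[OF con max(2)]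
  define x where "x = (\<lambda>(i, j). \<Gamma>' i j / \<Gamma> i j)"
  define X where "X = Max (x ` nonblank_cells M)"
  have fin: "finite (nonblank_cells M)"
    by (rule finite_subset[of _ "{1..ncols M} \<times> {1..nrows M}"]) (auto simp: nonblank_cells_def)
  have ne: "nonblank_cells M \<noteq> {}" using con by (simp add: connected_gridding_matrix_def)
  have xle: "\<Gamma>' i j \<le> X * \<Gamma> i j" for i j
  proof (cases "(i, j) \<in> nonblank_cells M")
    case True
    then have "x (i, j) \<le> X" using fin by (auto simp: X_def)
    then show ?thesis using pos[OF True] by (simp add: x_def field_simps)
  qed (use D in \<open>auto simp: distribution_matrix_def\<close>)
  have line: "col_sum M \<Gamma>' i = X * col_sum M \<Gamma> i \<and> row_sum M \<Gamma>' j = X * row_sum M \<Gamma> j"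
    if cell: "(i, j) \<in> nonblank_cells M" and eq: "\<Gamma>' i j = X * \<Gamma> i j" for i j
  proof -
    have "X > 0" using eq pos[OF cell] by (simp add: zero_less_mult_iff)
    have le: "col_sum M \<Gamma>' i \<le> X * col_sum M \<Gamma> i" "row_sum M \<Gamma>' j \<le> X * row_sum M \<Gamma> j"
      unfolding col_sum_def row_sum_def sum_distrib_left by (intro sum_mono xle)+
    have p: "col_sum M \<Gamma> i > 0" "row_sum M \<Gamma> j > 0" "col_sum M \<Gamma>' i > 0" "row_sum M \<Gamma>' j > 0"
      using pos[OF cell] le_sum_line[OF D(1) cell] le_sum_line[OF D(2) cell] by auto
    have "col_sum M \<Gamma>' i * row_sum M \<Gamma>' j = (X * col_sum M \<Gamma> i) * (X * row_sum M \<Gamma> j)"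
      using max_entropy_balanced[OF con max(1) cell] max_entropy_balanced[OF con max(2) cell] S eq
      by (simp add: power2_eq_square algebra_simps)
    moreover have "col_sum M \<Gamma>' i * row_sum M \<Gamma>' j < (X * col_sum M \<Gamma> i) * (X * row_sum M \<Gamma> j)"
      if "col_sum M \<Gamma>' i < X * col_sum M \<Gamma> i \<or> row_sum M \<Gamma>' j < X * row_sum M \<Gamma> j"
      using that le p \<open>X > 0\<close> by (auto intro: mult_less_le_imp_less mult_le_less_imp_less)
    ultimately show ?thesis using le by fastforce
  qed
  have "X \<in> x ` nonblank_cells M" using fin ne by (auto simp: X_def)
  then obtain k l where v: "(k, l) \<in> nonblank_cells M" "\<Gamma>' k l = X * \<Gamma> k l"
    using pos by (fastforce simp: x_def)
  have ratio: "\<Gamma>' i j = X * \<Gamma> i j" if cell: "(i, j) \<in> nonblank_cells M" for i j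
  proof (rule nonblank_walk_induct[where P = "\<lambda>i j. \<Gamma>' i j = X * \<Gamma> i j", OF con v _ _ cell])
    fix i j j' assume cells: "(i, j) \<in> nonblank_cells M" "(i, j') \<in> nonblank_cells M"
      and eq: "\<Gamma>' i j = X * \<Gamma> i j"
    have "(\<Sum>j=1..nrows M. X * \<Gamma> i j - \<Gamma>' i j) = 0"
      using line[OF cells(1)] eq by (simp add: col_sum_def sum_subtractf sum_distrib_left)
    then have "X * \<Gamma> i j' - \<Gamma>' i j' = 0"
      using xle cells by (subst (asm) sum_nonneg_eq_0_iff) (auto simp: nonblank_cells_def)
    then show "\<Gamma>' i j' = X * \<Gamma> i j'" by simp
  next
    fix i i' j assume cells: "(i, j) \<in> nonblank_cells M" "(i', j) \<in> nonblank_cells M"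
      and eq: "\<Gamma>' i j = X * \<Gamma> i j"
    have "(\<Sum>i=1..ncols M. X * \<Gamma> i j - \<Gamma>' i j) = 0"
      using line[OF cells(1)] eq by (simp add: row_sum_def sum_subtractf sum_distrib_left)
    then have "X * \<Gamma> i' j - \<Gamma>' i' j = 0"
      using xle cells by (subst (asm) sum_nonneg_eq_0_iff) (auto simp: nonblank_cells_def)
    then show "\<Gamma>' i' j = X * \<Gamma> i' j" by simp
  qed
  have eq: "\<Gamma>' i j = X * \<Gamma> i j" for i j
    using ratio[of i j] D by (cases "(i, j) \<in> nonblank_cells M") (auto simp: distribution_matrix_def)
  have "(\<Sum>i=1..ncols M. \<Sum>j=1..nrows M. \<Gamma>' i j) = X * (\<Sum>i=1..ncols M. \<Sum>j=1..nrows M. \<Gamma> i j)"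
    by (simp add: eq sum_distrib_left)
  then have "X = 1"
    using D by (simp add: distribution_matrix_def)
  then show ?thesis using eq by (simp add: fun_eq_iff)
qed

text \<open>
  The distribution matrices form a compact set and the entropy is continuous. Matrices are curried elsewhere;
  here they are functions of pairs, so that Tychonoff's theorem applies to them.
\<close>

lemma max_entropy_exists:
  assumes "nonblank_cells M \<noteq> {}"
  shows "\<exists>\<Gamma>. max_entropy M \<Gamma>"
proof -
  define K where "K = {g :: nat \<times> nat \<Rightarrow> real. distribution_matrix M (\<lambda>i j. g (i, j))}"
  define B where "B = (\<Pi>\<^sub>E v\<in>(UNIV :: (nat \<times> nat) set). if v \<in> nonblank_cells M then {0..1::real} else {0})"
  have KB: "K = B \<inter> {g. (\<Sum>i=1..ncols M. \<Sum>j=1..nrows M. g (i, j)) = 1}"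
  proof (intro equalityI subsetI)
    fix g assume g: "g \<in> K"
    then have D: "distribution_matrix M (\<lambda>i j. g (i, j))" by (simp add: K_def)
    have "g (i, j) \<le> 1" if "(i, j) \<in> nonblank_cells M" for i j
    proof -
      have "g (i, j) \<le> (\<Sum>(i, j)\<in>{1..ncols M} \<times> {1..nrows M}. g (i, j))"
        using D that member_le_sum[of "(i, j)" "{1..ncols M} \<times> {1..nrows M}" g]
        by (auto simp: nonblank_cells_def distribution_matrix_def)
      then show ?thesis using D by (simp add: distribution_matrix_def sum.cartesian_product)
    qed
    then show "g \<in> B \<inter> {g. (\<Sum>i=1..ncols M. \<Sum>j=1..nrows M. g (i, j)) = 1}"
      using D by (auto simp: B_def distribution_matrix_def)
  next
    fix g assume "g \<in> B \<inter> {g. (\<Sum>i=1..ncols M. \<Sum>j=1..nrows M. g (i, j)) = 1}"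
    then have g: "g \<in> B" "(\<Sum>i=1..ncols M. \<Sum>j=1..nrows M. g (i, j)) = 1" by auto
    have "g (i, j) \<in> (if (i, j) \<in> nonblank_cells M then {0..1} else {0})" for i j
      using PiE_mem[OF g(1)[unfolded B_def], of "(i, j)"] by simp
    then have "0 \<le> g (i, j)" "(i, j) \<notin> nonblank_cells M \<Longrightarrow> g (i, j) = 0" for i j
      by (metis atLeastAtMost_iff empty_iff insert_iff order_refl)+
    then show "g \<in> K"
      using g(2) by (simp add: K_def distribution_matrix_def)
  qed
  have "compactin (product_topology (\<lambda>_. euclidean) UNIV) B"
    unfolding B_def by (subst compactin_PiE) auto
  then have "compact B" by (simp add: euclidean_product_topology)
  moreover have "closed {g :: nat \<times> nat \<Rightarrow> real. (\<Sum>i=1..ncols M. \<Sum>j=1..nrows M. g (i, j)) = 1}"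
    by (intro closed_Collect_eq continuous_intros continuous_on_product_coordinates)
  ultimately have "compact K" unfolding KB by (rule compact_Int_closed)
  moreover have "K \<noteq> {}"
  proof -
    obtain i j where ij: "(i, j) \<in> nonblank_cells M" using assms by auto
    then have "(\<lambda>(i', j'). add_mass (\<lambda>_ _. 0) i j 1 i' j') \<in> K"
      using total_add_mass[OF ij, of "\<lambda>_ _. 0" 1] by (auto simp: K_def distribution_matrix_def add_mass_def)
    then show ?thesis by auto
  qed
  moreover have "continuous_on K (\<lambda>g. grid_entropy M (\<lambda>i j. g (i, j)))"
  proof -
    have *: "continuous_on K (\<lambda>g. f g * ln (f g))"
      if "continuous_on K f" "\<And>g. g \<in> K \<Longrightarrow> 0 \<le> f g" for f :: "_ \<Rightarrow> real"
      by (rule continuous_on_compose2[OF continuous_on_mult_ln that(1)]) (use that(2) in auto)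
    have "continuous_on K (\<lambda>g. g v)" for v
      by (rule continuous_on_subset[OF continuous_on_product_coordinates]) simp
    then show ?thesis
      unfolding grid_entropy_def col_sum_def row_sum_def
      by (intro continuous_on_add continuous_on_diff continuous_on_mult_left continuous_on_sum *)
         (simp_all add: K_def distribution_matrix_def sum_nonneg)
  qed
  ultimately obtain g where g: "g \<in> K" "\<forall>g'\<in>K. grid_entropy M (\<lambda>i j. g' (i, j)) \<le> grid_entropy M (\<lambda>i j. g (i, j))"
    using continuous_attains_sup by blast
  have "max_entropy M (\<lambda>i j. g (i, j))"
    unfolding max_entropy_def
  proof (intro conjI allI impI)
    show "distribution_matrix M (\<lambda>i j. g (i, j))" using g(1) by (simp add: K_def)
    fix \<Gamma>' assume "distribution_matrix M \<Gamma>'"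
    then have "(\<lambda>(i, j). \<Gamma>' i j) \<in> K" by (simp add: K_def)
    then show "grid_entropy M \<Gamma>' \<le> grid_entropy M (\<lambda>i j. g (i, j))" using g(2) by fastforce
  qed
  then show ?thesis by blast
qed

lemma max_entropy_max_distribution:
  assumes "connected_gridding_matrix M"
  shows "max_entropy M (max_distribution M)"
proof -
  obtain \<Gamma> where \<Gamma>: "max_entropy M \<Gamma>"
    using max_entropy_exists[of M] assms by (auto simp: connected_gridding_matrix_def)
  have "max_entropy M (THE \<Gamma>. max_entropy M \<Gamma>)"
    using \<Gamma> max_entropy_unique[OF assms \<Gamma>] by (rule theI)
  then show ?thesis
    by (simp add: max_distribution_def flip: max_entropy_iff_arg_max)
qed

section \<open>Ranks in finite sets\<close>

text \<open>
  Inside a cell, points are identified by their rank: the number of points of the cell weakly to the left, or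
  weakly below.
\<close>

lemma card_le_strict:
  fixes V :: "'a::linorder set"
  assumes "finite V" "y' \<in> V" "y < y'"
  shows "card {z \<in> V. z \<le> y} < card {z \<in> V. z \<le> y'}"
proof (rule psubset_card_mono)
  have "y' \<notin> {z \<in> V. z \<le> y}" "y' \<in> {z \<in> V. z \<le> y'}"
    using assms by auto
  then show "{z \<in> V. z \<le> y} \<subset> {z \<in> V. z \<le> y'}"
    using assms by (auto intro: order.trans)
qed (use assms in auto)

lemma card_le_image_strict_mono:
  fixes f :: "'a::linorder \<Rightarrow> 'b::linorder"
  assumes "strict_mono_on K f" "k \<in> K"
  shows "card {y \<in> f ` K. y \<le> f k} = card {x \<in> K. x \<le> k}"
proof -
  have "{y \<in> f ` K. y \<le> f k} = f ` {x \<in> K. x \<le> k}"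
    using assms strict_mono_on_less_eq[OF assms(1)] by auto
  moreover have "inj_on f {x \<in> K. x \<le> k}"
    using strict_mono_on_imp_inj_on[OF assms(1)] by (rule inj_on_subset) auto
  ultimately show ?thesis by (simp add: card_image)
qed

text \<open>
  The element of rank \<open>l\<close> must go to the element of rank \<open>l\<close> of the image.
\<close>

lemma strict_mono_on_image_unique:
  fixes f g :: "'a::linorder \<Rightarrow> 'b::linorder"
  assumes "finite K" "strict_mono_on K f" "strict_mono_on K g" "f ` K = g ` K" "k \<in> K"
  shows "f k = g k"
proof (rule ccontr)
  assume "f k \<noteq> g k"
  moreover have V: "finite (f ` K)" "f k \<in> f ` K" "g k \<in> f ` K"
    using assms(1,4,5) by auto
  ultimately have "card {y \<in> f ` K. y \<le> f k} \<noteq> card {y \<in> f ` K. y \<le> g k}"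
    using card_le_strict[OF V(1,2), of "g k"] card_le_strict[OF V(1,3), of "f k"]
    by (metis linorder_neqE order_less_irrefl)
  then show False
    using card_le_image_strict_mono[OF assms(2,5)] card_le_image_strict_mono[OF assms(3,5)] assms(4)
    by simp
qed

text \<open>
  A decreasing map reverses ranks; both ranks count the point itself, hence the summand 1.
\<close>

lemma card_le_image_strict_antimono:
  fixes f :: "'a::linorder \<Rightarrow> 'b::linorder"
  assumes "finite K" "strict_antimono_on K f" "k \<in> K"
  shows "card {y \<in> f ` K. y \<le> f k} + card {x \<in> K. x \<le> k} = card K + 1"
proof -
  have le: "f x \<le> f k \<longleftrightarrow> k \<le> x" if "x \<in> K" for x
    using monotone_onD[OF assms(2) that assms(3)] monotone_onD[OF assms(2) assms(3) that]
    by (cases x k rule: linorder_cases) auto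
  then have "{y \<in> f ` K. y \<le> f k} = f ` {x \<in> K. k \<le> x}"
    by auto
  moreover have "inj_on f K"
    using monotone_onD[OF assms(2)] by (intro linorder_inj_onI') (metis order_less_irrefl)
  then have "inj_on f {x \<in> K. k \<le> x}"
    by (rule inj_on_subset) auto
  ultimately have "card {y \<in> f ` K. y \<le> f k} = card {x \<in> K. k \<le> x}"
    by (simp add: card_image)
  moreover have "card {x \<in> K. k \<le> x} + card {x \<in> K. x \<le> k} =
      card ({x \<in> K. k \<le> x} \<union> {x \<in> K. x \<le> k}) + card ({x \<in> K. k \<le> x} \<inter> {x \<in> K. x \<le> k})"
    using assms(1) by (intro card_Un_Int) auto
  moreover have "{x \<in> K. k \<le> x} \<union> {x \<in> K. x \<le> k} = K" "{x \<in> K. k \<le> x} \<inter> {x \<in> K. x \<le> k} = {k}"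
    using assms(3) by auto
  ultimately show ?thesis by simp
qed

section \<open>Griddings as colourings of positions and values\<close>

definition cuts :: "nat \<Rightarrow> nat \<Rightarrow> (nat \<Rightarrow> nat) \<Rightarrow> bool" where
  "cuts t n c \<longleftrightarrow> c 0 = 0 \<and> c t = n \<and> (\<forall>i<t. c i \<le> c (Suc i))"

text \<open>
  For cuts \<open>c\<close> this is the index of the column (or row) that contains \<open>k\<close>. Through it a gridding becomes a
  colouring \<open>a\<close> of positions by columns and \<open>b\<close> of values by rows, and the arguments below are about \<open>a\<close> and \<open>b\<close>.
\<close>

definition block :: "(nat \<Rightarrow> nat) \<Rightarrow> nat \<Rightarrow> nat" where
  "block c k = (LEAST i. k \<le> c i)"

lemma cuts_mono:
  assumes "cuts t n c" "i \<le> i'" "i' \<le> t"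
  shows "c i \<le> c i'"
  using assms(2,3)
proof (induction i' rule: dec_induct)
  case (step i')
  then have "c i \<le> c i'" "c i' \<le> c (Suc i')" using assms(1) by (auto simp: cuts_def)
  then show ?case by simp
qed simp

lemma cuts_le: "cuts t n c \<Longrightarrow> i \<le> t \<Longrightarrow> c i \<le> n"
  using cuts_mono[of t n c i t] by (simp add: cuts_def)

lemma block_mem: "cuts t n c \<Longrightarrow> k \<in> {1..n} \<Longrightarrow> block c k \<in> {1..t}"
proof -
  assume c: "cuts t n c" and k: "k \<in> {1..n}"
  have "block c k \<le> t" unfolding block_def
    using c k by (intro Least_le) (simp add: cuts_def)
  moreover have "k \<le> c (block c k)" unfolding block_def
    by (rule LeastI[of _ t]) (use c k in \<open>simp add: cuts_def\<close>)
  then have "block c k \<noteq> 0" using c k by (metis atLeastAtMost_iff cuts_def not_one_le_zero le_zero_eq)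
  ultimately show ?thesis by simp
qed

lemma block_eq_iff:
  assumes "cuts t n c" "i \<in> {1..t}" "k \<in> {1..n}"
  shows "block c k = i \<longleftrightarrow> k \<in> {c (i - 1)<..c i}"
proof
  assume i: "block c k = i"
  have "k \<le> c (block c k)" unfolding block_def
    by (rule LeastI[of _ t]) (use assms in \<open>simp add: cuts_def\<close>)
  moreover have "\<not> k \<le> c (i - 1)"
    by (rule not_less_Least[of "i - 1"]) (use i assms(2) in \<open>auto simp: block_def\<close>)
  ultimately show "k \<in> {c (i - 1)<..c i}" using i by auto
next
  assume k: "k \<in> {c (i - 1)<..c i}"
  show "block c k = i" unfolding block_def
  proof (rule Least_equality)
    fix i' assume "k \<le> c i'"
    then show "i \<le> i'"
      using k cuts_mono[OF assms(1), of i' "i - 1"] assms(2) by fastforce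
  qed (use k in auto)
qed

lemma card_block:
  assumes "cuts t n c" "i \<in> {1..t}" "x \<le> n"
  shows "{k \<in> {1..x}. block c k = i} = {c (i - 1)<..min x (c i)}"
proof (rule set_eqI)
  fix k
  show "k \<in> {k \<in> {1..x}. block c k = i} \<longleftrightarrow> k \<in> {c (i - 1)<..min x (c i)}"
    using block_eq_iff[OF assms(1,2), of k] assms(3) by (cases "k \<in> {1..x}") auto
qed

definition cell_points :: "nat \<Rightarrow> (nat \<Rightarrow> nat) \<Rightarrow> (nat \<Rightarrow> nat) \<Rightarrow> (nat \<Rightarrow> nat) \<Rightarrow> nat \<Rightarrow> nat \<Rightarrow> nat set" where
  "cell_points n a b \<sigma> i j = {k \<in> {1..n}. a k = i \<and> b (\<sigma> k) = j}"

definition monotone_cells ::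
  "gridding_matrix \<Rightarrow> nat \<Rightarrow> (nat \<Rightarrow> nat) \<Rightarrow> (nat \<Rightarrow> nat) \<Rightarrow> (nat \<Rightarrow> nat) \<Rightarrow> bool" where
  "monotone_cells M n a b \<sigma> \<longleftrightarrow> (\<forall>i\<in>{1..ncols M}. \<forall>j\<in>{1..nrows M}.
     case entry M i j of
       Increasing \<Rightarrow> strict_mono_on (cell_points n a b \<sigma> i j) \<sigma>
     | Decreasing \<Rightarrow> strict_antimono_on (cell_points n a b \<sigma> i j) \<sigma>
     | Blank \<Rightarrow> cell_points n a b \<sigma> i j = {})"

lemma monotone_cellsD:
  assumes "monotone_cells M n a b \<sigma>" "i \<in> {1..ncols M}" "j \<in> {1..nrows M}"
  shows "entry M i j = Increasing \<Longrightarrow> strict_mono_on (cell_points n a b \<sigma> i j) \<sigma>"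
    and "entry M i j = Decreasing \<Longrightarrow> strict_antimono_on (cell_points n a b \<sigma> i j) \<sigma>"
    and "entry M i j = Blank \<Longrightarrow> cell_points n a b \<sigma> i j = {}"
  using bspec[OF bspec[OF assms(1)[unfolded monotone_cells_def] assms(2)] assms(3)] by simp_all

lemma is_gridding_iff:
  assumes "\<sigma> permutes {1..n}"
  shows "is_gridding M n \<sigma> c r \<longleftrightarrow>
    cuts (ncols M) n c \<and> cuts (nrows M) n r \<and> monotone_cells M n (block c) (block r) \<sigma>"
proof -
  have "{k \<in> {c (i - 1)<..c i}. \<sigma> k \<in> {r (j - 1)<..r j}} = cell_points n (block c) (block r) \<sigma> i j"
    if "cuts (ncols M) n c" "cuts (nrows M) n r" "i \<in> {1..ncols M}" "j \<in> {1..nrows M}" for i j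
  proof -
    have "k \<in> {1..n}" if "k \<in> {c (i - 1)<..c i}" for k
      using that cuts_le[OF \<open>cuts (ncols M) n c\<close>, of i] \<open>i \<in> {1..ncols M}\<close> by auto
    moreover have "\<sigma> k \<in> {1..n}" if "k \<in> {1..n}" for k
      using that assms by (simp only: permutes_in_image)
    ultimately show ?thesis
      using block_eq_iff[OF that(1,3)] block_eq_iff[OF that(2,4)] unfolding cell_points_def by blast
  qed
  then have eq: "(\<forall>i\<in>{1..ncols M}. \<forall>j\<in>{1..nrows M}.
        let K = {k \<in> {c (i - 1)<..c i}. \<sigma> k \<in> {r (j - 1)<..r j}} in
        case entry M i j of
          Increasing \<Rightarrow> strict_mono_on K \<sigma>
        | Decreasing \<Rightarrow> strict_antimono_on K \<sigma>
        | Blank \<Rightarrow> K = {}) \<longleftrightarrow> monotone_cells M n (block c) (block r) \<sigma>"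
    if "cuts (ncols M) n c" "cuts (nrows M) n r"
    unfolding monotone_cells_def Let_def using that by (intro ball_cong refl) (simp only:)
  have "is_gridding M n \<sigma> c r \<longleftrightarrow> monotone_cells M n (block c) (block r) \<sigma>"
    if "cuts (ncols M) n c" "cuts (nrows M) n r"
    unfolding is_gridding_def eq[OF that, symmetric] using that unfolding cuts_def by blast
  moreover have "cuts (ncols M) n c \<and> cuts (nrows M) n r" if "is_gridding M n \<sigma> c r"
    using that by (simp add: is_gridding_def cuts_def)
  ultimately show ?thesis by blast
qed

lemma image_cell_points:
  assumes "\<sigma> permutes {1..n}"
  shows "\<sigma> ` cell_points n a b \<sigma> i j = {y \<in> {1..n}. b y = j \<and> a (inv \<sigma> y) = i}"
proof (intro equalityI subsetI)
  fix y assume "y \<in> {y \<in> {1..n}. b y = j \<and> a (inv \<sigma> y) = i}"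
  then have y: "y \<in> {1..n}" "b y = j" "a (inv \<sigma> y) = i" by auto
  have "inv \<sigma> y \<in> {1..n}" using y(1) permutes_in_image[OF permutes_inv[OF assms]] by blast
  moreover have "\<sigma> (inv \<sigma> y) = y" using permutes_inverses(1)[OF assms] .
  ultimately show "y \<in> \<sigma> ` cell_points n a b \<sigma> i j"
    using y unfolding cell_points_def by (intro image_eqI[of _ _ "inv \<sigma> y"]) auto
next
  fix y assume "y \<in> \<sigma> ` cell_points n a b \<sigma> i j"
  then obtain k where "k \<in> {1..n}" "a k = i" "b (\<sigma> k) = j" "y = \<sigma> k" by (auto simp: cell_points_def)
  moreover have "\<sigma> k \<in> {1..n}" using calculation(1) by (simp only: permutes_in_image[OF assms])
  ultimately show "y \<in> {y \<in> {1..n}. b y = j \<and> a (inv \<sigma> y) = i}"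
    using permutes_inverses(2)[OF assms] by simp
qed

definition col_word :: "nat \<Rightarrow> (nat \<Rightarrow> nat) \<Rightarrow> (nat \<Rightarrow> nat) \<Rightarrow> nat \<Rightarrow> nat" where
  "col_word n b \<sigma> = (\<lambda>k\<in>{1..n}. b (\<sigma> k))"

definition row_word :: "nat \<Rightarrow> (nat \<Rightarrow> nat) \<Rightarrow> (nat \<Rightarrow> nat) \<Rightarrow> nat \<Rightarrow> nat" where
  "row_word n a \<sigma> = (\<lambda>y\<in>{1..n}. a (inv \<sigma> y))"

text \<open>
  The two words show which positions and which values belong to a given cell, and a monotone bijection
  between two finite sets is unique. Decreasing cells are reduced to increasing ones by negating the values.
\<close>

lemma words_determine_permutation:
  assumes \<sigma>: "\<sigma> permutes {1..n}" "monotone_cells M n a b \<sigma>"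
    and \<tau>: "\<tau> permutes {1..n}" "monotone_cells M n a b \<tau>"
    and a: "\<And>k. k \<in> {1..n} \<Longrightarrow> a k \<in> {1..ncols M}"
    and b: "\<And>y. y \<in> {1..n} \<Longrightarrow> b y \<in> {1..nrows M}"
    and w: "col_word n b \<sigma> = col_word n b \<tau>" and v: "row_word n a \<sigma> = row_word n a \<tau>"
  shows "\<sigma> = \<tau>"
proof
  fix k
  show "\<sigma> k = \<tau> k"
  proof (cases "k \<in> {1..n}")
    case True
    define i j where "i = a k" and "j = b (\<sigma> k)"
    define K where "K = cell_points n a b \<sigma> i j"
    have bw: "b (\<sigma> k) = b (\<tau> k)" if "k \<in> {1..n}" for k
      using fun_cong[OF w, of k] that by (simp add: col_word_def)
    have av: "a (inv \<sigma> y) = a (inv \<tau> y)" if "y \<in> {1..n}" for y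
      using fun_cong[OF v, of y] that by (simp add: row_word_def)
    have K\<tau>: "K = cell_points n a b \<tau> i j"
      using bw by (auto simp: K_def cell_points_def)
    have im: "\<sigma> ` K = \<tau> ` K"
      unfolding K_def image_cell_points[OF \<sigma>(1)]
      unfolding K_def[symmetric] K\<tau> image_cell_points[OF \<tau>(1)] using av by auto
    have "\<sigma> k \<in> {1..n}" using True \<sigma>(1) by (simp only: permutes_in_image)
    then have ij: "i \<in> {1..ncols M}" "j \<in> {1..nrows M}" using a b True by (auto simp: i_def j_def)
    have kK: "k \<in> K" using True by (simp add: K_def cell_points_def i_def j_def)
    have fin: "finite K" by (simp add: K_def cell_points_def)
    show ?thesis
    proof (cases "entry M i j")
      case Increasing
      then have "strict_mono_on K \<sigma>" "strict_mono_on K \<tau>"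
        using monotone_cellsD(1)[OF \<sigma>(2) ij] monotone_cellsD(1)[OF \<tau>(2) ij] K_def K\<tau> by auto
      then show ?thesis using strict_mono_on_image_unique[OF fin _ _ im kK] by blast
    next
      case Decreasing
      then have "strict_antimono_on K \<sigma>" "strict_antimono_on K \<tau>"
        using monotone_cellsD(2)[OF \<sigma>(2) ij] monotone_cellsD(2)[OF \<tau>(2) ij] K_def K\<tau> by auto
      then have "strict_mono_on K (\<lambda>k. - int (\<sigma> k))" "strict_mono_on K (\<lambda>k. - int (\<tau> k))"
        by (auto simp: monotone_on_def)
      moreover have "(\<lambda>k. - int (\<sigma> k)) ` K = (\<lambda>k. - int (\<tau> k)) ` K"
        using arg_cong[OF im, of "image (\<lambda>y. - int y)"] by (simp add: image_image)
      ultimately have "- int (\<sigma> k) = - int (\<tau> k)"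
        using kK by (rule strict_mono_on_image_unique[OF fin])
      then show ?thesis by simp
    next
      case Blank
      then show ?thesis using monotone_cellsD(3)[OF \<sigma>(2) ij] kK by (simp add: K_def)
    qed
  qed (use \<sigma>(1) \<tau>(1) in \<open>auto simp: permutes_def\<close>)
qed

section \<open>Random words\<close>

text \<open>
  An inequality, since the letter probabilities \<open>\<gamma>\<^sub>i\<^sub>j / c\<^sub>i\<close> of a blank column are all \<open>0 / 0 = 0\<close>.
\<close>

lemma sum_prod_words_le_1:
  fixes p :: "'k \<Rightarrow> 'l \<Rightarrow> real"
  assumes "finite K" "finite J" "\<And>k l. 0 \<le> p k l" "\<And>k. k \<in> K \<Longrightarrow> (\<Sum>l\<in>J. p k l) \<le> 1"
  shows "(\<Sum>w\<in>K \<rightarrow>\<^sub>E J. \<Prod>k\<in>K. p k (w k)) \<le> 1"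
  using assms by (subst prod_sum_PiE[symmetric]) (auto intro!: prod_le_1 sum_nonneg)

lemma exp_le_quadratic:
  assumes "\<bar>x\<bar> \<le> (1::real)"
  shows "exp x \<le> 1 + x + x\<^sup>2"
proof (cases "x \<ge> 0")
  case True
  then show ?thesis using assms exp_bound by simp
next
  case False
  \<comment> \<open>\<open>exp x = 1 / exp (-x) \<le> 1 / (1 - x + x\<^sup>2 / 2)\<close>\<close>
  have "1 - x + x\<^sup>2 / 2 \<le> exp (- x)"
    using exp_lower_Taylor_quadratic[of "- x"] False by simp
  moreover have "1 \<le> (1 + x + x\<^sup>2) * (1 - x + x\<^sup>2 / 2)"
  proof -
    have "(1 + x + x\<^sup>2) * (1 - x + x\<^sup>2 / 2) = 1 + x\<^sup>2 / 2 * (1 - x + x\<^sup>2)"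
      by (simp add: power2_eq_square field_simps)
    moreover have "0 \<le> x\<^sup>2 / 2 * (1 - x + x\<^sup>2)"
      using False by (intro mult_nonneg_nonneg) auto
    ultimately show ?thesis by simp
  qed
  moreover have "0 \<le> 1 + x + x\<^sup>2" using assms by (simp add: abs_le_iff add_nonneg_nonneg)
  ultimately have "1 \<le> (1 + x + x\<^sup>2) * exp (- x)"
    by (meson mult_left_mono order_trans)
  then show ?thesis by (simp add: exp_minus field_simps)
qed

lemma bernoulli_mgf_le:
  assumes "0 \<le> \<pi>" "\<pi> \<le> 1" "\<bar>\<theta>\<bar> \<le> (1::real)"
  shows "\<pi> * exp (\<theta> * (1 - \<pi>)) + (1 - \<pi>) * exp (- \<theta> * \<pi>) \<le> exp (\<theta>\<^sup>2)"
proof -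
  have "\<bar>\<theta> * (1 - \<pi>)\<bar> \<le> 1" "\<bar>- \<theta> * \<pi>\<bar> \<le> 1"
    using assms by (auto simp: abs_mult intro: mult_le_one)
  then have "\<pi> * exp (\<theta> * (1 - \<pi>)) + (1 - \<pi>) * exp (- \<theta> * \<pi>) \<le>
      \<pi> * (1 + \<theta> * (1 - \<pi>) + (\<theta> * (1 - \<pi>))\<^sup>2) + (1 - \<pi>) * (1 + - \<theta> * \<pi> + (- \<theta> * \<pi>)\<^sup>2)"
    using assms by (intro add_mono mult_left_mono exp_le_quadratic) auto
  also have "\<dots> = 1 + \<theta>\<^sup>2 * (\<pi> * (1 - \<pi>))"
    by (simp add: power2_eq_square algebra_simps)
  also have "\<dots> \<le> 1 + \<theta>\<^sup>2 * 1"
    using assms by (intro add_left_mono mult_left_mono mult_le_one) auto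
  also have "\<dots> \<le> exp (\<theta>\<^sup>2)"
    using exp_ge_add_one_self[of "\<theta>\<^sup>2"] by simp
  finally show ?thesis .
qed

text \<open>
  The Chernoff bound. The indicator of the event is at most \<open>exp (\<theta> (count - mean) - s)\<close>, which is a product over the
  positions, so the sum over all words factorises into moment generating functions.
\<close>

lemma word_count_tail:
  fixes p :: "'k \<Rightarrow> 'l \<Rightarrow> real"
  assumes fin: "finite K" "finite J" and p: "\<And>k l. 0 \<le> p k l" "\<And>k. k \<in> K \<Longrightarrow> (\<Sum>l\<in>J. p k l) \<le> 1"
    and T: "T \<subseteq> K" "\<And>k. k \<in> T \<Longrightarrow> p k l = \<pi>" and l: "l \<in> J" and \<theta>: "\<bar>\<theta>\<bar> \<le> 1"
  shows "(\<Sum>w | w \<in> K \<rightarrow>\<^sub>E J \<and> \<theta> * (real (card {k \<in> T. w k = l}) - \<pi> * real (card T)) \<ge> s. \<Prod>k\<in>K. p k (w k))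
    \<le> exp (\<theta>\<^sup>2 * real (card T) - s)"
proof -
  define W where "W = {w. w \<in> K \<rightarrow>\<^sub>E J \<and> \<theta> * (real (card {k \<in> T. w k = l}) - \<pi> * real (card T)) \<ge> s}"
  define h where "h = (\<lambda>k x. if k \<in> T then exp (\<theta> * (of_bool (x = l) - \<pi>)) else 1)"
  have finT: "finite T" using fin T finite_subset by blast
  have finPi: "finite (K \<rightarrow>\<^sub>E J)" using fin by (simp add: finite_PiE)
  have h: "(\<Prod>k\<in>K. h k (w k)) = exp (\<theta> * (real (card {k \<in> T. w k = l}) - \<pi> * real (card T)))" for w
  proof -
    have "(\<Prod>k\<in>K. h k (w k)) = (\<Prod>k\<in>T. exp (\<theta> * (of_bool (w k = l) - \<pi>)))"
      using fin T by (intro prod.mono_neutral_cong_right) (auto simp: h_def)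
    also have "\<dots> = exp (\<Sum>k\<in>T. \<theta> * (of_bool (w k = l) - \<pi>))"
      using finT by (simp add: exp_sum)
    also have "(\<Sum>k\<in>T. \<theta> * (of_bool (w k = l) - \<pi>)) =
        \<theta> * (real (card {k \<in> T. w k = l}) - \<pi> * real (card T))"
      using finT by (simp add: sum_subtractf Int_def mult.commute flip: sum_distrib_left)
    finally show ?thesis .
  qed
  have "(\<Sum>w\<in>W. \<Prod>k\<in>K. p k (w k)) \<le> (\<Sum>w\<in>W. (\<Prod>k\<in>K. p k (w k)) * ((\<Prod>k\<in>K. h k (w k)) * exp (- s)))"
  proof (rule sum_mono)
    fix w assume "w \<in> W"
    then have "1 \<le> (\<Prod>k\<in>K. h k (w k)) * exp (- s)"
      unfolding h by (simp add: W_def flip: exp_add)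
    then show "(\<Prod>k\<in>K. p k (w k)) \<le> (\<Prod>k\<in>K. p k (w k)) * ((\<Prod>k\<in>K. h k (w k)) * exp (- s))"
      using mult_left_mono[of 1 _ "\<Prod>k\<in>K. p k (w k)"] prod_nonneg[of K "\<lambda>k. p k (w k)"] p(1) by simp
  qed
  also have "\<dots> \<le> (\<Sum>w\<in>K \<rightarrow>\<^sub>E J. (\<Prod>k\<in>K. p k (w k)) * ((\<Prod>k\<in>K. h k (w k)) * exp (- s)))"
    using finPi by (intro sum_mono2) (auto simp: W_def h_def intro!: mult_nonneg_nonneg prod_nonneg p)
  also have "\<dots> = (\<Sum>w\<in>K \<rightarrow>\<^sub>E J. \<Prod>k\<in>K. p k (w k) * h k (w k)) * exp (- s)"
    by (simp add: prod.distrib sum_distrib_right mult.assoc)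
  also have "(\<Sum>w\<in>K \<rightarrow>\<^sub>E J. \<Prod>k\<in>K. p k (w k) * h k (w k)) = (\<Prod>k\<in>K. \<Sum>x\<in>J. p k x * h k x)"
    using fin by (simp add: prod_sum_PiE)
  also have "\<dots> \<le> (\<Prod>k\<in>K. if k \<in> T then exp (\<theta>\<^sup>2) else 1)"
  proof (intro prod_mono conjI)
    fix k assume k: "k \<in> K"
    show "0 \<le> (\<Sum>x\<in>J. p k x * h k x)" by (auto simp: h_def intro!: sum_nonneg mult_nonneg_nonneg p)
    show "(\<Sum>x\<in>J. p k x * h k x) \<le> (if k \<in> T then exp (\<theta>\<^sup>2) else 1)"
    proof (cases "k \<in> T")
      case True
      have split: "(\<Sum>x\<in>J. p k x) = \<pi> + (\<Sum>x\<in>J - {l}. p k x)"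
        using fin l T(2)[OF True] by (simp add: sum.remove)
      have \<pi>: "0 \<le> \<pi>" using p(1)[of k l] T(2)[OF True] by simp
      have rest: "(\<Sum>x\<in>J - {l}. p k x) \<le> 1 - \<pi>" "0 \<le> (\<Sum>x\<in>J - {l}. p k x)"
        using split p(2)[OF k] by (auto intro: sum_nonneg p)
      have "(\<Sum>x\<in>J. p k x * h k x) = \<pi> * exp (\<theta> * (1 - \<pi>)) + (\<Sum>x\<in>J - {l}. p k x * exp (- \<theta> * \<pi>))"
        using fin l T(2)[OF True] True by (subst sum.remove[of J l]) (auto simp: h_def intro!: sum.cong)
      also have "\<dots> = \<pi> * exp (\<theta> * (1 - \<pi>)) + (\<Sum>x\<in>J - {l}. p k x) * exp (- \<theta> * \<pi>)"
        by (simp only: sum_distrib_right)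
      also have "\<dots> \<le> \<pi> * exp (\<theta> * (1 - \<pi>)) + (1 - \<pi>) * exp (- \<theta> * \<pi>)"
        using rest by (intro add_left_mono mult_right_mono) auto
      also have "\<dots> \<le> exp (\<theta>\<^sup>2)"
        using \<pi> rest \<theta> by (intro bernoulli_mgf_le) auto
      finally show ?thesis using True by simp
    qed (use p(2)[OF k] in \<open>simp add: h_def\<close>)
  qed
  also have "\<dots> = exp (\<theta>\<^sup>2 * real (card T))"
    using fin T by (simp add: prod.If_cases Int_absorb1 mult.commute flip: exp_of_nat_mult)
  finally show ?thesis
    by (simp add: W_def exp_diff exp_minus divide_inverse)
qed

text \<open>
  The two tails of the previous bound with \<open>\<theta> = \<plusminus> \<epsilon> / 2\<close>, which minimises \<open>\<theta>\<^sup>2 n - \<bar>\<theta>\<bar> \<epsilon> n\<close>.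
\<close>

lemma word_count_deviation:
  fixes p :: "'k \<Rightarrow> 'l \<Rightarrow> real"
  assumes fin: "finite K" "finite J" and p: "\<And>k l. 0 \<le> p k l" "\<And>k. k \<in> K \<Longrightarrow> (\<Sum>l\<in>J. p k l) \<le> 1"
    and T: "T \<subseteq> K" "\<And>k. k \<in> T \<Longrightarrow> p k l = \<pi>" and l: "l \<in> J"
    and \<epsilon>: "0 < \<epsilon>" "\<epsilon> \<le> 1" and n: "real (card K) \<le> n"
  shows "(\<Sum>w | w \<in> K \<rightarrow>\<^sub>E J \<and> \<bar>real (card {k \<in> T. w k = l}) - \<pi> * real (card T)\<bar> > \<epsilon> * n. \<Prod>k\<in>K. p k (w k))
    \<le> 2 * exp (- (\<epsilon>\<^sup>2 * n / 4))"
proof -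
  define D where "D = (\<lambda>w. real (card {k \<in> T. w k = l}) - \<pi> * real (card T))"
  define U where "U = (\<lambda>\<theta>. {w. w \<in> K \<rightarrow>\<^sub>E J \<and> \<theta> * D w \<ge> \<epsilon> / 2 * (\<epsilon> * n)})"
  have finPi: "finite (K \<rightarrow>\<^sub>E J)" using fin by (simp add: finite_PiE)
  have nn: "0 \<le> (\<Prod>k\<in>K. p k (w k))" for w by (intro prod_nonneg p)
  have Tn: "real (card T) \<le> n" using card_mono[OF fin(1) T(1)] n by linarith
  have tail: "(\<Sum>w\<in>U \<theta>. \<Prod>k\<in>K. p k (w k)) \<le> exp (- (\<epsilon>\<^sup>2 * n / 4))" if "\<bar>\<theta>\<bar> = \<epsilon> / 2" for \<theta>
  proof -
    have "(\<Sum>w\<in>U \<theta>. \<Prod>k\<in>K. p k (w k)) \<le> exp (\<theta>\<^sup>2 * real (card T) - \<epsilon> / 2 * (\<epsilon> * n))"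
      unfolding U_def D_def using that \<epsilon> by (intro word_count_tail[OF fin p T l]) auto
    also have "\<theta>\<^sup>2 = (\<epsilon> / 2)\<^sup>2" using that by (metis power2_abs)
    also have "exp ((\<epsilon> / 2)\<^sup>2 * real (card T) - \<epsilon> / 2 * (\<epsilon> * n)) \<le> exp ((\<epsilon> / 2)\<^sup>2 * n - \<epsilon> / 2 * (\<epsilon> * n))"
      using Tn by (simp add: mult_left_mono)
    also have "(\<epsilon> / 2)\<^sup>2 * n - \<epsilon> / 2 * (\<epsilon> * n) = - (\<epsilon>\<^sup>2 * n / 4)"
      by (simp add: power2_eq_square field_simps)
    finally show ?thesis .
  qed
  have "{w. w \<in> K \<rightarrow>\<^sub>E J \<and> \<bar>D w\<bar> > \<epsilon> * n} \<subseteq> U (\<epsilon> / 2) \<union> U (- (\<epsilon> / 2))"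
  proof
    fix w assume "w \<in> {w. w \<in> K \<rightarrow>\<^sub>E J \<and> \<bar>D w\<bar> > \<epsilon> * n}"
    then have w: "w \<in> K \<rightarrow>\<^sub>E J" "\<bar>D w\<bar> > \<epsilon> * n" by auto
    then have "\<epsilon> / 2 * (\<epsilon> * n) \<le> \<epsilon> / 2 * \<bar>D w\<bar>"
      using \<epsilon> by (intro mult_left_mono) auto
    then show "w \<in> U (\<epsilon> / 2) \<union> U (- (\<epsilon> / 2))"
      using w(1) by (cases "D w \<ge> 0") (auto simp: U_def)
  qed
  then have "(\<Sum>w | w \<in> K \<rightarrow>\<^sub>E J \<and> \<bar>D w\<bar> > \<epsilon> * n. \<Prod>k\<in>K. p k (w k)) \<le>
      (\<Sum>w\<in>U (\<epsilon> / 2) \<union> U (- (\<epsilon> / 2)). \<Prod>k\<in>K. p k (w k))"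
    using finPi nn by (intro sum_mono2) (auto simp: U_def)
  also have "\<dots> \<le> (\<Sum>w\<in>U (\<epsilon> / 2). \<Prod>k\<in>K. p k (w k)) + (\<Sum>w\<in>U (- (\<epsilon> / 2)). \<Prod>k\<in>K. p k (w k))"
    using finPi nn by (subst sum.union_inter[symmetric]) (auto simp: U_def intro!: sum_nonneg)
  also have "\<dots> \<le> 2 * exp (- (\<epsilon>\<^sup>2 * n / 4))"
    using tail[of "\<epsilon> / 2"] tail[of "- (\<epsilon> / 2)"] \<epsilon> by simp
  finally show ?thesis by (simp add: D_def)
qed

section \<open>Counting words of a given type\<close>

text \<open>
  The positions \<open>K\<close> are split into classes by \<open>a\<close>, and \<open>A i l\<close> prescribes how often the letter \<open>l\<close> occurs in class \<open>i\<close>.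
\<close>

definition words_of_type ::
  "'k set \<Rightarrow> 'i set \<Rightarrow> 'l set \<Rightarrow> ('k \<Rightarrow> 'i) \<Rightarrow> ('i \<Rightarrow> 'l \<Rightarrow> nat) \<Rightarrow> ('k \<Rightarrow> 'l) set" where
  "words_of_type K I J a A =
     {w \<in> K \<rightarrow>\<^sub>E J. \<forall>i\<in>I. \<forall>l\<in>J. card {k \<in> K. a k = i \<and> w k = l} = A i l}"

lemma card_insert_filter:
  "finite K \<Longrightarrow> x \<notin> K \<Longrightarrow> card {k \<in> insert x K. P k} = (if P x then 1 else 0) + card {k \<in> K. P k}"
proof -
  assume "finite K" "x \<notin> K"
  moreover have "{k \<in> insert x K. P k} = (if P x then insert x {k \<in> K. P k} else {k \<in> K. P k})" by auto
  ultimately show ?thesis by simp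
qed

text \<open>
  Removing the position \<open>x\<close> with letter \<open>l\<close> lowers one prescribed count by one.
\<close>

lemma card_words_first_letter:
  assumes K: "finite K" "x \<notin> K" and fin: "finite I" "finite J" and x: "a x \<in> I" and l: "l \<in> J"
  shows "card {w \<in> words_of_type (insert x K) I J a A. w x = l} =
    (if A (a x) l = 0 then 0
     else card (words_of_type K I J a (\<lambda>i l'. A i l' - (if i = a x \<and> l' = l then 1 else 0))))"
proof -
  let ?B = "\<lambda>i l'. A i l' - (if i = a x \<and> l' = l then 1 else 0)"
  have count: "card {k \<in> insert x K. a k = i \<and> w k = l'} =
      (if i = a x \<and> l' = w x then 1 else 0) + card {k \<in> K. a k = i \<and> w k = l'}" for w i l'
    using card_insert_filter[OF K, of "\<lambda>k. a k = i \<and> w k = l'"] by auto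
  show ?thesis
  proof (cases "A (a x) l = 0")
    case True
    have "w x \<noteq> l" if "w \<in> words_of_type (insert x K) I J a A" for w
    proof
      assume wx: "w x = l"
      have "card {k \<in> insert x K. a k = a x \<and> w k = l} = A (a x) l"
        using that x l by (simp add: words_of_type_def)
      then show False using True wx count[of "a x" w l] by simp
    qed
    then show ?thesis using True by (auto simp: card_eq_0_iff)
  next
    case False
    have "bij_betw (\<lambda>w. w(x := l)) (words_of_type K I J a ?B) {w \<in> words_of_type (insert x K) I J a A. w x = l}"
    proof (rule bij_betw_byWitness[where f' = "\<lambda>w. w(x := undefined)"])
      show "\<forall>w\<in>words_of_type K I J a ?B. (w(x := l))(x := undefined) = w"
      proof
        fix w assume "w \<in> words_of_type K I J a ?B"
        then have "w x = undefined" using K(2) by (intro PiE_arb[of w K]) (auto simp: words_of_type_def)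
        then show "(w(x := l))(x := undefined) = w" by (simp add: fun_eq_iff)
      qed
      show "\<forall>w\<in>{w \<in> words_of_type (insert x K) I J a A. w x = l}. (w(x := undefined))(x := l) = w"
        by auto
      have same: "{k \<in> K. a k = i \<and> (w(x := y)) k = l'} = {k \<in> K. a k = i \<and> w k = l'}" for w y i l'
        using K by auto
      show "(\<lambda>w. w(x := l)) ` words_of_type K I J a ?B \<subseteq> {w \<in> words_of_type (insert x K) I J a A. w x = l}"
      proof clarify
        fix w assume w: "w \<in> words_of_type K I J a ?B"
        have "w(x := l) \<in> insert x K \<rightarrow>\<^sub>E J"
          using w l by (intro PiE_fun_upd) (auto simp: words_of_type_def)
        moreover have "card {k \<in> insert x K. a k = i \<and> (w(x := l)) k = l'} = A i l'"
          if "i \<in> I" "l' \<in> J" for i l'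
          unfolding count same using w that False by (auto simp: words_of_type_def)
        ultimately show "w(x := l) \<in> words_of_type (insert x K) I J a A \<and> (w(x := l)) x = l"
          by (simp add: words_of_type_def)
      qed
      show "(\<lambda>w. w(x := undefined)) ` {w \<in> words_of_type (insert x K) I J a A. w x = l}
          \<subseteq> words_of_type K I J a ?B"
      proof clarify
        fix w assume w: "w \<in> words_of_type (insert x K) I J a A" and wx: "l = w x"
        have "w(x := undefined) \<in> K \<rightarrow>\<^sub>E J"
          using w K by (intro fun_upd_in_PiE) (auto simp: words_of_type_def)
        moreover have "card {k \<in> K. a k = i \<and> (w(x := undefined)) k = l'} =
            A i l' - (if i = a x \<and> l' = w x then 1 else 0)" if "i \<in> I" "l' \<in> J" for i l'
        proof -
          have "card {k \<in> insert x K. a k = i \<and> w k = l'} = A i l'"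
            using w that by (simp add: words_of_type_def)
          then show ?thesis unfolding same count by auto
        qed
        ultimately show "w(x := undefined) \<in> words_of_type K I J a (\<lambda>i l'. A i l' - (if i = a x \<and> l' = w x then 1 else 0))"
          by (simp add: words_of_type_def)
      qed
    qed
    then show ?thesis using False by (simp add: bij_betw_same_card)
  qed
qed

text \<open>
  A product of multinomial coefficients, one for each class. In the induction step the words with letter \<open>l\<close> at
  the new position make up the fraction \<open>A (a x) l\<close> divided by the size of its class.
\<close>

lemma card_words_of_type:
  assumes "finite K" "finite I" "finite J" "\<And>k. k \<in> K \<Longrightarrow> a k \<in> I"
    and "\<And>i. i \<in> I \<Longrightarrow> (\<Sum>l\<in>J. A i l) = card {k \<in> K. a k = i}"
  shows "card (words_of_type K I J a A) * (\<Prod>i\<in>I. \<Prod>l\<in>J. fact (A i l)) =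
    (\<Prod>i\<in>I. fact (card {k \<in> K. a k = i}) :: nat)"
  using assms(1,4,5)
proof (induction K arbitrary: A rule: finite_induct)
  case empty
  then have "A i l = 0" if "i \<in> I" "l \<in> J" for i l
    using that assms(3) by simp
  then have "words_of_type {} I J a A = {\<lambda>_. undefined}"
    by (auto simp: words_of_type_def)
  moreover have "(\<Prod>i\<in>I. \<Prod>l\<in>J. fact (A i l)) = (1 :: nat)"
    using \<open>\<And>i l. i \<in> I \<Longrightarrow> l \<in> J \<Longrightarrow> A i l = 0\<close> by (intro prod.neutral ballI) auto
  ultimately show ?case by simp
next
  case (insert x K)
  let ?B = "\<lambda>l i l'. A i l' - (if i = a x \<and> l' = l then 1 else 0)"
  define F where "F = (\<Prod>i\<in>I. fact (card {k \<in> K. a k = i}) :: nat)"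
  have ax: "a x \<in> I" using insert.prems(1) by simp
  have cnt: "card {k \<in> insert x K. a k = i} = (if i = a x then 1 else 0) + card {k \<in> K. a k = i}" for i
    using card_insert_filter[OF insert.hyps(1,2), of "\<lambda>k. a k = i"] by auto
  have step: "card {w \<in> words_of_type (insert x K) I J a A. w x = l} * (\<Prod>i\<in>I. \<Prod>l\<in>J. fact (A i l)) =
      A (a x) l * F" if l: "l \<in> J" for l
  proof (cases "A (a x) l = 0")
    case True
    then show ?thesis
      by (simp add: card_words_first_letter[where a = a and A = A, OF insert.hyps(1,2) assms(2,3) ax l])
  next
    case False
    have "(\<Sum>l'\<in>J. ?B l i l') = card {k \<in> K. a k = i}" if "i \<in> I" for i
    proof -
      have "(\<Sum>l'\<in>J. ?B l i l') + (\<Sum>l'\<in>J. if i = a x \<and> l' = l then 1 else 0) = (\<Sum>l'\<in>J. A i l')"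
        unfolding sum.distrib[symmetric] using False by (intro sum.cong) auto
      moreover have "(\<Sum>l'\<in>J. if i = a x \<and> l' = l then 1 else 0) = (if i = a x then 1 else (0::nat))"
        using l assms(3) by auto
      ultimately show ?thesis using insert.prems(2)[OF that] cnt[of i] by simp
    qed
    then have IH: "card (words_of_type K I J a (?B l)) * (\<Prod>i\<in>I. \<Prod>l'\<in>J. fact (?B l i l')) = F"
      unfolding F_def using insert.prems(1) by (intro insert.IH) auto
    have "fact (A i l') = (if i = a x then if l' = l then A i l' else 1 else 1) * fact (?B l i l')" for i l'
      using False by (cases "A (a x) l") auto
    then have "(\<Prod>i\<in>I. \<Prod>l'\<in>J. fact (A i l')) =
        (\<Prod>i\<in>I. \<Prod>l'\<in>J. (if i = a x then if l' = l then A i l' else 1 else 1)) * (\<Prod>i\<in>I. \<Prod>l'\<in>J. fact (?B l i l'))"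
      by (simp add: prod.distrib)
    also have "(\<Prod>i\<in>I. \<Prod>l'\<in>J. (if i = a x then if l' = l then A i l' else 1 else 1)) =
        (\<Prod>i\<in>I. if i = a x then A i l else 1)"
      using l assms(3) by (intro prod.cong refl) simp
    also have "\<dots> = A (a x) l"
      using ax assms(2) by simp
    finally show ?thesis
      using IH False card_words_first_letter[where a = a and A = A, OF insert.hyps(1,2) assms(2,3) ax l]
      by (simp add: mult.left_commute)
  qed
  have "finite (words_of_type (insert x K) I J a A)"
    by (rule finite_subset[of _ "insert x K \<rightarrow>\<^sub>E J"])
       (use insert.hyps(1) assms(3) in \<open>auto simp: words_of_type_def intro!: finite_PiE\<close>)
  moreover have "words_of_type (insert x K) I J a A = (\<Union>l\<in>J. {w \<in> words_of_type (insert x K) I J a A. w x = l})"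
    by (auto simp: words_of_type_def)
  ultimately have "card (words_of_type (insert x K) I J a A) =
      (\<Sum>l\<in>J. card {w \<in> words_of_type (insert x K) I J a A. w x = l})"
    using assms(3) by (subst card_UN_disjoint[symmetric]) auto
  then have "card (words_of_type (insert x K) I J a A) * (\<Prod>i\<in>I. \<Prod>l\<in>J. fact (A i l)) =
      (\<Sum>l\<in>J. A (a x) l) * F"
    by (simp add: sum_distrib_right step)
  also have "\<dots> = (1 + card {k \<in> K. a k = a x}) * F"
    using insert.prems(2)[OF ax] cnt[of "a x"] by simp
  also have "\<dots> = (\<Prod>i\<in>I. (if i = a x then 1 + card {k \<in> K. a k = i} else 1)) * F"
    using ax assms(2) by simp
  also have "\<dots> = (\<Prod>i\<in>I. fact (card {k \<in> insert x K. a k = i}))"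
    unfolding F_def prod.distrib[symmetric] cnt by (intro prod.cong) auto
  finally show ?case .
qed

section \<open>Permutations with prescribed words\<close>

lemma ex_strict_mono_bij:
  fixes K V :: "nat set"
  assumes "finite K" "finite V" "card K = card V"
  shows "\<exists>f. bij_betw f K V \<and> strict_mono_on K f" "\<exists>f. bij_betw f K V \<and> strict_antimono_on K f"
proof -
  obtain g where g: "bij_betw g {..<card K} K" "strict_mono_on {..<card K} g"
    using ex_bij_betw_strict_mono_card[OF assms(1)] by blast
  obtain h where h: "bij_betw h {..<card K} V" "strict_mono_on {..<card K} h"
    using ex_bij_betw_strict_mono_card[OF assms(2)] assms(3) by metis
  \<comment> \<open>\<open>g'\<close> is the rank in \<open>K\<close>, counted from 0\<close>
  define g' where "g' = inv_into {..<card K} g"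
  have g': "bij_betw g' K {..<card K}" unfolding g'_def by (rule bij_betw_inv_into[OF g(1)])
  have inK: "g' x < card K" "g (g' x) = x" if "x \<in> K" for x
    using that g' bij_betw_inv_into_right[OF g(1) that] by (auto simp: bij_betw_def g'_def)
  have mono: "g' x < g' y" if "x \<in> K" "y \<in> K" "x < y" for x y
    using strict_mono_on_less[OF g(2), of "g' x" "g' y"] inK[OF that(1)] inK[OF that(2)] that(3) by simp
  have hm: "h x < h y" if "x < y" "y < card K" for x y
    using strict_mono_onD[OF h(2), of x y] that by simp
  have "bij_betw (h \<circ> g') K V" using g' h(1) by (rule bij_betw_trans)
  moreover have "strict_mono_on K (h \<circ> g')"
    using mono hm inK by (auto intro!: strict_mono_onI)
  ultimately show "\<exists>f. bij_betw f K V \<and> strict_mono_on K f" by blast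
  have "bij_betw (\<lambda>x. card K - Suc x) {..<card K} {..<card K}"
    by (rule bij_betw_byWitness[where f' = "\<lambda>x. card K - Suc x"]) auto
  then have "bij_betw (h \<circ> ((\<lambda>x. card K - Suc x) \<circ> g')) K V"
    using g' h(1) by (intro bij_betw_trans)
  moreover have "strict_antimono_on K (h \<circ> ((\<lambda>x. card K - Suc x) \<circ> g'))"
  proof (rule monotone_onI)
    fix x y assume "x \<in> K" "y \<in> K" "x < y"
    then have "g' x < g' y" "g' y < card K" using mono inK by auto
    then show "(h \<circ> ((\<lambda>x. card K - Suc x) \<circ> g')) y < (h \<circ> ((\<lambda>x. card K - Suc x) \<circ> g')) x"
      by (auto intro!: hm)
  qed
  ultimately show "\<exists>f. bij_betw f K V \<and> strict_antimono_on K f" by blast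
qed

text \<open>
  For each cell the words give a set of positions and an equally large set of values; the monotone bijections
  between them fit together to a permutation.
\<close>

lemma permutation_with_words:
  assumes a: "\<And>k. k \<in> {1..n} \<Longrightarrow> a k \<in> {1..ncols M}"
    and b: "\<And>y. y \<in> {1..n} \<Longrightarrow> b y \<in> {1..nrows M}"
    and w: "w \<in> words_of_type {1..n} {1..ncols M} {1..nrows M} a A"
    and v: "v \<in> words_of_type {1..n} {1..nrows M} {1..ncols M} b (\<lambda>j i. A i j)"
    and blank: "\<And>i j. entry M i j = Blank \<Longrightarrow> A i j = 0"
  shows "\<exists>\<sigma>. \<sigma> permutes {1..n} \<and> monotone_cells M n a b \<sigma> \<and> col_word n b \<sigma> = w \<and> row_word n a \<sigma> = v"
proof -
  define K where "K = (\<lambda>i j. {k \<in> {1..n}. a k = i \<and> w k = j})"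
  define V where "V = (\<lambda>i j. {y \<in> {1..n}. b y = j \<and> v y = i})"
  define ok where "ok = (\<lambda>i j f. bij_betw f (K i j) (V i j) \<and>
      (entry M i j = Increasing \<longrightarrow> strict_mono_on (K i j) f) \<and>
      (entry M i j = Decreasing \<longrightarrow> strict_antimono_on (K i j) f))"
  have wJ: "w k \<in> {1..nrows M}" if "k \<in> {1..n}" for k
    using w that by (auto simp: words_of_type_def)
  have vI: "v y \<in> {1..ncols M}" if "y \<in> {1..n}" for y
    using v that by (auto simp: words_of_type_def)
  have card: "card (K i j) = A i j" "card (V i j) = A i j" if "i \<in> {1..ncols M}" "j \<in> {1..nrows M}" for i j
    using w v that by (auto simp: words_of_type_def K_def V_def)
  have "\<exists>f. ok i j f" if ij: "i \<in> {1..ncols M}" "j \<in> {1..nrows M}" for i j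
  proof -
    have fin: "finite (K i j)" "finite (V i j)" "card (K i j) = card (V i j)"
      using card[OF ij] by (simp_all add: K_def V_def)
    obtain f g where "bij_betw f (K i j) (V i j)" "strict_mono_on (K i j) f"
        "bij_betw g (K i j) (V i j)" "strict_antimono_on (K i j) g"
      using ex_strict_mono_bij[OF fin] by blast
    then have "ok i j (if entry M i j = Increasing then f else g)"
      by (simp add: ok_def)
    then show ?thesis by blast
  qed
  then obtain f where f: "\<And>i j. i \<in> {1..ncols M} \<Longrightarrow> j \<in> {1..nrows M} \<Longrightarrow> ok i j (f i j)"
    by metis
  define \<sigma> where "\<sigma> = (\<lambda>k. if k \<in> {1..n} then f (a k) (w k) k else k)"
  have \<sigma>V: "\<sigma> k \<in> V (a k) (w k)" if k: "k \<in> {1..n}" for k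
  proof -
    have "k \<in> K (a k) (w k)" using k by (simp add: K_def)
    then show ?thesis
      using f[OF a[OF k] wJ[OF k]] k by (auto simp: ok_def \<sigma>_def bij_betw_def)
  qed
  have \<sigma>: "\<sigma> k \<in> {1..n}" "b (\<sigma> k) = w k" "v (\<sigma> k) = a k" if "k \<in> {1..n}" for k
    using \<sigma>V[OF that] by (auto simp: V_def)
  have "inj_on \<sigma> {1..n}"
  proof (rule inj_onI)
    fix k k' assume k: "k \<in> {1..n}" "k' \<in> {1..n}" "\<sigma> k = \<sigma> k'"
    then have eq: "a k = a k'" "w k = w k'" using \<sigma>[OF k(1)] \<sigma>[OF k(2)] by auto
    have "inj_on (f (a k) (w k)) (K (a k) (w k))"
      using f[OF a[OF k(1)] wJ[OF k(1)]] by (simp add: ok_def bij_betw_def)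
    then show "k = k'"
      by (rule inj_onD) (use k eq in \<open>auto simp: \<sigma>_def K_def\<close>)
  qed
  moreover have "\<sigma> ` {1..n} \<subseteq> {1..n}" using \<sigma>(1) by blast
  ultimately have "bij_betw \<sigma> {1..n} {1..n}"
    by (simp add: bij_betw_def endo_inj_surj)
  then have perm: "\<sigma> permutes {1..n}"
    by (rule bij_imp_permutes) (auto simp: \<sigma>_def)
  have "col_word n b \<sigma> = w"
  proof
    fix k show "col_word n b \<sigma> k = w k"
      using \<sigma>(2)[of k] w by (auto simp: col_word_def words_of_type_def PiE_def extensional_def)
  qed
  moreover have "row_word n a \<sigma> = v"
  proof
    fix y
    have "a (inv \<sigma> y) = v y" if y: "y \<in> {1..n}"
    proof -
      have "inv \<sigma> y \<in> {1..n}" using y permutes_in_image[OF permutes_inv[OF perm]] by blast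
      then show ?thesis using \<sigma>(3)[of "inv \<sigma> y"] permutes_inverses(1)[OF perm] by simp
    qed
    then show "row_word n a \<sigma> y = v y"
      using v by (auto simp: row_word_def words_of_type_def PiE_def extensional_def)
  qed
  moreover have "monotone_cells M n a b \<sigma>"
    unfolding monotone_cells_def
  proof (intro ballI)
    fix i j assume ij: "i \<in> {1..ncols M}" "j \<in> {1..nrows M}"
    have cell: "cell_points n a b \<sigma> i j = K i j"
      using \<sigma>(2) by (auto simp: cell_points_def K_def)
    have agree: "\<sigma> k = f i j k" if "k \<in> K i j" for k
      using that by (simp add: K_def \<sigma>_def)
    show "case entry M i j of
       Increasing \<Rightarrow> strict_mono_on (cell_points n a b \<sigma> i j) \<sigma>
     | Decreasing \<Rightarrow> strict_antimono_on (cell_points n a b \<sigma> i j) \<sigma>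
     | Blank \<Rightarrow> cell_points n a b \<sigma> i j = {}"
    proof (cases "entry M i j")
      case Increasing
      then show ?thesis using f[OF ij] by (auto simp: ok_def cell monotone_on_def agree)
    next
      case Decreasing
      then show ?thesis using f[OF ij] by (auto simp: ok_def cell monotone_on_def agree)
    next
      case Blank
      then have "card (K i j) = 0" using card[OF ij] blank by simp
      then show ?thesis using Blank cell by (simp add: K_def)
    qed
  qed
  ultimately show ?thesis using perm by blast
qed

lemma finite_Grid: "finite (Grid M n)"
  by (rule finite_subset[OF _ finite_permutations[of "{1..n}"]]) (auto simp: Grid_def)

text \<open>
  With the cuts fixed by the line sums of \<open>A\<close>, different pairs of words of type \<open>A\<close> give different permutations.
\<close>

lemma card_Grid_ge:
  fixes A :: "nat \<Rightarrow> nat \<Rightarrow> nat"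
  assumes blank: "\<And>i j. entry M i j = Blank \<Longrightarrow> A i j = 0"
    and total: "(\<Sum>i=1..ncols M. \<Sum>j=1..nrows M. A i j) = n"
  shows "(\<Prod>i=1..ncols M. fact (\<Sum>j=1..nrows M. A i j)) * (\<Prod>j=1..nrows M. fact (\<Sum>i=1..ncols M. A i j)) \<le>
    card (Grid M n) * (\<Prod>i=1..ncols M. \<Prod>j=1..nrows M. fact (A i j))\<^sup>2"
proof -
  define c where "c = (\<lambda>i. \<Sum>i'=1..i. \<Sum>j=1..nrows M. A i' j)"
  define r where "r = (\<lambda>j. \<Sum>j'=1..j. \<Sum>i=1..ncols M. A i j')"
  have c: "cuts (ncols M) n c"
    using total by (simp add: cuts_def c_def)
  have r: "cuts (nrows M) n r"
    using total sum.swap[of A "{1..nrows M}" "{1..ncols M}"] by (simp add: cuts_def r_def)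
  let ?a = "block c" and ?b = "block r"
  have card_c: "card {k \<in> {1..n}. ?a k = i} = (\<Sum>j=1..nrows M. A i j)" if i: "i \<in> {1..ncols M}" for i
  proof -
    have "{k \<in> {1..n}. ?a k = i} = {c (i - 1)<..c i}"
      using card_block[OF c i order_refl] cuts_le[OF c, of i] i by (simp add: min_absorb2)
    moreover have "c i = c (i - 1) + (\<Sum>j=1..nrows M. A i j)"
      using i by (cases i) (auto simp: c_def)
    ultimately show ?thesis by simp
  qed
  have card_r: "card {y \<in> {1..n}. ?b y = j} = (\<Sum>i=1..ncols M. A i j)" if j: "j \<in> {1..nrows M}" for j
  proof -
    have "{y \<in> {1..n}. ?b y = j} = {r (j - 1)<..r j}"
      using card_block[OF r j order_refl] cuts_le[OF r, of j] j by (simp add: min_absorb2)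
    moreover have "r j = r (j - 1) + (\<Sum>i=1..ncols M. A i j)"
      using j by (cases j) (auto simp: r_def)
    ultimately show ?thesis by simp
  qed
  define W where "W = words_of_type {1..n} {1..ncols M} {1..nrows M} ?a A"
  define V where "V = words_of_type {1..n} {1..nrows M} {1..ncols M} ?b (\<lambda>j i. A i j)"
  define P where "P = (\<Prod>i=1..ncols M. \<Prod>j=1..nrows M. fact (A i j) :: nat)"
  have e1: "card W * P = (\<Prod>i=1..ncols M. fact (\<Sum>j=1..nrows M. A i j))"
    using card_words_of_type[of "{1..n}" "{1..ncols M}" "{1..nrows M}" ?a A] block_mem[OF c] card_c
    by (simp add: W_def P_def)
  have e2: "card V * P = (\<Prod>j=1..nrows M. fact (\<Sum>i=1..ncols M. A i j))"
    using card_words_of_type[of "{1..n}" "{1..nrows M}" "{1..ncols M}" ?b "\<lambda>j i. A i j"] block_mem[OF r] card_r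
      prod.swap[of "\<lambda>i j. fact (A i j) :: nat" "{1..nrows M}" "{1..ncols M}"]
    by (simp add: V_def P_def)
  have prod: "(\<Prod>i=1..ncols M. fact (\<Sum>j=1..nrows M. A i j)) *
      (\<Prod>j=1..nrows M. fact (\<Sum>i=1..ncols M. A i j)) = card W * card V * P\<^sup>2"
    unfolding e1[symmetric] e2[symmetric] by (simp add: power2_eq_square mult_ac)
  have "\<exists>\<sigma>. \<sigma> permutes {1..n} \<and> monotone_cells M n ?a ?b \<sigma> \<and> col_word n ?b \<sigma> = w \<and> row_word n ?a \<sigma> = v"
    if "w \<in> W" "v \<in> V" for w v
    using that block_mem[OF c] block_mem[OF r] blank unfolding W_def V_def by (intro permutation_with_words)
  then obtain s where s: "\<And>w v. w \<in> W \<Longrightarrow> v \<in> V \<Longrightarrow> s w v permutes {1..n} \<and>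
      monotone_cells M n ?a ?b (s w v) \<and> col_word n ?b (s w v) = w \<and> row_word n ?a (s w v) = v"
    by metis
  have "card (W \<times> V) \<le> card (Grid M n)"
  proof (rule card_inj_on_le)
    show "inj_on (case_prod s) (W \<times> V)"
    proof (rule inj_onI, clarify)
      fix w v w' v' assume "w \<in> W" "v \<in> V" "w' \<in> W" "v' \<in> V" "s w v = s w' v'"
      then show "w = w' \<and> v = v'" using s[of w v] s[of w' v'] by metis
    qed
    show "case_prod s ` (W \<times> V) \<subseteq> Grid M n"
      using s c r is_gridding_iff unfolding Grid_def by fast
  qed (rule finite_Grid)
  then show ?thesis
    unfolding prod P_def[symmetric] by (simp add: card_cartesian_product)
qed

section \<open>Growth of the number of gridded permutations\<close>

text \<open>
  A weak form of Stirling's formula, by induction with the tangents of \<open>x ln x\<close>.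
\<close>

lemma ln_fact_bounds:
  "real m * ln (real m) - real m \<le> ln (fact m)"
  "ln (fact m) \<le> real m * ln (real m) - real m + ln (real m + 1) + 1"
proof -
  have *: "real m * ln (real m) - real m \<le> ln (fact m) \<and>
    ln (fact m) \<le> (real m + 1) * ln (real m + 1) - real m"
  proof (induction m)
    case (Suc m)
    define x where "x = real m + 1"
    have x: "x \<ge> 1" by (simp add: x_def)
    have f: "ln (fact (Suc m) :: real) = ln x + ln (fact m)"
      by (simp add: ln_mult x_def add.commute)
    have "x * ln x + ((x - 1) - x) * (ln x + 1) \<le> (x - 1) * ln (x - 1)"
      using x by (intro mult_ln_tangent) auto
    moreover have "(x + 1) * ln (x + 1) + (x - (x + 1)) * (ln (x + 1) + 1) \<le> x * ln x"
      using x by (intro mult_ln_tangent) auto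
    moreover have "(x + 1) * ln (x + 1) \<ge> x * ln x + (x + 1 - x) * (ln x + 1)"
      using x by (intro mult_ln_tangent) auto
    ultimately show ?case
      using Suc unfolding f by (simp add: x_def algebra_simps)
  qed simp
  show "real m * ln (real m) - real m \<le> ln (fact m)" using * by blast
  have "(real m + 1) * ln (real m + 1) + (real m - (real m + 1)) * (ln (real m + 1) + 1) \<le> real m * ln (real m)"
    by (rule mult_ln_tangent) auto
  then show "ln (fact m) \<le> real m * ln (real m) - real m + ln (real m + 1) + 1"
    using * by (simp add: algebra_simps)
qed

text \<open>
  The subtracted terms are linear in \<open>x n\<close>. They cancel in the logarithm of the bound of \<open>card_Grid_ge\<close>, where the
  column sums and the row sums enter once and the entries enter twice with the opposite sign.
\<close>

lemma ln_fact_scaled_limit: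
  fixes x :: "nat \<Rightarrow> nat"
  assumes le: "\<And>n. x n \<le> n" and lim: "(\<lambda>n. x n / n) \<longlonglongrightarrow> \<gamma>"
  shows "(\<lambda>n. (ln (fact (x n)) - x n * ln n + x n) / n) \<longlonglongrightarrow> \<gamma> * ln \<gamma>"
proof -
  have \<gamma>: "\<gamma> \<ge> 0" using lim by (rule LIMSEQ_le_const) (auto intro!: exI[of _ 0])
  have h: "(\<lambda>n. (x n / n) * ln (x n / n)) \<longlonglongrightarrow> \<gamma> * ln \<gamma>"
    using continuous_on_tendsto_compose[OF continuous_on_mult_ln lim] \<gamma> by simp
  have scale: "(x n * ln (x n) - x n * ln n) / n = (x n / n) * ln (x n / n)" if "n > 0" for n
    using that by (cases "x n = 0") (auto simp: ln_div algebra_simps diff_divide_distrib)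
  have "(\<lambda>n. (ln (real n + 1) + 1) / n) \<longlonglongrightarrow> 0" by real_asymp
  then have up: "(\<lambda>n. (x n / n) * ln (x n / n) + (ln (real n + 1) + 1) / n) \<longlonglongrightarrow> \<gamma> * ln \<gamma> + 0"
    by (intro tendsto_add h)
  show ?thesis
  proof (rule tendsto_sandwich[OF _ _ h])
    show "(\<lambda>n. (x n / n) * ln (x n / n) + (ln (real n + 1) + 1) / n) \<longlonglongrightarrow> \<gamma> * ln \<gamma>"
      using up by simp
    show "\<forall>\<^sub>F n in sequentially. (x n / n) * ln (x n / n) \<le> (ln (fact (x n)) - x n * ln n + x n) / n"
    proof (rule eventually_sequentiallyI[of 1])
      fix n :: nat assume "1 \<le> n"
      then have "(x n / n) * ln (x n / n) = (x n * ln (x n) - x n * ln n) / n" using scale by simp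
      also have "\<dots> \<le> (ln (fact (x n)) - x n * ln n + x n) / n"
        using ln_fact_bounds(1)[of "x n"] by (intro divide_right_mono) auto
      finally show "(x n / n) * ln (x n / n) \<le> (ln (fact (x n)) - x n * ln n + x n) / n" .
    qed
    show "\<forall>\<^sub>F n in sequentially. (ln (fact (x n)) - x n * ln n + x n) / n \<le>
        (x n / n) * ln (x n / n) + (ln (real n + 1) + 1) / n"
    proof (rule eventually_sequentiallyI[of 1])
      fix n :: nat assume n: "1 \<le> n"
      have "ln (real (x n) + 1) \<le> ln (real n + 1)" using le[of n] by simp
      then have "(ln (fact (x n)) - x n * ln n + x n) / n \<le> (x n * ln (x n) - x n * ln n + (ln (real n + 1) + 1)) / n"
        using ln_fact_bounds(2)[of "x n"] by (intro divide_right_mono) (linarith, simp)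
      also have "\<dots> = (x n / n) * ln (x n / n) + (ln (real n + 1) + 1) / n"
        using scale[of n] n by (simp add: add_divide_distrib)
      finally show "(ln (fact (x n)) - x n * ln n + x n) / n \<le>
        (x n / n) * ln (x n / n) + (ln (real n + 1) + 1) / n" .
    qed
  qed
qed

lemma sum_single_cell:
  assumes "finite I" "finite J" "i0 \<in> I" "j0 \<in> J"
  shows "(\<Sum>i\<in>I. \<Sum>j\<in>J. if i = i0 then if j = j0 then x else 0 else 0) = (x :: 'a::comm_monoid_add)"
proof -
  have "(\<Sum>i\<in>I. \<Sum>j\<in>J. if i = i0 then if j = j0 then x else 0 else 0) = (\<Sum>i\<in>I. if i = i0 then x else 0)"
    using assms by (intro sum.cong refl) auto
  then show ?thesis using assms by simp
qed

text \<open>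
  Round all entries of \<open>n \<Gamma>\<close> down and put the remainder into one non-blank cell.
\<close>

lemma integer_approximation:
  assumes D: "distribution_matrix M \<Gamma>"
  shows "\<exists>A :: nat \<Rightarrow> nat \<Rightarrow> nat \<Rightarrow> nat. (\<forall>n i j. (i, j) \<notin> nonblank_cells M \<longrightarrow> A n i j = 0) \<and>
    (\<forall>n. (\<Sum>i=1..ncols M. \<Sum>j=1..nrows M. A n i j) = n) \<and> (\<forall>i j. (\<lambda>n. A n i j / n) \<longlonglongrightarrow> \<Gamma> i j)"
proof -
  have nn: "0 \<le> \<Gamma> i j" for i j using D by (simp add: distribution_matrix_def)
  have tot: "(\<Sum>i=1..ncols M. \<Sum>j=1..nrows M. \<Gamma> i j) = 1" using D by (simp add: distribution_matrix_def)
  have "nonblank_cells M \<noteq> {}"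
  proof
    assume "nonblank_cells M = {}"
    then have "\<Gamma> i j = 0" for i j using D by (simp add: distribution_matrix_def)
    then show False using tot by simp
  qed
  then obtain i0 j0 where cell: "(i0, j0) \<in> nonblank_cells M" by auto
  then have ij0: "i0 \<in> {1..ncols M}" "j0 \<in> {1..nrows M}" by (auto simp: nonblank_cells_def)
  define B where "B = (\<lambda>n i j. nat \<lfloor>real n * \<Gamma> i j\<rfloor>)"
  define R where "R = (\<lambda>n. n - (\<Sum>i=1..ncols M. \<Sum>j=1..nrows M. B n i j))"
  define A where "A = (\<lambda>n i j. B n i j + (if i = i0 then if j = j0 then R n else 0 else 0))"
  have Ble: "real (B n i j) \<le> n * \<Gamma> i j" for n i j
    using nn by (simp add: B_def)
  have le: "(\<Sum>i=1..ncols M. \<Sum>j=1..nrows M. B n i j) \<le> n" for n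
  proof -
    have "real (\<Sum>i=1..ncols M. \<Sum>j=1..nrows M. B n i j) \<le> (\<Sum>i=1..ncols M. \<Sum>j=1..nrows M. n * \<Gamma> i j)"
      unfolding of_nat_sum by (intro sum_mono Ble)
    also have "\<dots> = real n"
      using tot by (simp only: sum_distrib_left[symmetric] mult_1_right)
    finally show ?thesis by linarith
  qed
  have limB: "(\<lambda>n. B n i j / n) \<longlonglongrightarrow> \<Gamma> i j" for i j
  proof (rule tendsto_sandwich[where f = "\<lambda>n. \<Gamma> i j - 1 / real n" and h = "\<lambda>_. \<Gamma> i j"])
    show "\<forall>\<^sub>F n in sequentially. \<Gamma> i j - 1 / n \<le> B n i j / n"
    proof (rule eventually_sequentiallyI[of 1])
      fix n :: nat assume "1 \<le> n"
      moreover have "n * \<Gamma> i j - 1 \<le> B n i j" unfolding B_def by linarith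
      then have "(n * \<Gamma> i j - 1) / n \<le> B n i j / n" by (rule divide_right_mono) simp
      ultimately show "\<Gamma> i j - 1 / n \<le> B n i j / n" by (simp add: diff_divide_distrib)
    qed
    show "\<forall>\<^sub>F n in sequentially. B n i j / n \<le> \<Gamma> i j"
      using Ble[of _ i j] by (intro eventually_sequentiallyI[of 1]) (simp add: field_simps)
    show "(\<lambda>n. \<Gamma> i j - 1 / real n) \<longlonglongrightarrow> \<Gamma> i j" by real_asymp
  qed simp
  have "(\<lambda>n. R n / n) \<longlonglongrightarrow> 1 - 1"
  proof (rule Lim_transform_eventually)
    show "(\<lambda>n. 1 - (\<Sum>i=1..ncols M. \<Sum>j=1..nrows M. B n i j / n)) \<longlonglongrightarrow> 1 - 1"
      unfolding tot[symmetric] by (intro tendsto_intros limB)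
    show "\<forall>\<^sub>F n in sequentially. 1 - (\<Sum>i=1..ncols M. \<Sum>j=1..nrows M. B n i j / n) = R n / n"
      using le by (intro eventually_sequentiallyI[of 1])
        (simp add: R_def of_nat_diff diff_divide_distrib sum_divide_distrib)
  qed
  then have "(\<lambda>n. (if i = i0 then if j = j0 then R n else 0 else 0) / n) \<longlonglongrightarrow> 0" for i j
    by (cases "i = i0"; cases "j = j0") auto
  then have "(\<lambda>n. A n i j / n) \<longlonglongrightarrow> \<Gamma> i j" for i j
    using tendsto_add[OF limB[of i j]] by (fastforce simp: A_def add_divide_distrib)
  moreover have "(\<Sum>i=1..ncols M. \<Sum>j=1..nrows M. A n i j) = n" for n
    using ij0 le[of n] unfolding A_def sum.distrib by (subst sum_single_cell) (auto simp: R_def)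
  moreover have "A n i j = 0" if "(i, j) \<notin> nonblank_cells M" for n i j
    using that cell D by (auto simp: A_def B_def distribution_matrix_def)
  ultimately show ?thesis by blast
qed

lemma card_Grid_lower_bound:
  assumes D: "distribution_matrix M \<Gamma>" and \<delta>: "\<delta> > 0"
  shows "\<forall>\<^sub>F n in sequentially. exp (n * (grid_entropy M \<Gamma> - \<delta>)) \<le> card (Grid M n)"
proof -
  obtain A :: "nat \<Rightarrow> nat \<Rightarrow> nat \<Rightarrow> nat" where
    A0: "\<And>n i j. (i, j) \<notin> nonblank_cells M \<Longrightarrow> A n i j = 0" and
    An: "\<And>n. (\<Sum>i=1..ncols M. \<Sum>j=1..nrows M. A n i j) = n" and
    Alim: "\<And>i j. (\<lambda>n. A n i j / n) \<longlonglongrightarrow> \<Gamma> i j"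
    using integer_approximation[OF D] by metis
  define c where "c = (\<lambda>n i. \<Sum>j=1..nrows M. A n i j)"
  define r where "r = (\<lambda>n j. \<Sum>i=1..ncols M. A n i j)"
  have cn: "(\<Sum>i=1..ncols M. c n i) = n" for n using An by (simp add: c_def)
  have rn: "(\<Sum>j=1..nrows M. r n j) = n" for n
    using An[of n] sum.swap[of "A n" "{1..nrows M}" "{1..ncols M}"] by (simp add: r_def)
  have cle: "c n i \<le> n" if "i \<in> {1..ncols M}" for n i
    using member_le_sum[OF that, of "c n"] cn[of n] by simp
  have rle: "r n j \<le> n" if "j \<in> {1..nrows M}" for n j
    using member_le_sum[OF that, of "r n"] rn[of n] by simp
  have Ale: "A n i j \<le> n" if "i \<in> {1..ncols M}" "j \<in> {1..nrows M}" for n i j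
    using member_le_sum[OF that(2), of "A n i"] cle[OF that(1), of n] by (simp add: c_def)
  have clim: "(\<lambda>n. c n i / n) \<longlonglongrightarrow> col_sum M \<Gamma> i" for i
    unfolding c_def col_sum_def of_nat_sum sum_divide_distrib by (intro tendsto_sum Alim)
  have rlim: "(\<lambda>n. r n j / n) \<longlonglongrightarrow> row_sum M \<Gamma> j" for j
    unfolding r_def row_sum_def of_nat_sum sum_divide_distrib by (intro tendsto_sum Alim)
  define q where "q = (\<lambda>n m :: nat. (ln (fact m) - m * ln n + m) / n)"
  \<comment> \<open>the logarithm of the lower bound of \<open>card_Grid_ge\<close>\<close>
  define L where "L = (\<lambda>n. (\<Sum>i=1..ncols M. ln (fact (c n i))) + (\<Sum>j=1..nrows M. ln (fact (r n j))) -
      2 * (\<Sum>i=1..ncols M. \<Sum>j=1..nrows M. ln (fact (A n i j) :: real)))"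
  have "(\<lambda>n. (\<Sum>i=1..ncols M. q n (c n i)) + (\<Sum>j=1..nrows M. q n (r n j)) -
      2 * (\<Sum>i=1..ncols M. \<Sum>j=1..nrows M. q n (A n i j))) \<longlonglongrightarrow> grid_entropy M \<Gamma>"
    unfolding grid_entropy_def q_def
    by (intro tendsto_add tendsto_diff tendsto_mult_left tendsto_sum ln_fact_scaled_limit
        clim rlim Alim cle rle Ale) auto
  moreover have "(\<Sum>i=1..ncols M. q n (c n i)) + (\<Sum>j=1..nrows M. q n (r n j)) -
      2 * (\<Sum>i=1..ncols M. \<Sum>j=1..nrows M. q n (A n i j)) = L n / n" for n
  proof -
    have lin: "(\<Sum>x\<in>X. q n (f x)) = ((\<Sum>x\<in>X. ln (fact (f x))) - (\<Sum>x\<in>X. f x) * ln n + (\<Sum>x\<in>X. f x)) / n"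
      for X and f :: "nat \<Rightarrow> nat"
      unfolding q_def by (simp add: sum.distrib sum_subtractf sum_distrib_right flip: sum_divide_distrib)
    have "(\<Sum>i=1..ncols M. \<Sum>j=1..nrows M. q n (A n i j)) =
      (\<Sum>i=1..ncols M. ((\<Sum>j=1..nrows M. ln (fact (A n i j))) - c n i * ln n + c n i) / n)"
      unfolding lin c_def ..
    also have "\<dots> = ((\<Sum>i=1..ncols M. \<Sum>j=1..nrows M. ln (fact (A n i j))) - n * ln n + n) / n"
      using arg_cong[OF cn[of n], of real]
      by (simp add: sum.distrib sum_subtractf flip: sum_divide_distrib sum_distrib_right)
    finally show ?thesis
      unfolding lin cn rn L_def by (simp add: add_divide_distrib diff_divide_distrib)
  qed
  ultimately have "(\<lambda>n. L n / n) \<longlonglongrightarrow> grid_entropy M \<Gamma>" by simp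
  then have "\<forall>\<^sub>F n in sequentially. grid_entropy M \<Gamma> - \<delta> < L n / n"
    by (rule order_tendstoD) (use \<delta> in simp)
  moreover have "\<forall>\<^sub>F n in sequentially. n > (0::nat)" by (rule eventually_gt_at_top)
  ultimately show ?thesis
  proof eventually_elim
    case (elim n)
    define P where "P = (\<Prod>i=1..ncols M. \<Prod>j=1..nrows M. fact (A n i j) :: nat)"
    define Q where "Q = (\<Prod>i=1..ncols M. fact (c n i)) * (\<Prod>j=1..nrows M. fact (r n j) :: nat)"
    have "Q \<le> card (Grid M n) * P\<^sup>2"
      unfolding Q_def P_def c_def r_def
    proof (rule card_Grid_ge[OF _ An])
      show "A n i j = 0" if "entry M i j = Blank" for i j
        using A0 that by (simp add: nonblank_cells_def)
    qed
    then have "real Q \<le> real (card (Grid M n)) * (real P)\<^sup>2"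
      by (metis of_nat_le_iff of_nat_mult of_nat_power)
    moreover have "real Q = exp (L n) * (real P)\<^sup>2"
      unfolding L_def exp_diff exp_add Q_def P_def
      by (simp add: exp_sum exp_double)
    ultimately have "exp (L n) * (real P)\<^sup>2 \<le> real (card (Grid M n)) * (real P)\<^sup>2"
      by simp
    moreover have "0 < (real P)\<^sup>2"
      by (simp add: P_def prod_pos)
    ultimately have "exp (L n) \<le> card (Grid M n)" by (rule mult_right_le_imp_le)
    moreover have "n * (grid_entropy M \<Gamma> - \<delta>) \<le> L n"
      using elim by (simp add: field_simps)
    ultimately show ?case by (meson exp_le_cancel_iff order_trans)
  qed
qed

lemma Grid_nonempty:
  assumes "nonblank_cells M \<noteq> {}"
  shows "Grid M n \<noteq> {}"
proof
  assume "Grid M n = {}"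
  obtain i0 j0 where cell: "(i0, j0) \<in> nonblank_cells M" using assms by auto
  then have ij: "i0 \<in> {1..ncols M}" "j0 \<in> {1..nrows M}" "entry M i0 j0 \<noteq> Blank"
    by (auto simp: nonblank_cells_def)
  have "(\<Prod>i=1..ncols M. fact (\<Sum>j=1..nrows M. if i = i0 then if j = j0 then n else 0 else 0)) *
      (\<Prod>j=1..nrows M. fact (\<Sum>i=1..ncols M. if i = i0 then if j = j0 then n else 0 else 0)) \<le>
      card (Grid M n) *
        (\<Prod>i=1..ncols M. \<Prod>j=1..nrows M. fact (if i = i0 then if j = j0 then n else 0 else 0))\<^sup>2"
  proof (rule card_Grid_ge)
    show "(if i = i0 then if j = j0 then n else 0 else 0) = 0" if "entry M i j = Blank" for i j
      using that ij by auto
    show "(\<Sum>i=1..ncols M. \<Sum>j=1..nrows M. if i = i0 then if j = j0 then n else 0 else 0) = n"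
      using ij by (intro sum_single_cell) auto
  qed
  then show False
    using \<open>Grid M n = {}\<close> by (simp add: prod_zero_iff)
qed

section \<open>Finite mixtures of probability measures\<close>

lemma space_weighted_sum_measure [simp]: "space (weighted_sum_measure I w \<nu>) = UNIV"
  using sets_eq_imp_space_eq[OF sets_weighted_sum_measure[of I w \<nu>]] by simp

lemma nn_integral_weighted_sum_measure:
  assumes sets: "\<And>i. i \<in> I \<Longrightarrow> sets (\<nu> i) = sets borel" and f: "f \<in> borel_measurable borel"
  shows "(\<integral>\<^sup>+x. f x \<partial>weighted_sum_measure I w \<nu>) = (\<Sum>i\<in>I. ennreal (w i) * (\<integral>\<^sup>+x. f x \<partial>\<nu> i))"
proof -
  have meas: "g \<in> borel_measurable (\<nu> i)" if "i \<in> I" "g \<in> borel_measurable borel" for i and g :: "_ \<Rightarrow> ennreal"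
    using that measurable_cong_sets[OF sets[OF that(1)] refl] by blast
  have meas': "g \<in> borel_measurable (weighted_sum_measure I w \<nu>)" if "g \<in> borel_measurable borel" for g :: "_ \<Rightarrow> ennreal"
    using that measurable_cong_sets[OF sets_weighted_sum_measure refl] by blast
  show ?thesis
    using f
  proof (induction rule: borel_measurable_induct)
    case (cong f g)
    then have "f = g" by (simp add: fun_eq_iff)
    then show ?case using cong by simp
  next
    case (set A)
    then show ?case by (simp add: sets emeasure_weighted_sum_measure)
  next
    case (mult u c)
    then show ?case
      by (simp add: nn_integral_cmult meas meas' sum_distrib_left mult.left_commute cong: sum.cong)
  next
    case (add u v)
    then show ?case
      by (simp add: nn_integral_add meas meas' sum.distrib distrib_left cong: sum.cong)
  next
    case (seq U)
    have mono: "incseq U" by (rule seq.hyps)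
    have borel: "U n \<in> borel_measurable borel" for n by (rule seq.hyps)
    have limit: "(\<integral>\<^sup>+x. (SUP n. U n) x \<partial>N) = (SUP n. \<integral>\<^sup>+x. U n x \<partial>N)" if "sets N = sets borel" for N
      unfolding SUP_apply
      using mono borel measurable_cong_sets[OF that refl] by (intro nn_integral_monotone_convergence_SUP) auto
    have "(\<integral>\<^sup>+x. (SUP n. U n) x \<partial>weighted_sum_measure I w \<nu>) =
        (SUP n. \<Sum>i\<in>I. ennreal (w i) * (\<integral>\<^sup>+x. U n x \<partial>\<nu> i))"
      unfolding limit[OF sets_weighted_sum_measure] seq.IH ..
    also have "\<dots> = (\<Sum>i\<in>I. SUP n. ennreal (w i) * (\<integral>\<^sup>+x. U n x \<partial>\<nu> i))"
      using mono by (intro ennreal_SUP_sum incseq_SucI mult_left_mono nn_integral_mono)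
        (auto simp: incseq_Suc_iff le_fun_def)
    also have "\<dots> = (\<Sum>i\<in>I. ennreal (w i) * (\<integral>\<^sup>+x. (SUP n. U n) x \<partial>\<nu> i))"
      by (intro sum.cong refl) (simp only: limit[OF sets] SUP_mult_left_ennreal)
    finally show ?case .
  qed
qed

locale mixture =
  fixes I :: "'i set" and w :: "'i \<Rightarrow> real" and \<nu> :: "'i \<Rightarrow> 'a::topological_space measure"
  assumes w_nonneg: "\<And>i. i \<in> I \<Longrightarrow> 0 \<le> w i" and sum_w: "sum w I = 1"
    and prob: "\<And>i. i \<in> I \<Longrightarrow> prob_space (\<nu> i)"
    and sets_component: "\<And>i. i \<in> I \<Longrightarrow> sets (\<nu> i) = sets borel"
begin

lemma measure_mixture:
  assumes "A \<in> sets borel"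
  shows "measure (weighted_sum_measure I w \<nu>) A = (\<Sum>i\<in>I. w i * measure (\<nu> i) A)"
proof -
  have "emeasure (weighted_sum_measure I w \<nu>) A = (\<Sum>i\<in>I. ennreal (w i) * emeasure (\<nu> i) A)"
    using assms sets_component by (simp add: emeasure_weighted_sum_measure)
  also have "\<dots> = (\<Sum>i\<in>I. ennreal (w i * measure (\<nu> i) A))"
    using prob w_nonneg
    by (intro sum.cong refl) (simp add: ennreal_mult prob_space.finite_measure finite_measure.emeasure_eq_measure)
  also have "\<dots> = ennreal (\<Sum>i\<in>I. w i * measure (\<nu> i) A)"
    using w_nonneg by (intro sum_ennreal) simp
  finally show ?thesis
    using w_nonneg by (simp add: measure_def sum_nonneg)
qed

lemma prob_space_mixture: "prob_space (weighted_sum_measure I w \<nu>)"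
proof (rule prob_spaceI)
  have "emeasure (weighted_sum_measure I w \<nu>) UNIV = (\<Sum>i\<in>I. ennreal (w i) * emeasure (\<nu> i) UNIV)"
    using sets_component by (simp add: emeasure_weighted_sum_measure)
  also have "\<dots> = (\<Sum>i\<in>I. ennreal (w i))"
  proof (intro sum.cong refl)
    fix i assume i: "i \<in> I"
    have "space (\<nu> i) = UNIV" using sets_eq_imp_space_eq[OF sets_component[OF i]] by simp
    then show "ennreal (w i) * emeasure (\<nu> i) UNIV = ennreal (w i)"
      using prob_space.emeasure_space_1[OF prob[OF i]] by simp
  qed
  also have "\<dots> = 1"
    using w_nonneg sum_w by (simp add: sum_ennreal)
  finally show "emeasure (weighted_sum_measure I w \<nu>) (space (weighted_sum_measure I w \<nu>)) = 1"
    by simp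
qed

text \<open>
  Adding the constant \<open>B\<close> makes the integrand nonnegative and reduces the claim to nonnegative integrals.
\<close>

lemma integral_mixture:
  fixes f :: "'a \<Rightarrow> real"
  assumes f: "f \<in> borel_measurable borel" and bound: "\<And>x. \<bar>f x\<bar> \<le> B"
  shows "(LINT x|weighted_sum_measure I w \<nu>. f x) = (\<Sum>i\<in>I. w i * (LINT x|\<nu> i. f x))"
proof -
  have nn: "0 \<le> f x + B" for x using bound[of x] by simp
  have integrable: "integrable N f" if "prob_space N" "sets N = sets borel" for N
  proof -
    interpret prob_space N by fact
    have "f \<in> borel_measurable N" using f measurable_cong_sets[OF that(2) refl] by blast
    then show ?thesis using bound by (intro integrable_const_bound[where B = B]) auto
  qed
  have shift: "(\<integral>\<^sup>+x. ennreal (f x + B) \<partial>N) = ennreal ((LINT x|N. f x) + B)" "0 \<le> (LINT x|N. f x) + B"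
    if N: "prob_space N" "sets N = sets borel" for N
  proof -
    interpret prob_space N by fact
    have "integrable N (\<lambda>x. f x + B)" using integrable[OF N] by simp
    then have "(\<integral>\<^sup>+x. ennreal (f x + B) \<partial>N) = ennreal (LINT x|N. f x + B)"
      using nn by (intro nn_integral_eq_integral) auto
    moreover have "(LINT x|N. f x + B) = (LINT x|N. f x) + B"
      using integrable[OF N] by (simp add: prob_space)
    moreover have "0 \<le> (LINT x|N. f x + B)" using nn by (intro integral_nonneg_AE) auto
    ultimately show "(\<integral>\<^sup>+x. ennreal (f x + B) \<partial>N) = ennreal ((LINT x|N. f x) + B)" "0 \<le> (LINT x|N. f x) + B"
      by auto
  qed
  let ?N = "weighted_sum_measure I w \<nu>"
  have "ennreal ((LINT x|?N. f x) + B) = (\<integral>\<^sup>+x. ennreal (f x + B) \<partial>?N)"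
    using shift(1)[OF prob_space_mixture] by simp
  also have "\<dots> = (\<Sum>i\<in>I. ennreal (w i) * (\<integral>\<^sup>+x. ennreal (f x + B) \<partial>\<nu> i))"
    using f by (intro nn_integral_weighted_sum_measure sets_component) auto
  also have "\<dots> = (\<Sum>i\<in>I. ennreal (w i * ((LINT x|\<nu> i. f x) + B)))"
    using shift[OF prob sets_component] w_nonneg by (intro sum.cong refl) (simp add: ennreal_mult)
  also have "\<dots> = ennreal (\<Sum>i\<in>I. w i * ((LINT x|\<nu> i. f x) + B))"
    using shift(2)[OF prob sets_component] w_nonneg by (intro sum_ennreal) simp
  finally have "(LINT x|?N. f x) + B = (\<Sum>i\<in>I. w i * ((LINT x|\<nu> i. f x) + B))"
    using shift(2)[OF prob_space_mixture] shift(2)[OF prob sets_component] w_nonneg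
    by (subst (asm) ennreal_inj) (auto intro!: sum_nonneg)
  also have "\<dots> = (\<Sum>i\<in>I. w i * (LINT x|\<nu> i. f x)) + B"
    using sum_w by (simp add: distrib_left sum.distrib flip: sum_distrib_right)
  finally show ?thesis by simp
qed

end

section \<open>Marginals\<close>

text \<open>
  The length of \<open>[a, b] \<inter> [x, y]\<close> is \<open>clip a b y - clip a b x\<close>. Expressed in this way the marginals of a permuton that is
  assembled from pieces become telescoping sums.
\<close>

definition clip :: "real \<Rightarrow> real \<Rightarrow> real \<Rightarrow> real" where
  "clip a b x = max a (min b x)"

lemma measure_interval_Int:
  assumes "a \<le> b" "x \<le> y"
  shows "measure lborel ({a..b} \<inter> {x..y}) = clip a b y - clip a b x"
proof -
  have "{a..b} \<inter> {x..y} = {max a x..min b y}" by auto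
  then show ?thesis using assms by (auto simp: clip_def)
qed

lemma emeasure_rectangle:
  fixes a b c d :: real
  assumes "a \<le> b" "c \<le> d"
  shows "emeasure lborel ({a..b} \<times> {c..d}) = ennreal ((b - a) * (d - c))"
  using assms by (simp add: lborel_prod[symmetric] lborel.emeasure_pair_measure_Times ennreal_mult)

lemma measure_Times:
  assumes "A \<in> sets borel" "B \<in> sets (borel :: real measure)"
  shows "measure lborel (A \<times> B) = measure lborel A * measure lborel B"
  using assms by (simp add: measure_def lborel_prod[symmetric] lborel.emeasure_pair_measure_Times enn2real_mult)

lemma uniform_rectangle:
  fixes x1 x2 y1 y2 :: real
  assumes x: "0 \<le> x1" "x1 < x2" "x2 \<le> 1" and y: "0 \<le> y1" "y1 < y2" "y2 \<le> 1"
  defines "U \<equiv> uniform_measure lborel ({x1..x2} \<times> {y1..y2})"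
  shows "prob_space U" "sets U = sets borel"
    and "0 \<le> a \<Longrightarrow> a \<le> b \<Longrightarrow> b \<le> 1 \<Longrightarrow>
      measure U ({a..b} \<times> {0..1}) = (clip a b x2 - clip a b x1) / (x2 - x1)"
    and "0 \<le> a \<Longrightarrow> a \<le> b \<Longrightarrow> b \<le> 1 \<Longrightarrow>
      measure U ({0..1} \<times> {a..b}) = (clip a b y2 - clip a b y1) / (y2 - y1)"
proof -
  let ?S = "{x1..x2} \<times> {y1..y2}"
  have e: "emeasure lborel ?S = ennreal ((x2 - x1) * (y2 - y1))"
    using x y by (intro emeasure_rectangle) auto
  have "0 < (x2 - x1) * (y2 - y1)"
    using x y by (intro mult_pos_pos) auto
  then have S: "emeasure lborel ?S \<noteq> 0" "emeasure lborel ?S \<noteq> \<infinity>"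
    unfolding e by (metis ennreal_eq_0_iff not_le, simp)
  have m: "measure lborel ?S = (x2 - x1) * (y2 - y1)"
    using e x y by (simp add: measure_def)
  show "prob_space U" unfolding U_def by (rule prob_space_uniform_measure[OF S])
  show "sets U = sets borel" by (simp add: U_def)
  assume ab: "0 \<le> a" "a \<le> b" "b \<le> 1"
  have c: "{c..d} \<inter> {0..1} = {c..d}" if "0 \<le> c" "d \<le> 1" for c d :: real
    using that by auto
  have box: "{c..d} \<times> {c'..d'} \<in> sets lborel" for c d c' d' :: real
    by (simp add: borel_closed closed_Times)
  have "measure U ({a..b} \<times> {0..1}) = measure lborel (({a..b} \<inter> {x1..x2}) \<times> ({y1..y2} \<inter> {0..1})) / ((x2 - x1) * (y2 - y1))"
    unfolding U_def measure_uniform_measure[OF S box] m by (simp add: Times_Int_Times Int_commute)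
  also have "\<dots> = (clip a b x2 - clip a b x1) * (y2 - y1) / ((x2 - x1) * (y2 - y1))"
    using ab x y by (simp add: measure_Times measure_interval_Int c del: Int_atLeastAtMost)
  finally show "measure U ({a..b} \<times> {0..1}) = (clip a b x2 - clip a b x1) / (x2 - x1)"
    using x y by simp
  have "measure U ({0..1} \<times> {a..b}) = measure lborel (({x1..x2} \<inter> {0..1}) \<times> ({a..b} \<inter> {y1..y2})) / ((x2 - x1) * (y2 - y1))"
    unfolding U_def measure_uniform_measure[OF S box] m by (simp add: Times_Int_Times Int_commute)
  also have "\<dots> = (x2 - x1) * (clip a b y2 - clip a b y1) / ((x2 - x1) * (y2 - y1))"
    using ab x y by (simp add: measure_Times measure_interval_Int c del: Int_atLeastAtMost)
  finally show "measure U ({0..1} \<times> {a..b}) = (clip a b y2 - clip a b y1) / (y2 - y1)"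
    using x y by simp
qed

lemma permutonI:
  assumes "prob_space \<mu>" "sets \<mu> = sets borel"
    and "\<And>a b. 0 \<le> a \<Longrightarrow> a \<le> b \<Longrightarrow> b \<le> 1 \<Longrightarrow> measure \<mu> ({a..b} \<times> {0..1}) = b - a"
    and "\<And>a b. 0 \<le> a \<Longrightarrow> a \<le> b \<Longrightarrow> b \<le> 1 \<Longrightarrow> measure \<mu> ({0..1} \<times> {a..b}) = b - a"
  shows "permuton \<mu>"
  using assms by (simp add: permuton_def)

lemma clip_ends: "0 \<le> a \<Longrightarrow> a \<le> b \<Longrightarrow> b \<le> 1 \<Longrightarrow> clip a b 1 - clip a b 0 = b - a"
  by (auto simp: clip_def)

definition perm_square :: "nat \<Rightarrow> (nat \<Rightarrow> nat) \<Rightarrow> nat \<Rightarrow> (real \<times> real) measure" where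
  "perm_square n \<sigma> i = uniform_measure lborel
     ({(real i - 1) / real n..real i / real n} \<times> {(real (\<sigma> i) - 1) / real n..real (\<sigma> i) / real n})"

context
  fixes n :: nat and \<sigma> :: "nat \<Rightarrow> nat"
  assumes n: "n > 0" and \<sigma>: "\<sigma> permutes {1..n}"
begin

lemma perm_square:
  assumes "i \<in> {1..n}"
  shows "prob_space (perm_square n \<sigma> i)" "sets (perm_square n \<sigma> i) = sets borel"
    and "0 \<le> a \<Longrightarrow> a \<le> b \<Longrightarrow> b \<le> 1 \<Longrightarrow> measure (perm_square n \<sigma> i) ({a..b} \<times> {0..1}) =
      n * (clip a b (i / n) - clip a b (real (i - 1) / n))"
    and "0 \<le> a \<Longrightarrow> a \<le> b \<Longrightarrow> b \<le> 1 \<Longrightarrow> measure (perm_square n \<sigma> i) ({0..1} \<times> {a..b}) =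
      n * (clip a b (\<sigma> i / n) - clip a b (real (\<sigma> i - 1) / n))"
proof -
  have r: "0 \<le> (real k - 1) / n" "(real k - 1) / n < k / n" "k / n \<le> 1"
      "k / n - (real k - 1) / n = 1 / n" "real (k - 1) = real k - 1" if "k \<in> {1..n}" for k :: nat
    using that n by (auto simp: field_simps of_nat_diff)
  have \<sigma>i: "\<sigma> i \<in> {1..n}" using assms \<sigma> by (simp only: permutes_in_image)
  note U = uniform_rectangle[OF r(1-3)[OF assms] r(1-3)[OF \<sigma>i]]
  show "prob_space (perm_square n \<sigma> i)" "sets (perm_square n \<sigma> i) = sets borel"
    using U(1,2) by (simp_all add: perm_square_def)
  show "0 \<le> a \<Longrightarrow> a \<le> b \<Longrightarrow> b \<le> 1 \<Longrightarrow> measure (perm_square n \<sigma> i) ({a..b} \<times> {0..1}) =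
      n * (clip a b (i / n) - clip a b (real (i - 1) / n))"
    using U(3)[of a b] unfolding perm_square_def r(4)[OF assms] r(5)[OF assms] by simp
  show "0 \<le> a \<Longrightarrow> a \<le> b \<Longrightarrow> b \<le> 1 \<Longrightarrow> measure (perm_square n \<sigma> i) ({0..1} \<times> {a..b}) =
      n * (clip a b (\<sigma> i / n) - clip a b (real (\<sigma> i - 1) / n))"
    using U(4)[of a b] unfolding perm_square_def r(4)[OF \<sigma>i] r(5)[OF \<sigma>i] by simp
qed

lemma perm_permuton_eq: "perm_permuton n \<sigma> = weighted_sum_measure {1..n} (\<lambda>_. 1 / real n) (perm_square n \<sigma>)"
  by (simp add: perm_permuton_def perm_square_def[abs_def])

lemma mixture_perm: "mixture {1..n} (\<lambda>_. 1 / real n) (perm_square n \<sigma>)"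
proof (rule mixture.intro)
  show "(\<Sum>i=1..n. 1 / real n) = 1" using n by simp
qed (simp, (rule perm_square; assumption)+)

lemma permuton_perm_permuton: "permuton (perm_permuton n \<sigma>)"
  unfolding perm_permuton_eq
proof (rule permutonI)
  interpret mixture "{1..n}" "\<lambda>_. 1 / real n" "perm_square n \<sigma>" by (rule mixture_perm)
  let ?N = "weighted_sum_measure {1..n} (\<lambda>_. 1 / real n) (perm_square n \<sigma>)"
  show "prob_space ?N" by (rule prob_space_mixture)
  show "sets ?N = sets borel" by simp
  fix a b :: real assume ab: "0 \<le> a" "a \<le> b" "b \<le> 1"
  have box: "{c..d} \<times> {c'..d'} \<in> sets borel" for c d c' d' :: real
    by (simp add: borel_closed closed_Times)
  have tele: "(\<Sum>i=1..n. clip a b (real i / n) - clip a b (real (i - 1) / n)) = b - a"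
    using sum_telescope''[of 0 n "\<lambda>i. clip a b (real i / n)"] n clip_ends[OF ab] by simp
  have "measure ?N ({a..b} \<times> {0..1}) = (\<Sum>i=1..n. clip a b (real i / n) - clip a b (real (i - 1) / n))"
    unfolding measure_mixture[OF box] using n by (intro sum.cong refl) (simp add: perm_square(3) ab)
  then show "measure ?N ({a..b} \<times> {0..1}) = b - a" using tele by simp
  have "measure ?N ({0..1} \<times> {a..b}) = (\<Sum>i=1..n. clip a b (real (\<sigma> i) / n) - clip a b (real (\<sigma> i - 1) / n))"
    unfolding measure_mixture[OF box] using n by (intro sum.cong refl) (simp add: perm_square(4) ab)
  also have "\<dots> = (\<Sum>i=1..n. clip a b (real i / n) - clip a b (real (i - 1) / n))"
    using sum.permute[OF \<sigma>, of "\<lambda>i. clip a b (real i / n) - clip a b (real (i - 1) / n)"] by (simp add: comp_def)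
  finally show "measure ?N ({0..1} \<times> {a..b}) = b - a" using tele by simp
qed

lemma integral_perm_permuton_approx:
  fixes f :: "real \<times> real \<Rightarrow> real"
  assumes f: "f \<in> borel_measurable borel" and bound: "\<And>x. \<bar>f x\<bar> \<le> B"
    and close: "\<And>x y x' y'. x \<in> {0..1} \<Longrightarrow> y \<in> {0..1} \<Longrightarrow> x' \<in> {0..1} \<Longrightarrow> y' \<in> {0..1} \<Longrightarrow>
      \<bar>x - x'\<bar> \<le> 1 / n \<Longrightarrow> \<bar>y - y'\<bar> \<le> 1 / n \<Longrightarrow> \<bar>f (x, y) - f (x', y')\<bar> \<le> \<eta>"
  shows "\<bar>(LINT x|perm_permuton n \<sigma>. f x) - (\<Sum>k=1..n. f (k / n, \<sigma> k / n)) / n\<bar> \<le> \<eta>"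
proof -
  interpret mixture "{1..n}" "\<lambda>_. 1 / real n" "perm_square n \<sigma>" by (rule mixture_perm)
  have each: "\<bar>(LINT x|perm_square n \<sigma> k. f x) - f (k / n, \<sigma> k / n)\<bar> \<le> \<eta>" if k: "k \<in> {1..n}" for k
  proof -
    interpret P: prob_space "perm_square n \<sigma> k" by (rule perm_square(1)[OF k])
    have meas: "f \<in> borel_measurable (perm_square n \<sigma> k)"
      using f measurable_cong_sets[OF perm_square(2)[OF k] refl] by blast
    have int: "integrable (perm_square n \<sigma> k) f"
      using meas bound by (intro P.integrable_const_bound[where B = B]) auto
    let ?c = "f (k / n, \<sigma> k / n)"
    have \<sigma>k: "\<sigma> k \<in> {1..n}" using k \<sigma> by (simp only: permutes_in_image)
    have "AE x in perm_square n \<sigma> k. \<bar>f x - ?c\<bar> \<le> \<eta>"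
      unfolding perm_square_def
    proof (rule AE_uniform_measureI)
      have "\<bar>f (x, y) - ?c\<bar> \<le> \<eta>"
        if "x \<in> {(real k - 1) / n..k / n}" "y \<in> {(real (\<sigma> k) - 1) / n..\<sigma> k / n}" for x y
      proof (rule close)
        have unit: "z \<in> {0..1} \<and> real m / n \<in> {0..1} \<and> \<bar>z - real m / n\<bar> \<le> 1 / n"
          if "m \<in> {1..n}" "z \<in> {(real m - 1) / n..m / n}" for m z
        proof -
          have "0 \<le> (real m - 1) / n" "real m / n \<le> 1" "real m / n - (real m - 1) / n = 1 / n"
            using that(1) n by (auto simp: field_simps)
          then show ?thesis using that(2) unfolding atLeastAtMost_iff by linarith
        qed
        show "x \<in> {0..1}" "k / n \<in> {0..1}" "\<bar>x - k / n\<bar> \<le> 1 / n" using unit[OF k that(1)] by auto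
        show "y \<in> {0..1}" "\<sigma> k / n \<in> {0..1}" "\<bar>y - \<sigma> k / n\<bar> \<le> 1 / n" using unit[OF \<sigma>k that(2)] by auto
      qed
      then show "AE x in lborel. x \<in> {(real k - 1) / n..k / n} \<times> {(real (\<sigma> k) - 1) / n..\<sigma> k / n} \<longrightarrow> \<bar>f x - ?c\<bar> \<le> \<eta>"
        by (intro AE_I2) auto
    qed (simp add: borel_closed closed_Times)
    note AE = this
    have "(LINT x|perm_square n \<sigma> k. f x) - ?c = (LINT x|perm_square n \<sigma> k. f x - ?c)"
      using int by (simp add: P.prob_space)
    also have "\<bar>\<dots>\<bar> \<le> (LINT x|perm_square n \<sigma> k. \<bar>f x - ?c\<bar>)"
      by (rule integral_abs_bound)
    also have "\<dots> \<le> (LINT x|perm_square n \<sigma> k. \<eta>)"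
      using int AE by (intro integral_mono_AE) auto
    finally show ?thesis by (simp add: P.prob_space)
  qed
  have "(LINT x|perm_permuton n \<sigma>. f x) - (\<Sum>k=1..n. f (k / n, \<sigma> k / n)) / n =
      (\<Sum>k=1..n. (LINT x|perm_square n \<sigma> k. f x) - f (k / n, \<sigma> k / n)) / n"
    unfolding perm_permuton_eq integral_mixture[OF f bound]
    by (simp add: sum_subtractf diff_divide_distrib sum_divide_distrib)
  also have "\<bar>\<dots>\<bar> \<le> \<eta>"
  proof -
    have "\<bar>\<Sum>k=1..n. (LINT x|perm_square n \<sigma> k. f x) - f (k / n, \<sigma> k / n)\<bar> \<le> (\<Sum>k=1..n. \<eta>)"
      by (rule order_trans[OF sum_abs sum_mono]) (rule each)
    then show ?thesis using n by (simp add: field_simps)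
  qed
  finally show ?thesis .
qed

end

section \<open>Segments\<close>

text \<open>
  The right-hand side is symmetric in \<open>x\<close> and \<open>y\<close>, so one formula covers rising and falling segments.
\<close>

lemma measure_linear_preimage:
  fixes x y a b :: real
  assumes "x \<noteq> y" "a \<le> b"
  shows "measure lborel ({0..1} \<inter> {t. (1 - t) * x + t * y \<in> {a..b}}) = (clip a b y - clip a b x) / (y - x)"
proof -
  have len: "measure lborel {u..v} = max 0 (v - u)" for u v :: real
    by (cases "u \<le> v") auto
  show ?thesis
  proof (cases "x < y")
    case True
    define d where "d = y - x"
    have d: "d > 0" "y = x + d" using True by (auto simp: d_def)
    have "{0..1} \<inter> {t. (1 - t) * x + t * y \<in> {a..b}} = {max 0 ((a - x) / d)..min 1 ((b - x) / d)}"
      using d by (auto simp: field_simps)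
    moreover have "max 0 (min 1 ((b - x) / d) - max 0 ((a - x) / d)) * d = clip a b y - clip a b x"
      using d assms(2) by (auto simp: clip_def max_def min_def field_simps)
    ultimately show ?thesis
      using d(1) unfolding d_def[symmetric] by (simp only: len) (simp add: eq_divide_eq)
  next
    case False
    define d where "d = x - y"
    have d: "d > 0" "x = y + d" using False assms(1) by (auto simp: d_def)
    have "{0..1} \<inter> {t. (1 - t) * x + t * y \<in> {a..b}} = {max 0 ((x - b) / d)..min 1 ((x - a) / d)}"
      using d by (auto simp: field_simps)
    moreover have "max 0 (min 1 ((x - a) / d) - max 0 ((x - b) / d)) * d = clip a b x - clip a b y"
      using d assms(2) by (auto simp: clip_def max_def min_def field_simps)
    moreover have "(clip a b y - clip a b x) / (y - x) = (clip a b x - clip a b y) / d"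
      by (metis d_def minus_diff_eq minus_divide_divide)
    ultimately show ?thesis
      using d(1) by (simp only: len) (simp add: eq_divide_eq)
  qed
qed

lemma uniform_unit_interval:
  shows "prob_space (uniform_measure lborel {0..1::real})"
    and "A \<in> sets borel \<Longrightarrow> measure (uniform_measure lborel {0..1::real}) A = measure lborel ({0..1} \<inter> A)"
  by (rule prob_space_uniform_measure) simp_all

lemma linepath_measurable [measurable]: "linepath p q \<in> borel_measurable borel"
  by (intro borel_measurable_continuous_onI) (simp add: linepath_def continuous_intros)

lemma segment_measure:
  fixes p q :: "real \<times> real"
  shows "prob_space (segment_measure p q)" "sets (segment_measure p q) = sets borel"
    and "f \<in> borel_measurable borel \<Longrightarrow>
      (LINT x|segment_measure p q. f x) = (LINT t|uniform_measure lborel {0..1}. (f (linepath p q t) :: real))"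
  using prob_space.prob_space_distr[OF uniform_unit_interval(1), of "linepath p q" borel]
  by (simp_all add: segment_measure_def integral_distr measurable_cong_sets[OF sets_uniform_measure refl])

lemma measure_segment:
  assumes p: "fst p \<in> {0..1}" "snd p \<in> {0..1}" and q: "fst q \<in> {0..1}" "snd q \<in> {0..1}"
    and ab: "0 \<le> a" "a \<le> b" "b \<le> (1::real)"
  shows "fst p \<noteq> fst q \<Longrightarrow> measure (segment_measure p q) ({a..b} \<times> {0..1}) =
      (clip a b (fst q) - clip a b (fst p)) / (fst q - fst p)"
    and "snd p \<noteq> snd q \<Longrightarrow> measure (segment_measure p q) ({0..1} \<times> {a..b}) =
      (clip a b (snd q) - clip a b (snd p)) / (snd q - snd p)"
proof -
  have box: "{c..d} \<times> {c'..d'} \<in> sets borel" for c d c' d' :: real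
    by (simp add: borel_closed closed_Times)
  have meas: "measure (segment_measure p q) A = measure lborel ({0..1} \<inter> linepath p q -` A)" if "A \<in> sets borel" for A
  proof -
    have "linepath p q -` A \<in> sets borel"
      using measurable_sets[OF linepath_measurable that] by simp
    then show ?thesis
      using that unfolding segment_measure_def
      by (subst measure_distr) (simp_all add: uniform_unit_interval(2) measurable_cong_sets[OF sets_uniform_measure refl])
  qed
  have unit: "(1 - t) * x + t * y \<in> {0..1}" if "t \<in> {0..1}" "x \<in> {0..1}" "y \<in> {0..1}" for t x y :: real
    using that convex_bound_le[of x 1 y "1 - t" t] by auto
  have comp: "fst (linepath p q t) = (1 - t) * fst p + t * fst q"
      "snd (linepath p q t) = (1 - t) * snd p + t * snd q" for t
    by (simp_all add: linepath_def)
  have "{0..1} \<inter> linepath p q -` ({a..b} \<times> {0..1}) = {0..1} \<inter> {t. (1 - t) * fst p + t * fst q \<in> {a..b}}"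
    unfolding vimage_def mem_Times_iff comp using unit[OF _ p(2) q(2)] by blast
  then show "fst p \<noteq> fst q \<Longrightarrow> measure (segment_measure p q) ({a..b} \<times> {0..1}) =
      (clip a b (fst q) - clip a b (fst p)) / (fst q - fst p)"
    using measure_linear_preimage[OF _ ab(2)] meas[OF box] by simp
  have "{0..1} \<inter> linepath p q -` ({0..1} \<times> {a..b}) = {0..1} \<inter> {t. (1 - t) * snd p + t * snd q \<in> {a..b}}"
    unfolding vimage_def mem_Times_iff comp using unit[OF _ p(1) q(1)] by blast
  then show "snd p \<noteq> snd q \<Longrightarrow> measure (segment_measure p q) ({0..1} \<times> {a..b}) =
      (clip a b (snd q) - clip a b (snd p)) / (snd q - snd p)"
    using measure_linear_preimage[OF _ ab(2)] meas[OF box] by simp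
qed

text \<open>
  If \<open>F\<close> is an antiderivative, then \<open>F 1 - F 0\<close> telescopes into increments over the intervals of length \<open>1 / m\<close>. By the
  mean value theorem each increment is \<open>\<phi> x / m\<close> for some \<open>x\<close> in the interval, close to \<open>\<phi> (k / m) / m\<close>.
\<close>

lemma riemann_sums_converge:
  fixes \<phi> :: "real \<Rightarrow> real"
  assumes "continuous_on UNIV \<phi>"
  shows "(\<lambda>m. (\<Sum>k=1..m. \<phi> (real k / real m)) / real m) \<longlonglongrightarrow> (LINT t|uniform_measure lborel {0..1}. \<phi> t)"
proof -
  have cont: "continuous_on {0..1} \<phi>" using assms by (rule continuous_on_subset) simp
  obtain F where F: "\<And>x. x \<in> {0..1} \<Longrightarrow> (F has_vector_derivative \<phi> x) (at x within {0..1})"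
    using antiderivative_continuous[OF cont] by blast
  have "uniform_measure lborel {0..1} = density lborel (\<lambda>x. ennreal (indicator {0..1::real} x))"
    unfolding uniform_measure_def by (simp add: ennreal_indicator divide_ennreal_def)
  then have "(LINT t|uniform_measure lborel {0..1}. \<phi> t) = (LINT t|lborel. indicator {0..1} t *\<^sub>R \<phi> t)"
    using assms by (simp add: integral_density borel_measurable_continuous_onI)
  also have "\<dots> = F 1 - F 0"
    using F cont by (intro integral_FTC_atLeastAtMost) auto
  finally have I: "(LINT t|uniform_measure lborel {0..1}. \<phi> t) = F 1 - F 0" .
  show ?thesis
  proof (rule LIMSEQ_I)
    fix e :: real assume e: "e > 0"
    have "uniformly_continuous_on {0..1} \<phi>"
      using cont by (intro compact_uniformly_continuous) auto
    then obtain d where d: "d > 0" "\<And>x y. x \<in> {0..1} \<Longrightarrow> y \<in> {0..1} \<Longrightarrow> \<bar>y - x\<bar> < d \<Longrightarrow> \<bar>\<phi> y - \<phi> x\<bar> < e / 2"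
      using e unfolding uniformly_continuous_on_def dist_real_def by (metis half_gt_zero)
    obtain N where N: "N > 0" "1 / real N < d" using d(1) by (meson nat_approx_posE zero_less_Suc)
    show "\<exists>no::nat. \<forall>m\<ge>no. norm ((\<Sum>k=1..m. \<phi> (real k / real m)) / real m - (LINT t|uniform_measure lborel {0..1}. \<phi> t)) < e"
    proof (intro exI[of _ N] allI impI)
      fix m assume m: "m \<ge> N"
      then have m0: "m > 0" using N by simp
      have md: "1 / real m < d" using N m by (meson frac_le le_less_trans less_imp_of_nat_less of_nat_0_less_iff of_nat_le_iff order_refl zero_le_one)
      have step: "\<bar>\<phi> (k / m) / m - (F (k / m) - F (real (k - 1) / m))\<bar> \<le> e / 2 / m" if k: "k \<in> {1..m}" for k
      proof -
        have u: "0 \<le> real (k - 1) / m" "real (k - 1) / m < k / m" "k / m \<le> 1" "k / m - real (k - 1) / m = 1 / m"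
          using k m0 by (auto simp: field_simps of_nat_diff)
        have sub: "y \<in> {0..1}" if "real (k - 1) / m \<le> y" "y \<le> k / m" for y
          using that u(1,3) unfolding atLeastAtMost_iff by linarith
        have "\<exists>x\<in>{real (k - 1) / m<..<k / m}. F (k / m) - F (real (k - 1) / m) = (k / m - real (k - 1) / m) *\<^sub>R \<phi> x"
        proof (rule mvt_simple[OF u(2), where f' = "\<lambda>x h. h *\<^sub>R \<phi> x"])
          fix x assume "real (k - 1) / m \<le> x" "x \<le> k / m"
          then have "(F has_vector_derivative \<phi> x) (at x within {real (k - 1) / m..k / m})"
            using sub by (intro has_vector_derivative_within_subset[OF F]) auto
          then show "(F has_derivative (\<lambda>h. h *\<^sub>R \<phi> x)) (at x within {real (k - 1) / m..k / m})"
            by (simp add: has_vector_derivative_def)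
        qed
        then obtain x where x: "x \<in> {real (k - 1) / m<..<k / m}" "F (k / m) - F (real (k - 1) / m) = \<phi> x / m"
          using u(4) by auto
        have "\<bar>\<phi> (k / m) - \<phi> x\<bar> < e / 2"
          using x(1) u(2,4) md sub[of x] sub[of "k / m"] by (intro d(2)) auto
        then have "\<bar>\<phi> (k / m) - \<phi> x\<bar> / m \<le> e / 2 / m" by (intro divide_right_mono) auto
        then show ?thesis unfolding x(2) by (simp add: diff_divide_distrib[symmetric])
      qed
      have "(\<Sum>k=1..m. F (k / m) - F (real (k - 1) / m)) = F 1 - F 0"
        using sum_telescope''[of 0 m "\<lambda>k. F (real k / m)"] m0 by simp
      then have "(\<Sum>k=1..m. \<phi> (k / m)) / m - (F 1 - F 0) =
          (\<Sum>k=1..m. \<phi> (k / m) / m - (F (k / m) - F (real (k - 1) / m)))"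
        by (simp add: sum_subtractf sum_divide_distrib)
      also have "\<bar>\<dots>\<bar> \<le> (\<Sum>k=1..m. e / 2 / m)"
        by (rule order_trans[OF sum_abs sum_mono]) (rule step)
      also have "\<dots> < e" using m0 e by simp
      finally show "norm ((\<Sum>k=1..m. \<phi> (k / m)) / m - (LINT t|uniform_measure lborel {0..1}. \<phi> t)) < e"
        unfolding I by simp
    qed
  qed
qed

section \<open>The limit permuton\<close>

definition col_bound :: "gridding_matrix \<Rightarrow> nat \<Rightarrow> real" where
  "col_bound M i = (\<Sum>i'=1..i. col_sum M (max_distribution M) i')"

definition row_bound :: "gridding_matrix \<Rightarrow> nat \<Rightarrow> real" where
  "row_bound M j = (\<Sum>j'=1..j. row_sum M (max_distribution M) j')"

lemma grid_point_eq: "grid_point M i j = (col_bound M i, row_bound M j)"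
  by (simp add: grid_point_def col_bound_def row_bound_def)

lemma bound_step:
  "i > 0 \<Longrightarrow> col_bound M i = col_bound M (i - 1) + col_sum M (max_distribution M) i"
  "j > 0 \<Longrightarrow> row_bound M j = row_bound M (j - 1) + row_sum M (max_distribution M) j"
  by (cases i; simp add: col_bound_def) (cases j; simp add: row_bound_def)

definition support_cells :: "gridding_matrix \<Rightarrow> (nat \<times> nat) set" where
  "support_cells M = {(i, j). i \<in> {1..ncols M} \<and> j \<in> {1..nrows M} \<and> max_distribution M i j > 0}"

context
  fixes M :: gridding_matrix
  assumes D: "distribution_matrix M (max_distribution M)"
begin

lemma distribution_facts:
  "0 \<le> max_distribution M i j" "0 \<le> col_sum M (max_distribution M) i" "0 \<le> row_sum M (max_distribution M) j"
  "(\<Sum>i=1..ncols M. col_sum M (max_distribution M) i) = 1" "(\<Sum>j=1..nrows M. row_sum M (max_distribution M) j) = 1"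
  "i \<in> {1..ncols M} \<Longrightarrow> j \<in> {1..nrows M} \<Longrightarrow> max_distribution M i j \<le> col_sum M (max_distribution M) i"
  "i \<in> {1..ncols M} \<Longrightarrow> j \<in> {1..nrows M} \<Longrightarrow> max_distribution M i j \<le> row_sum M (max_distribution M) j"
proof -
  have nn: "0 \<le> max_distribution M i j" for i j using D by (simp add: distribution_matrix_def)
  then show "0 \<le> max_distribution M i j" .
  show "0 \<le> col_sum M (max_distribution M) i" "0 \<le> row_sum M (max_distribution M) j" by (simp_all add: col_sum_def row_sum_def sum_nonneg nn)
  show "(\<Sum>i=1..ncols M. col_sum M (max_distribution M) i) = 1" using D by (simp add: distribution_matrix_def col_sum_def)
  then show "(\<Sum>j=1..nrows M. row_sum M (max_distribution M) j) = 1"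
    unfolding col_sum_def row_sum_def by (subst sum.swap)
  show "i \<in> {1..ncols M} \<Longrightarrow> j \<in> {1..nrows M} \<Longrightarrow> max_distribution M i j \<le> col_sum M (max_distribution M) i"
    unfolding col_sum_def by (intro member_le_sum nn) auto
  show "i \<in> {1..ncols M} \<Longrightarrow> j \<in> {1..nrows M} \<Longrightarrow> max_distribution M i j \<le> row_sum M (max_distribution M) j"
    unfolding row_sum_def by (rule member_le_sum[where f = "\<lambda>i. max_distribution M i j"]) (auto simp: nn)
qed

lemma bounds_unit:
  "i \<le> ncols M \<Longrightarrow> col_bound M i \<in> {0..1}" "j \<le> nrows M \<Longrightarrow> row_bound M j \<in> {0..1}"
proof -
  show "col_bound M i \<in> {0..1}" if "i \<le> ncols M"
  proof -
    have "col_bound M i \<le> (\<Sum>i'=1..ncols M. col_sum M (max_distribution M) i')"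
      unfolding col_bound_def by (rule sum_mono2) (use that distribution_facts(2) in auto)
    moreover have "0 \<le> col_bound M i"
      unfolding col_bound_def by (intro sum_nonneg distribution_facts)
    ultimately show ?thesis unfolding distribution_facts(4) by simp
  qed
  show "row_bound M j \<in> {0..1}" if "j \<le> nrows M"
  proof -
    have "row_bound M j \<le> (\<Sum>j'=1..nrows M. row_sum M (max_distribution M) j')"
      unfolding row_bound_def by (rule sum_mono2) (use that distribution_facts(3) in auto)
    moreover have "0 \<le> row_bound M j"
      unfolding row_bound_def by (intro sum_nonneg distribution_facts)
    ultimately show ?thesis unfolding distribution_facts(5) by simp
  qed
qed

lemma sum_support_cells:
  fixes h :: "nat \<Rightarrow> nat \<Rightarrow> real"
  shows "(\<Sum>(i, j)\<in>support_cells M. max_distribution M i j * h i j) = (\<Sum>i=1..ncols M. \<Sum>j=1..nrows M. max_distribution M i j * h i j)"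
proof -
  have "(\<Sum>(i, j)\<in>support_cells M. max_distribution M i j * h i j) = (\<Sum>(i, j)\<in>{1..ncols M} \<times> {1..nrows M}. max_distribution M i j * h i j)"
  proof (rule sum.mono_neutral_left)
    have "max_distribution M i j = 0" if "i \<in> {1..ncols M}" "j \<in> {1..nrows M}" "(i, j) \<notin> support_cells M" for i j
      using that distribution_facts(1)[of i j] by (simp add: support_cells_def)
    then show "\<forall>v\<in>{1..ncols M} \<times> {1..nrows M} - support_cells M. (case v of (i, j) \<Rightarrow> max_distribution M i j * h i j) = 0"
      by force
  qed (auto simp: support_cells_def)
  then show ?thesis by (simp add: sum.cartesian_product)
qed

lemma limit_permuton_eq:
  "limit_permuton M = weighted_sum_measure (support_cells M) (\<lambda>(i, j). max_distribution M i j) (cell_measure M)"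
  by (simp add: limit_permuton_def support_cells_def)

lemma cell_measure:
  assumes "(i, j) \<in> support_cells M"
  shows "prob_space (cell_measure M (i, j))" "sets (cell_measure M (i, j)) = sets borel"
    and "0 \<le> a \<Longrightarrow> a \<le> b \<Longrightarrow> b \<le> 1 \<Longrightarrow> measure (cell_measure M (i, j)) ({a..b} \<times> {0..1}) =
      (clip a b (col_bound M i) - clip a b (col_bound M (i - 1))) / col_sum M (max_distribution M) i"
    and "0 \<le> a \<Longrightarrow> a \<le> b \<Longrightarrow> b \<le> 1 \<Longrightarrow> measure (cell_measure M (i, j)) ({0..1} \<times> {a..b}) =
      (clip a b (row_bound M j) - clip a b (row_bound M (j - 1))) / row_sum M (max_distribution M) j"
proof -
  have ij: "i \<in> {1..ncols M}" "j \<in> {1..nrows M}" "max_distribution M i j > 0" using assms by (auto simp: support_cells_def)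
  show "prob_space (cell_measure M (i, j))" "sets (cell_measure M (i, j)) = sets borel"
    by (simp_all add: cell_measure_def segment_measure)
  have step: "col_bound M i = col_bound M (i - 1) + col_sum M (max_distribution M) i"
    "row_bound M j = row_bound M (j - 1) + row_sum M (max_distribution M) j"
    by (rule bound_step, use ij in force)+
  have pos: "col_sum M (max_distribution M) i > 0" "row_sum M (max_distribution M) j > 0"
    using distribution_facts(6,7)[OF ij(1,2)] ij(3) by auto
  have unit: "col_bound M (i - 1) \<in> {0..1}" "col_bound M i \<in> {0..1}"
    "row_bound M (j - 1) \<in> {0..1}" "row_bound M j \<in> {0..1}"
    by (rule bounds_unit, use ij in force)+
  assume ab: "0 \<le> a" "a \<le> b" "b \<le> 1"
  note inc = measure_segment[of "grid_point M (i - 1) (j - 1)" "grid_point M i j",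
      unfolded grid_point_eq fst_conv snd_conv, OF unit(1,3,2,4) ab]
  note dec = measure_segment[of "grid_point M (i - 1) j" "grid_point M i (j - 1)",
      unfolded grid_point_eq fst_conv snd_conv, OF unit(1,4,2,3) ab]
  \<comment> \<open>the segment of a decreasing cell runs downwards\<close>
  have flip: "(clip a b (row_bound M (j - 1)) - clip a b (row_bound M j)) / (row_bound M (j - 1) - row_bound M j) =
      (clip a b (row_bound M j) - clip a b (row_bound M (j - 1))) / (row_bound M j - row_bound M (j - 1))"
    by (metis minus_diff_eq minus_divide_divide)
  have diff: "col_bound M i - col_bound M (i - 1) = col_sum M (max_distribution M) i"
      "row_bound M j - row_bound M (j - 1) = row_sum M (max_distribution M) j"
    using step by auto
  have ne: "col_bound M (i - 1) \<noteq> col_bound M i" "row_bound M (j - 1) \<noteq> row_bound M j"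
    using diff pos by auto
  show "measure (cell_measure M (i, j)) ({a..b} \<times> {0..1}) =
      (clip a b (col_bound M i) - clip a b (col_bound M (i - 1))) / col_sum M (max_distribution M) i"
    unfolding cell_measure_def grid_point_eq prod.case
    using inc(1)[OF ne(1)] dec(1)[OF ne(1)] unfolding diff by (cases "entry M i j = Increasing") simp_all
  show "measure (cell_measure M (i, j)) ({0..1} \<times> {a..b}) =
      (clip a b (row_bound M j) - clip a b (row_bound M (j - 1))) / row_sum M (max_distribution M) j"
    unfolding cell_measure_def grid_point_eq prod.case
    using inc(2)[OF ne(2)] dec(2)[OF ne(2)[symmetric]] unfolding flip diff
    by (cases "entry M i j = Increasing") simp_all
qed

lemma mixture_limit: "mixture (support_cells M) (\<lambda>(i, j). max_distribution M i j) (cell_measure M)"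
proof (rule mixture.intro)
  show "(\<Sum>(i, j)\<in>support_cells M. max_distribution M i j) = 1"
    using sum_support_cells[of "\<lambda>_ _. 1"] distribution_facts(4) by (simp add: col_sum_def)
next
  fix v assume "v \<in> support_cells M"
  then show "0 \<le> (case v of (i, j) \<Rightarrow> max_distribution M i j)" "prob_space (cell_measure M v)"
    "sets (cell_measure M v) = sets borel"
    using cell_measure(1,2) distribution_facts(1) by (cases v; simp)+
qed

text \<open>
  On a column of width \<open>c\<^sub>i\<close> the cells carry the total mass \<open>c\<^sub>i\<close>, each of them spread uniformly over the width, so the
  first marginal is uniform there; a column with \<open>c\<^sub>i = 0\<close> has no width. Rows are alike.
\<close>

lemma permuton_limit_permuton: "permuton (limit_permuton M)"
  unfolding limit_permuton_eq
proof (rule permutonI)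
  interpret mixture "support_cells M" "\<lambda>(i, j). max_distribution M i j" "cell_measure M" by (rule mixture_limit)
  let ?N = "weighted_sum_measure (support_cells M) (\<lambda>(i, j). max_distribution M i j) (cell_measure M)"
  show "prob_space ?N" by (rule prob_space_mixture)
  show "sets ?N = sets borel" by simp
  fix a b :: real assume ab: "0 \<le> a" "a \<le> b" "b \<le> 1"
  have box: "{c..d} \<times> {c'..d'} \<in> sets borel" for c d c' d' :: real
    by (simp add: borel_closed closed_Times)
  define X where "X = (\<lambda>i. clip a b (col_bound M i))"
  define Y where "Y = (\<lambda>j. clip a b (row_bound M j))"
  have X: "(\<Sum>i=1..ncols M. X i - X (i - 1)) = b - a"
    using sum_telescope''[of 0 "ncols M" X] clip_ends[OF ab] distribution_facts(4)
    by (simp add: X_def col_bound_def)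
  have Y: "(\<Sum>j=1..nrows M. Y j - Y (j - 1)) = b - a"
    using sum_telescope''[of 0 "nrows M" Y] clip_ends[OF ab] distribution_facts(5)
    by (simp add: Y_def row_bound_def)
  have "measure ?N ({a..b} \<times> {0..1}) = (\<Sum>(i, j)\<in>support_cells M. max_distribution M i j * ((X i - X (i - 1)) / col_sum M (max_distribution M) i))"
    unfolding measure_mixture[OF box] using ab
    by (intro sum.cong refl) (auto simp: cell_measure(3) X_def)
  also have "\<dots> = (\<Sum>i=1..ncols M. col_sum M (max_distribution M) i * ((X i - X (i - 1)) / col_sum M (max_distribution M) i))"
    by (simp only: sum_support_cells sum_distrib_right[symmetric] col_sum_def[symmetric])
  also have "\<dots> = (\<Sum>i=1..ncols M. X i - X (i - 1))"
  proof (intro sum.cong refl)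
    fix i assume "i \<in> {1..ncols M}"
    then show "col_sum M (max_distribution M) i * ((X i - X (i - 1)) / col_sum M (max_distribution M) i) = X i - X (i - 1)"
      using bound_step(1)[of i M] by (cases "col_sum M (max_distribution M) i = 0") (auto simp: X_def)
  qed
  finally show "measure ?N ({a..b} \<times> {0..1}) = b - a" using X by simp
  have "measure ?N ({0..1} \<times> {a..b}) = (\<Sum>(i, j)\<in>support_cells M. max_distribution M i j * ((Y j - Y (j - 1)) / row_sum M (max_distribution M) j))"
    unfolding measure_mixture[OF box] using ab
    by (intro sum.cong refl) (auto simp: cell_measure(4) Y_def)
  also have "\<dots> = (\<Sum>j=1..nrows M. row_sum M (max_distribution M) j * ((Y j - Y (j - 1)) / row_sum M (max_distribution M) j))"
    by (simp only: sum_support_cells, subst sum.swap, simp only: sum_distrib_right[symmetric] row_sum_def[symmetric])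
  also have "\<dots> = (\<Sum>j=1..nrows M. Y j - Y (j - 1))"
  proof (intro sum.cong refl)
    fix j assume "j \<in> {1..nrows M}"
    then show "row_sum M (max_distribution M) j * ((Y j - Y (j - 1)) / row_sum M (max_distribution M) j) = Y j - Y (j - 1)"
      using bound_step(2)[of j M] by (cases "row_sum M (max_distribution M) j = 0") (auto simp: Y_def)
  qed
  finally show "measure ?N ({0..1} \<times> {a..b}) = b - a" using Y by simp
qed

lemma integral_limit_permuton:
  fixes f :: "real \<times> real \<Rightarrow> real"
  assumes f: "f \<in> borel_measurable borel" and bound: "\<And>x. \<bar>f x\<bar> \<le> B"
  shows "(LINT x|limit_permuton M. f x) =
    (\<Sum>i=1..ncols M. \<Sum>j=1..nrows M. max_distribution M i j * (LINT x|cell_measure M (i, j). f x))"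
proof -
  interpret mixture "support_cells M" "\<lambda>(i, j). max_distribution M i j" "cell_measure M" by (rule mixture_limit)
  show ?thesis
    unfolding limit_permuton_eq integral_mixture[OF f bound] sum_support_cells[symmetric]
    by (intro sum.cong) auto
qed

end

section \<open>Most gridded permutations are evenly spread\<close>

lemma sum_UN_le:
  fixes f :: "'a \<Rightarrow> real"
  assumes "finite I" "\<And>i. i \<in> I \<Longrightarrow> finite (A i)" "\<And>x. 0 \<le> f x"
  shows "sum f (\<Union>i\<in>I. A i) \<le> (\<Sum>i\<in>I. sum f (A i))"
  using assms(1,2)
proof (induction I rule: finite_induct)
  case (insert i I)
  have "sum f (A i \<union> (\<Union>i\<in>I. A i)) = sum f (A i) + sum f (\<Union>i\<in>I. A i) - sum f (A i \<inter> (\<Union>i\<in>I. A i))"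
    using insert by (intro sum_Un) auto
  moreover have "0 \<le> sum f (A i \<inter> (\<Union>i\<in>I. A i))" using assms(3) by (intro sum_nonneg)
  moreover have "sum f (\<Union>i\<in>I. A i) \<le> (\<Sum>i\<in>I. sum f (A i))" using insert by simp
  ultimately show ?case using insert by simp
qed simp

text \<open>
  The union bound over all prefixes and all pairs of a class and a letter.
\<close>

lemma uneven_words_weight:
  fixes a :: "nat \<Rightarrow> nat" and P :: "nat \<Rightarrow> nat \<Rightarrow> real"
  assumes fin: "finite J" "finite C" and C: "\<And>i l. (i, l) \<in> C \<Longrightarrow> l \<in> J"
    and P: "\<And>i l. 0 \<le> P i l" "\<And>i. (\<Sum>l\<in>J. P i l) \<le> 1" and \<epsilon>: "0 < \<epsilon>" "\<epsilon> \<le> 1"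
  shows "(\<Sum>w | w \<in> {1..n} \<rightarrow>\<^sub>E J \<and> (\<exists>x\<le>n. \<exists>(i, l)\<in>C.
        \<bar>real (card {k \<in> {1..x}. a k = i \<and> w k = l}) - P i l * real (card {k \<in> {1..x}. a k = i})\<bar> > \<epsilon> * n).
      \<Prod>k\<in>{1..n}. P (a k) (w k)) \<le> 2 * (real n + 1) * card C * exp (- (\<epsilon>\<^sup>2 * n / 4))"
proof -
  define D where "D = (\<lambda>(x, i, l) w.
    \<bar>real (card {k \<in> {1..x}. a k = i \<and> w k = l}) - P i l * real (card {k \<in> {1..x}. a k = i})\<bar>)"
  define U where "U = (\<lambda>e. {w. w \<in> {1..n} \<rightarrow>\<^sub>E J \<and> D e w > \<epsilon> * n})"
  have finU: "finite (U e)" for e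
    unfolding U_def using fin by (intro finite_subset[OF _ finite_PiE[of "{1..n}" "\<lambda>_. J"]]) auto
  have nn: "0 \<le> (\<Prod>k\<in>{1..n}. P (a k) (w k))" for w by (intro prod_nonneg P)
  have each: "(\<Sum>w\<in>U e. \<Prod>k\<in>{1..n}. P (a k) (w k)) \<le> 2 * exp (- (\<epsilon>\<^sup>2 * n / 4))" if e: "e \<in> {0..n} \<times> C" for e
  proof -
    obtain x i l where e': "e = (x, i, l)" "x \<le> n" "(i, l) \<in> C" using e by (cases e) auto
    have "(\<Sum>w | w \<in> {1..n} \<rightarrow>\<^sub>E J \<and> \<bar>real (card {k \<in> {k \<in> {1..x}. a k = i}. w k = l}) -
        P i l * real (card {k \<in> {1..x}. a k = i})\<bar> > \<epsilon> * n. \<Prod>k\<in>{1..n}. P (a k) (w k)) \<le> 2 * exp (- (\<epsilon>\<^sup>2 * n / 4))"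
      by (rule word_count_deviation) (use fin C[OF e'(3)] P \<epsilon> e'(2) in auto)
    moreover have "{k \<in> {k \<in> {1..x}. a k = i}. w k = l} = {k \<in> {1..x}. a k = i \<and> w k = l}" for w by auto
    ultimately show ?thesis by (simp add: U_def D_def e'(1))
  qed
  have "{w. w \<in> {1..n} \<rightarrow>\<^sub>E J \<and> (\<exists>x\<le>n. \<exists>(i, l)\<in>C.
        \<bar>real (card {k \<in> {1..x}. a k = i \<and> w k = l}) - P i l * real (card {k \<in> {1..x}. a k = i})\<bar> > \<epsilon> * n)}
      = (\<Union>e\<in>{0..n} \<times> C. U e)"
    unfolding U_def D_def by force
  then have "(\<Sum>w | w \<in> {1..n} \<rightarrow>\<^sub>E J \<and> (\<exists>x\<le>n. \<exists>(i, l)\<in>C.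
        \<bar>real (card {k \<in> {1..x}. a k = i \<and> w k = l}) - P i l * real (card {k \<in> {1..x}. a k = i})\<bar> > \<epsilon> * n).
      \<Prod>k\<in>{1..n}. P (a k) (w k)) \<le> (\<Sum>e\<in>{0..n} \<times> C. \<Sum>w\<in>U e. \<Prod>k\<in>{1..n}. P (a k) (w k))"
    using fin finU nn sum_UN_le[of "{0..n} \<times> C" U "\<lambda>w. \<Prod>k\<in>{1..n}. P (a k) (w k)"] by simp
  also have "\<dots> \<le> (\<Sum>e\<in>{0..n} \<times> C. 2 * exp (- (\<epsilon>\<^sup>2 * n / 4)))"
    by (intro sum_mono each)
  also have "\<dots> = 2 * (real n + 1) * card C * exp (- (\<epsilon>\<^sup>2 * n / 4))"
    by (simp add: card_cartesian_product algebra_simps)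
  finally show ?thesis .
qed

text \<open>
  For each non-blank cell the points among the first \<open>x\<close> positions (or values) that lie in the column (or row) of the
  cell are shared out to the cell in the expected proportion, up to an error of \<open>\<epsilon> n\<close>.
\<close>

definition evenly_spread ::
  "gridding_matrix \<Rightarrow> nat \<Rightarrow> (nat \<Rightarrow> nat) \<Rightarrow> (nat \<Rightarrow> nat) \<Rightarrow> real \<Rightarrow> (nat \<Rightarrow> nat) \<Rightarrow> bool" where
  "evenly_spread M n a b \<epsilon> \<sigma> \<longleftrightarrow> (\<forall>(i, j)\<in>nonblank_cells M. \<forall>x\<le>n.
     \<bar>real (card {k \<in> {1..x}. a k = i \<and> b (\<sigma> k) = j}) -
       max_distribution M i j / col_sum M (max_distribution M) i * real (card {k \<in> {1..x}. a k = i})\<bar> \<le> \<epsilon> * n \<and>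
     \<bar>real (card {y \<in> {1..x}. b y = j \<and> a (inv \<sigma> y) = i}) -
       max_distribution M i j / row_sum M (max_distribution M) j * real (card {y \<in> {1..x}. b y = j})\<bar> \<le> \<epsilon> * n)"

lemma finite_nonblank_cells: "finite (nonblank_cells M)"
  by (rule finite_subset[of _ "{1..ncols M} \<times> {1..nrows M}"]) (auto simp: nonblank_cells_def)

text \<open>
  Reindexing the second product by \<open>\<sigma>\<close> brings together the two letters that belong to the same point. Their
  probabilities multiply to \<open>\<gamma>\<^sub>i\<^sub>j\<^sup>2 / (c\<^sub>i r\<^sub>j) = exp (- S)\<close>, where \<open>(i, j)\<close> is the cell of the point.
\<close>

lemma weight_of_words:
  assumes con: "connected_gridding_matrix M"
    and \<sigma>: "\<sigma> permutes {1..n}" "monotone_cells M n a b \<sigma>"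
    and a: "\<And>k. k \<in> {1..n} \<Longrightarrow> a k \<in> {1..ncols M}" and b: "\<And>y. y \<in> {1..n} \<Longrightarrow> b y \<in> {1..nrows M}"
  defines "\<Gamma> \<equiv> max_distribution M"
  shows "(\<Prod>k\<in>{1..n}. \<Gamma> (a k) (col_word n b \<sigma> k) / col_sum M \<Gamma> (a k)) *
    (\<Prod>y\<in>{1..n}. \<Gamma> (row_word n a \<sigma> y) (b y) / row_sum M \<Gamma> (b y)) = exp (- (n * grid_entropy M \<Gamma>))"
proof -
  have max: "max_entropy M \<Gamma>" unfolding \<Gamma>_def by (rule max_entropy_max_distribution[OF con])
  then have D: "distribution_matrix M \<Gamma>" by (simp add: max_entropy_def)
  have "(\<Prod>y\<in>{1..n}. \<Gamma> (row_word n a \<sigma> y) (b y) / row_sum M \<Gamma> (b y)) =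
      (\<Prod>k\<in>{1..n}. \<Gamma> (row_word n a \<sigma> (\<sigma> k)) (b (\<sigma> k)) / row_sum M \<Gamma> (b (\<sigma> k)))"
    using prod.permute[OF \<sigma>(1), of "\<lambda>y. \<Gamma> (row_word n a \<sigma> y) (b y) / row_sum M \<Gamma> (b y)"]
    by (simp add: comp_def)
  also have "\<dots> = (\<Prod>k\<in>{1..n}. \<Gamma> (a k) (b (\<sigma> k)) / row_sum M \<Gamma> (b (\<sigma> k)))"
  proof (intro prod.cong refl)
    fix k assume "k \<in> {1..n}"
    then have "\<sigma> k \<in> {1..n}" using \<sigma>(1) by (simp only: permutes_in_image)
    then show "\<Gamma> (row_word n a \<sigma> (\<sigma> k)) (b (\<sigma> k)) / row_sum M \<Gamma> (b (\<sigma> k)) =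
        \<Gamma> (a k) (b (\<sigma> k)) / row_sum M \<Gamma> (b (\<sigma> k))"
      using permutes_inverses(2)[OF \<sigma>(1), of k] by (simp add: row_word_def)
  qed
  finally have "(\<Prod>k\<in>{1..n}. \<Gamma> (a k) (col_word n b \<sigma> k) / col_sum M \<Gamma> (a k)) *
      (\<Prod>y\<in>{1..n}. \<Gamma> (row_word n a \<sigma> y) (b y) / row_sum M \<Gamma> (b y)) =
    (\<Prod>k\<in>{1..n}. \<Gamma> (a k) (b (\<sigma> k)) / col_sum M \<Gamma> (a k) * (\<Gamma> (a k) (b (\<sigma> k)) / row_sum M \<Gamma> (b (\<sigma> k))))"
    by (simp add: col_word_def flip: prod.distrib)
  also have "\<dots> = (\<Prod>k\<in>{1..n}. exp (- grid_entropy M \<Gamma>))"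
  proof (intro prod.cong refl)
    fix k assume k: "k \<in> {1..n}"
    define i j where "i = a k" and "j = b (\<sigma> k)"
    have "\<sigma> k \<in> {1..n}" using k \<sigma>(1) by (simp only: permutes_in_image)
    then have ij: "i \<in> {1..ncols M}" "j \<in> {1..nrows M}" using a b k by (auto simp: i_def j_def)
    have "k \<in> cell_points n a b \<sigma> i j" using k by (simp add: cell_points_def i_def j_def)
    then have cell: "(i, j) \<in> nonblank_cells M"
      using monotone_cellsD(3)[OF \<sigma>(2) ij] ij by (auto simp: nonblank_cells_def)
    have "\<Gamma> i j > 0" by (rule max_entropy_pos[OF con max cell])
    moreover have "col_sum M \<Gamma> i > 0" "row_sum M \<Gamma> j > 0"
      using calculation le_sum_line[OF D cell] by auto
    moreover have "col_sum M \<Gamma> i * row_sum M \<Gamma> j = exp (grid_entropy M \<Gamma>) * (\<Gamma> i j)\<^sup>2"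
      by (rule max_entropy_balanced[OF con max cell])
    ultimately have "\<Gamma> i j / col_sum M \<Gamma> i * (\<Gamma> i j / row_sum M \<Gamma> j) = exp (- grid_entropy M \<Gamma>)"
      by (simp add: power2_eq_square exp_minus inverse_eq_divide)
    then show "\<Gamma> (a k) (b (\<sigma> k)) / col_sum M \<Gamma> (a k) * (\<Gamma> (a k) (b (\<sigma> k)) / row_sum M \<Gamma> (b (\<sigma> k))) =
        exp (- grid_entropy M \<Gamma>)"
      by (simp add: i_def j_def)
  qed
  also have "\<dots> = exp (- (n * grid_entropy M \<Gamma>))"
    by (simp flip: exp_of_nat_mult)
  finally show ?thesis .
qed

text \<open>
  Each permutation counted here has weight \<open>exp (- n S)\<close>, and one of its two words is uneven. Distinct permutations
  have distinct pairs of words, so the total weight is at most the probability that one of two independent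
  words is uneven.
\<close>

lemma card_uneven_with_cuts:
  assumes con: "connected_gridding_matrix M" and \<epsilon>: "0 < \<epsilon>" "\<epsilon> \<le> 1"
    and a: "\<And>k. k \<in> {1..n} \<Longrightarrow> a k \<in> {1..ncols M}" and b: "\<And>y. y \<in> {1..n} \<Longrightarrow> b y \<in> {1..nrows M}"
  shows "real (card {\<sigma>. \<sigma> permutes {1..n} \<and> monotone_cells M n a b \<sigma> \<and> \<not> evenly_spread M n a b \<epsilon> \<sigma>}) \<le>
    exp (n * grid_entropy M (max_distribution M)) *
      (4 * (real n + 1) * card (nonblank_cells M) * exp (- (\<epsilon>\<^sup>2 * n / 4)))"
proof -
  define X where "X = {\<sigma>. \<sigma> permutes {1..n} \<and> monotone_cells M n a b \<sigma> \<and> \<not> evenly_spread M n a b \<epsilon> \<sigma>}"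
  define \<Gamma> where "\<Gamma> = max_distribution M"
  have max: "max_entropy M \<Gamma>" unfolding \<Gamma>_def by (rule max_entropy_max_distribution[OF con])
  then have D: "distribution_matrix M \<Gamma>" by (simp add: max_entropy_def)
  have nn: "0 \<le> \<Gamma> i j" "0 \<le> col_sum M \<Gamma> i" "0 \<le> row_sum M \<Gamma> j" for i j
    using D by (auto simp: distribution_matrix_def intro: col_sum_nonneg row_sum_nonneg)
  define p where "p = (\<lambda>i j. \<Gamma> i j / col_sum M \<Gamma> i)"
  define q where "q = (\<lambda>j i. \<Gamma> i j / row_sum M \<Gamma> j)"
  have pq: "0 \<le> p i j" "0 \<le> q j i" "(\<Sum>j=1..nrows M. p i j) \<le> 1" "(\<Sum>i=1..ncols M. q j i) \<le> 1" for i j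
    using nn by (auto simp: p_def q_def col_sum_def row_sum_def simp flip: sum_divide_distrib)
  define WW where "WW = ({1..n} \<rightarrow>\<^sub>E {1..nrows M} :: (nat \<Rightarrow> nat) set)"
  define VV where "VV = ({1..n} \<rightarrow>\<^sub>E {1..ncols M} :: (nat \<Rightarrow> nat) set)"
  define W where "W = (\<lambda>w. \<Prod>k\<in>{1..n}. p (a k) (w k))"
  define V where "V = (\<lambda>v. \<Prod>y\<in>{1..n}. q (b y) (v y))"
  define BW where "BW = {w. w \<in> {1..n} \<rightarrow>\<^sub>E {1..nrows M} \<and> (\<exists>x\<le>n. \<exists>(i, l)\<in>nonblank_cells M.
        \<bar>real (card {k \<in> {1..x}. a k = i \<and> w k = l}) - p i l * real (card {k \<in> {1..x}. a k = i})\<bar> > \<epsilon> * n)}"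
  define BV where "BV = {v. v \<in> {1..n} \<rightarrow>\<^sub>E {1..ncols M} \<and> (\<exists>x\<le>n. \<exists>(j, l)\<in>prod.swap ` nonblank_cells M.
        \<bar>real (card {y \<in> {1..x}. b y = j \<and> v y = l}) - q j l * real (card {y \<in> {1..x}. b y = j})\<bar> > \<epsilon> * n)}"
  define \<beta> where "\<beta> = 2 * (real n + 1) * card (nonblank_cells M) * exp (- (\<epsilon>\<^sup>2 * n / 4))"
  have finWV: "finite WW" "finite VV" unfolding WW_def VV_def by (auto intro: finite_PiE)
  have WVnn: "0 \<le> W w" "0 \<le> V v" for w v unfolding W_def V_def by (auto intro: prod_nonneg pq)
  have WV1: "(\<Sum>w\<in>WW. W w) \<le> 1" "(\<Sum>v\<in>VV. V v) \<le> 1"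
    unfolding W_def V_def WW_def VV_def by (rule sum_prod_words_le_1; simp add: pq[unfolded One_nat_def])+
  have BW: "(\<Sum>w\<in>BW. W w) \<le> \<beta>"
    unfolding BW_def W_def \<beta>_def
    by (rule uneven_words_weight) (use \<epsilon> pq finite_nonblank_cells in \<open>auto simp: nonblank_cells_def\<close>)
  have "(\<Sum>v\<in>BV. V v) \<le> 2 * (real n + 1) * card (prod.swap ` nonblank_cells M) * exp (- (\<epsilon>\<^sup>2 * n / 4))"
    unfolding BV_def V_def
    by (rule uneven_words_weight) (use \<epsilon> pq finite_nonblank_cells in \<open>auto simp: nonblank_cells_def\<close>)
  then have BV: "(\<Sum>v\<in>BV. V v) \<le> \<beta>"
    by (simp add: \<beta>_def card_image)
  have bad: "col_word n b \<sigma> \<in> BW \<or> row_word n a \<sigma> \<in> BV" if "\<sigma> \<in> X" for \<sigma>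
  proof -
    have \<sigma>: "\<sigma> permutes {1..n}" "\<not> evenly_spread M n a b \<epsilon> \<sigma>" using that by (auto simp: X_def)
    have W: "col_word n b \<sigma> \<in> {1..n} \<rightarrow>\<^sub>E {1..nrows M}"
      using b permutes_in_image[OF \<sigma>(1)] by (auto simp: col_word_def)
    have V: "row_word n a \<sigma> \<in> {1..n} \<rightarrow>\<^sub>E {1..ncols M}"
      using a permutes_in_image[OF permutes_inv[OF \<sigma>(1)]] by (auto simp: row_word_def)
    define A where "A = (\<lambda>i j x. \<bar>real (card {k \<in> {1..x}. a k = i \<and> b (\<sigma> k) = j}) -
      p i j * real (card {k \<in> {1..x}. a k = i})\<bar>)"
    define B where "B = (\<lambda>i j x. \<bar>real (card {y \<in> {1..x}. b y = j \<and> a (inv \<sigma> y) = i}) -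
      q j i * real (card {y \<in> {1..x}. b y = j})\<bar>)"
    have "\<not> (\<forall>(i, j)\<in>nonblank_cells M. \<forall>x\<le>n. A i j x \<le> \<epsilon> * n \<and> B i j x \<le> \<epsilon> * n)"
      using \<sigma>(2) unfolding evenly_spread_def A_def B_def p_def q_def \<Gamma>_def .
    then obtain i j x where "(i, j) \<in> nonblank_cells M" "x \<le> n" "A i j x > \<epsilon> * n \<or> B i j x > \<epsilon> * n"
      by (force simp: not_le)
    then have cell: "(i, j) \<in> nonblank_cells M" "x \<le> n" and
      dev: "\<bar>real (card {k \<in> {1..x}. a k = i \<and> b (\<sigma> k) = j}) - p i j * real (card {k \<in> {1..x}. a k = i})\<bar> > \<epsilon> * n \<or>
        \<bar>real (card {y \<in> {1..x}. b y = j \<and> a (inv \<sigma> y) = i}) - q j i * real (card {y \<in> {1..x}. b y = j})\<bar> > \<epsilon> * n"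
      unfolding A_def B_def by simp_all
    have "{k \<in> {1..x}. a k = i \<and> col_word n b \<sigma> k = j} = {k \<in> {1..x}. a k = i \<and> b (\<sigma> k) = j}"
      "{y \<in> {1..x}. b y = j \<and> row_word n a \<sigma> y = i} = {y \<in> {1..x}. b y = j \<and> a (inv \<sigma> y) = i}"
      using cell(2) by (auto simp: col_word_def row_word_def)
    then show ?thesis
      using W V cell dev unfolding BW_def BV_def by (auto intro!: exI[of _ x] bexI[of _ "(i, j)"])
  qed
  have finX: "finite X"
    by (rule finite_subset[OF _ finite_permutations[of "{1..n}"]]) (auto simp: X_def)
  have inj: "inj_on (\<lambda>\<sigma>. (col_word n b \<sigma>, row_word n a \<sigma>)) X"
  proof (rule inj_onI)
    fix \<sigma> \<tau> assume "\<sigma> \<in> X" "\<tau> \<in> X" "(col_word n b \<sigma>, row_word n a \<sigma>) = (col_word n b \<tau>, row_word n a \<tau>)"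
    then have "\<sigma> permutes {1..n}" "monotone_cells M n a b \<sigma>" "\<tau> permutes {1..n}" "monotone_cells M n a b \<tau>"
      "col_word n b \<sigma> = col_word n b \<tau>" "row_word n a \<sigma> = row_word n a \<tau>"
      unfolding X_def by blast+
    with a b show "\<sigma> = \<tau>" by (intro words_determine_permutation[of \<sigma> n M a b \<tau>])
  qed
  have "real (card X) * exp (- (n * grid_entropy M \<Gamma>)) = (\<Sum>\<sigma>\<in>X. W (col_word n b \<sigma>) * V (row_word n a \<sigma>))"
    using weight_of_words[OF con _ _ a b] unfolding X_def W_def V_def p_def q_def \<Gamma>_def by simp
  also have "\<dots> = (\<Sum>(w, v)\<in>(\<lambda>\<sigma>. (col_word n b \<sigma>, row_word n a \<sigma>)) ` X. W w * V v)"
    using sum.reindex[OF inj, of "\<lambda>(w, v). W w * V v"] by (simp add: comp_def)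
  also have "\<dots> \<le> (\<Sum>(w, v)\<in>BW \<times> VV \<union> WW \<times> BV. W w * V v)"
  proof (rule sum_mono2)
    show "finite (BW \<times> VV \<union> WW \<times> BV)"
      by (rule finite_subset[of _ "WW \<times> VV"]) (use finWV in \<open>auto simp: BW_def BV_def WW_def VV_def\<close>)
    have "col_word n b \<sigma> \<in> WW" "row_word n a \<sigma> \<in> VV" if "\<sigma> \<in> X" for \<sigma>
      using that a b permutes_in_image[of \<sigma> "{1..n}"] permutes_in_image[OF permutes_inv, of \<sigma> "{1..n}"]
      by (auto simp: X_def col_word_def row_word_def WW_def VV_def)
    then show "(\<lambda>\<sigma>. (col_word n b \<sigma>, row_word n a \<sigma>)) ` X \<subseteq> BW \<times> VV \<union> WW \<times> BV"
      using bad by auto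
  qed (use WVnn in auto)
  also have "\<dots> \<le> (\<Sum>(w, v)\<in>BW \<times> VV. W w * V v) + (\<Sum>(w, v)\<in>WW \<times> BV. W w * V v)"
  proof -
    have "finite (BW \<times> VV)" "finite (WW \<times> BV)"
      by (rule finite_subset[of _ "WW \<times> VV"]; use finWV in \<open>auto simp: BW_def BV_def WW_def VV_def\<close>)+
    then show ?thesis
      using sum_Un[of "BW \<times> VV" "WW \<times> BV" "\<lambda>(w, v). W w * V v"]
        sum_nonneg[of "BW \<times> VV \<inter> WW \<times> BV" "\<lambda>(w, v). W w * V v"] WVnn by fastforce
  qed
  also have "\<dots> = (\<Sum>w\<in>BW. W w) * (\<Sum>v\<in>VV. V v) + (\<Sum>w\<in>WW. W w) * (\<Sum>v\<in>BV. V v)"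
    by (simp add: sum_product sum.cartesian_product)
  also have "\<dots> \<le> \<beta> * 1 + 1 * \<beta>"
    using BW BV WV1 WVnn by (intro add_mono mult_mono) (auto simp: \<beta>_def intro!: sum_nonneg)
  finally have "real (card X) * exp (- (n * grid_entropy M \<Gamma>)) \<le> 2 * \<beta>" by simp
  then have "real (card X) \<le> exp (n * grid_entropy M \<Gamma>) * (2 * \<beta>)"
    by (simp add: exp_minus field_simps)
  moreover have "2 * \<beta> = 4 * (real n + 1) * card (nonblank_cells M) * exp (- (\<epsilon>\<^sup>2 * n / 4))"
    by (simp add: \<beta>_def)
  ultimately show ?thesis
    by (simp only: X_def \<Gamma>_def)
qed

definition spread_permutation :: "gridding_matrix \<Rightarrow> nat \<Rightarrow> real \<Rightarrow> (nat \<Rightarrow> nat) \<Rightarrow> bool" where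
  "spread_permutation M n \<epsilon> \<sigma> \<longleftrightarrow>
     (\<exists>c r. is_gridding M n \<sigma> c r \<and> evenly_spread M n (block c) (block r) \<epsilon> \<sigma>)"

text \<open>
  Cuts are functions on all natural numbers. Making them constant beyond the last cut leaves finitely many.
\<close>

lemma is_gridding_min:
  assumes "is_gridding M n \<sigma> c r"
  shows "is_gridding M n \<sigma> (\<lambda>i. c (min i (ncols M))) (\<lambda>j. r (min j (nrows M)))"
proof -
  have col: "min (i - 1) (ncols M) = i - 1" "min i (ncols M) = i" if "i \<in> {1..ncols M}" for i
    using that by auto
  have row: "min (j - 1) (nrows M) = j - 1" "min j (nrows M) = j" if "j \<in> {1..nrows M}" for j
    using that by auto
  have "(\<forall>i\<in>{1..ncols M}. \<forall>j\<in>{1..nrows M}.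
        let K = {k \<in> {c (min (i - 1) (ncols M))<..c (min i (ncols M))}.
            \<sigma> k \<in> {r (min (j - 1) (nrows M))<..r (min j (nrows M))}} in
        case entry M i j of
          Increasing \<Rightarrow> strict_mono_on K \<sigma>
        | Decreasing \<Rightarrow> strict_antimono_on K \<sigma>
        | Blank \<Rightarrow> K = {}) \<longleftrightarrow>
      (\<forall>i\<in>{1..ncols M}. \<forall>j\<in>{1..nrows M}.
        let K = {k \<in> {c (i - 1)<..c i}. \<sigma> k \<in> {r (j - 1)<..r j}} in
        case entry M i j of
          Increasing \<Rightarrow> strict_mono_on K \<sigma>
        | Decreasing \<Rightarrow> strict_antimono_on K \<sigma>
        | Blank \<Rightarrow> K = {})"
    by (intro ball_cong refl) (simp only: col row)
  then show ?thesis
    using assms unfolding is_gridding_def by simp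
qed

text \<open>
  There are at most \<open>(n + 1)\<^sup>t\<^sup>+\<^sup>1\<close> ways to cut \<open>n\<close> into \<open>t\<close> intervals, so the choice of the cuts costs a polynomial factor.
\<close>

lemma card_uneven:
  assumes con: "connected_gridding_matrix M" and \<epsilon>: "0 < \<epsilon>" "\<epsilon> \<le> 1"
  shows "real (card {\<sigma> \<in> Grid M n. \<not> spread_permutation M n \<epsilon> \<sigma>}) \<le>
    4 * card (nonblank_cells M) * (real n + 1) ^ (ncols M + nrows M + 3) *
      exp (n * (grid_entropy M (max_distribution M) - \<epsilon>\<^sup>2 / 4))"
proof -
  define S where "S = grid_entropy M (max_distribution M)"
  define \<beta> where "\<beta> = exp (n * S) * (4 * (real n + 1) * card (nonblank_cells M) * exp (- (\<epsilon>\<^sup>2 * n / 4)))"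
  define cutset where "cutset = (\<lambda>t. (\<lambda>f i. f (min i t)) ` ({0..t} \<rightarrow>\<^sub>E {0..n}) :: (nat \<Rightarrow> nat) set)"
  have cutset: "finite (cutset t)" "card (cutset t) \<le> (n + 1) ^ (t + 1)" for t
  proof -
    have fin: "finite ({0..t} \<rightarrow>\<^sub>E {0..n} :: (nat \<Rightarrow> nat) set)" by (rule finite_PiE) auto
    then show "finite (cutset t)" unfolding cutset_def by simp
    have "card (cutset t) \<le> card ({0..t} \<rightarrow>\<^sub>E {0..n} :: (nat \<Rightarrow> nat) set)"
      unfolding cutset_def using fin by (rule card_image_le)
    then show "card (cutset t) \<le> (n + 1) ^ (t + 1)" by (simp add: card_PiE)
  qed
  have mem: "(\<lambda>i. c (min i t)) \<in> cutset t" if "cuts t n c" for c t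
  proof -
    have "(\<lambda>i. c (min i t)) = (\<lambda>f i. f (min i t)) (\<lambda>i\<in>{0..t}. c i)" by auto
    moreover have "(\<lambda>i\<in>{0..t}. c i) \<in> {0..t} \<rightarrow>\<^sub>E {0..n}" using cuts_le[OF that] by auto
    ultimately show ?thesis unfolding cutset_def by (rule image_eqI)
  qed
  define X where "X = (\<lambda>(c, r). {\<sigma>. \<sigma> permutes {1..n} \<and> is_gridding M n \<sigma> c r \<and>
    \<not> evenly_spread M n (block c) (block r) \<epsilon> \<sigma>})"
  have X: "real (card (X e)) \<le> \<beta>" for e
  proof (cases "\<exists>\<sigma>. \<sigma> \<in> X e")
    case True
    obtain c r where e: "e = (c, r)" by (cases e)
    obtain \<sigma> where "\<sigma> permutes {1..n}" "is_gridding M n \<sigma> c r" using True e by (auto simp: X_def)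
    then have cr: "cuts (ncols M) n c" "cuts (nrows M) n r" using is_gridding_iff by auto
    have "X e = {\<sigma>. \<sigma> permutes {1..n} \<and> monotone_cells M n (block c) (block r) \<sigma> \<and>
        \<not> evenly_spread M n (block c) (block r) \<epsilon> \<sigma>}"
      unfolding X_def e using is_gridding_iff cr by auto
    then show ?thesis
      unfolding \<beta>_def S_def using card_uneven_with_cuts[OF con \<epsilon> block_mem[OF cr(1)] block_mem[OF cr(2)]] by simp
  next
    case False
    then have "X e = {}" by blast
    then show ?thesis by (simp add: \<beta>_def)
  qed
  have "{\<sigma> \<in> Grid M n. \<not> spread_permutation M n \<epsilon> \<sigma>} \<subseteq> (\<Union>e\<in>cutset (ncols M) \<times> cutset (nrows M). X e)"
  proof
    fix \<sigma> assume "\<sigma> \<in> {\<sigma> \<in> Grid M n. \<not> spread_permutation M n \<epsilon> \<sigma>}"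
    then obtain c r where \<sigma>: "\<sigma> permutes {1..n}" "is_gridding M n \<sigma> c r" "\<not> spread_permutation M n \<epsilon> \<sigma>"
      by (auto simp: Grid_def)
    let ?c = "\<lambda>i. c (min i (ncols M))" and ?r = "\<lambda>j. r (min j (nrows M))"
    have "(?c, ?r) \<in> cutset (ncols M) \<times> cutset (nrows M)"
      using mem \<sigma>(2) is_gridding_iff[OF \<sigma>(1)] by auto
    moreover have "\<sigma> \<in> X (?c, ?r)"
      using \<sigma> is_gridding_min[OF \<sigma>(2)] unfolding X_def spread_permutation_def by blast
    ultimately show "\<sigma> \<in> (\<Union>e\<in>cutset (ncols M) \<times> cutset (nrows M). X e)" by blast
  qed
  moreover have "finite (X e)" for e
    by (rule finite_subset[OF _ finite_permutations[of "{1..n}"]]) (auto simp: X_def)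
  ultimately have "card {\<sigma> \<in> Grid M n. \<not> spread_permutation M n \<epsilon> \<sigma>} \<le>
      card (\<Union>e\<in>cutset (ncols M) \<times> cutset (nrows M). X e)"
    using cutset by (intro card_mono) auto
  also have "\<dots> \<le> (\<Sum>e\<in>cutset (ncols M) \<times> cutset (nrows M). card (X e))"
    using cutset by (intro card_UN_le) auto
  finally have "real (card {\<sigma> \<in> Grid M n. \<not> spread_permutation M n \<epsilon> \<sigma>}) \<le>
      real (\<Sum>e\<in>cutset (ncols M) \<times> cutset (nrows M). card (X e))"
    by (simp only: of_nat_le_iff)
  also have "\<dots> = (\<Sum>e\<in>cutset (ncols M) \<times> cutset (nrows M). real (card (X e)))"
    by (rule of_nat_sum)
  also have "\<dots> \<le> real (card (cutset (ncols M)) * card (cutset (nrows M))) * \<beta>"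
    using sum_mono[of "cutset (ncols M) \<times> cutset (nrows M)" "\<lambda>e. real (card (X e))" "\<lambda>_. \<beta>"] X
    by (simp add: card_cartesian_product)
  also have "\<dots> \<le> real ((n + 1) ^ (ncols M + 1) * (n + 1) ^ (nrows M + 1)) * \<beta>"
    by (intro mult_right_mono, subst of_nat_le_iff, intro mult_mono cutset) (auto simp: \<beta>_def)
  also have "\<dots> = 4 * card (nonblank_cells M) * (real n + 1) ^ (ncols M + nrows M + 3) * exp (n * (S - \<epsilon>\<^sup>2 / 4))"
  proof -
    have "exp (n * (S - \<epsilon>\<^sup>2 / 4)) = exp (n * S) * exp (- (\<epsilon>\<^sup>2 * n / 4))"
      unfolding exp_add[symmetric] by (simp add: algebra_simps)
    moreover have "x ^ (ncols M + nrows M + 3) = x ^ (ncols M + 1) * x ^ (nrows M + 1) * x" for x :: real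
      by (simp add: power_add power3_eq_cube)
    ultimately show ?thesis
      unfolding \<beta>_def of_nat_mult of_nat_power of_nat_add of_nat_1 by (simp only: mult_ac)
  qed
  finally show ?thesis by (simp add: S_def)
qed

text \<open>
  The lower bound for \<open>card (Grid M n)\<close> is applied with \<open>\<delta> = \<epsilon>\<^sup>2 / 8\<close>, half of the exponent that unevenness costs.
\<close>

lemma uneven_fraction_tendsto_0:
  assumes con: "connected_gridding_matrix M" and \<epsilon>: "0 < \<epsilon>" "\<epsilon> \<le> 1"
  shows "(\<lambda>n. card {\<sigma> \<in> Grid M n. \<not> spread_permutation M n \<epsilon> \<sigma>} / card (Grid M n)) \<longlonglongrightarrow> 0"
proof -
  define S where "S = grid_entropy M (max_distribution M)"
  define \<kappa> where "\<kappa> = \<epsilon>\<^sup>2 / 8"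
  define d where "d = ncols M + nrows M + 3"
  define C where "C = 4 * real (card (nonblank_cells M))"
  have \<kappa>: "\<kappa> > 0" using \<epsilon> by (simp add: \<kappa>_def)
  have "distribution_matrix M (max_distribution M)"
    using max_entropy_max_distribution[OF con] by (simp add: max_entropy_def)
  then have lower: "\<forall>\<^sub>F n in sequentially. exp (n * (S - \<kappa>)) \<le> card (Grid M n)"
    unfolding S_def using \<kappa> by (rule card_Grid_lower_bound)
  have "filterlim (\<lambda>n::nat. \<kappa> * (real n + 1)) at_top sequentially"
    using \<kappa> by real_asymp
  then have "(\<lambda>n::nat. (\<kappa> * (real n + 1)) ^ d / exp (\<kappa> * (real n + 1))) \<longlonglongrightarrow> 0"
    by (rule filterlim_compose[OF tendsto_power_div_exp_0])
  then have "(\<lambda>n::nat. C * exp \<kappa> / \<kappa> ^ d * ((\<kappa> * (real n + 1)) ^ d / exp (\<kappa> * (real n + 1)))) \<longlonglongrightarrow> C * exp \<kappa> / \<kappa> ^ d * 0"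
    by (rule tendsto_mult_left)
  moreover have "C * exp \<kappa> / \<kappa> ^ d * ((\<kappa> * (real n + 1)) ^ d / exp (\<kappa> * (real n + 1))) =
      C * (real n + 1) ^ d * exp (- (\<kappa> * n))" for n :: nat
  proof -
    have "C * exp \<kappa> / \<kappa> ^ d * ((\<kappa> * y) ^ d / exp (\<kappa> * y)) = C * y ^ d * (exp \<kappa> / exp (\<kappa> * y))" for y
      using \<kappa> by (simp add: power_mult_distrib)
    moreover have "exp \<kappa> / exp (\<kappa> * (real n + 1)) = exp (- (\<kappa> * n))"
      by (simp add: algebra_simps flip: exp_diff)
    ultimately show ?thesis by (simp only:)
  qed
  ultimately have lim: "(\<lambda>n::nat. C * (real n + 1) ^ d * exp (- (\<kappa> * n))) \<longlonglongrightarrow> 0" by simp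
  show ?thesis
  proof (rule tendsto_sandwich[OF _ _ tendsto_const lim])
    show "\<forall>\<^sub>F n in sequentially. card {\<sigma> \<in> Grid M n. \<not> spread_permutation M n \<epsilon> \<sigma>} / card (Grid M n) \<le>
        C * (real n + 1) ^ d * exp (- (\<kappa> * n))"
      using lower
    proof eventually_elim
      case (elim n)
      have "real (card {\<sigma> \<in> Grid M n. \<not> spread_permutation M n \<epsilon> \<sigma>}) \<le> C * (real n + 1) ^ d * exp (n * (S - \<epsilon>\<^sup>2 / 4))"
        using card_uneven[OF con \<epsilon>, of n] by (simp add: C_def d_def S_def)
      also have "n * (S - \<epsilon>\<^sup>2 / 4) = - (\<kappa> * n) + n * (S - \<kappa>)" by (simp add: \<kappa>_def field_simps)
      also have "C * (real n + 1) ^ d * exp (- (\<kappa> * n) + n * (S - \<kappa>)) =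
          C * (real n + 1) ^ d * exp (- (\<kappa> * n)) * exp (n * (S - \<kappa>))" by (simp only: exp_add mult.assoc)
      also have "\<dots> \<le> C * (real n + 1) ^ d * exp (- (\<kappa> * n)) * card (Grid M n)"
        using elim by (intro mult_left_mono) (auto simp: C_def)
      finally show ?case
        using less_le_trans[OF exp_gt_zero elim] by (simp add: divide_le_eq)
    qed
  qed simp
qed

section \<open>Evenly spread permutations are close to the limit\<close>

lemma rank_bij:
  fixes K :: "'a::linorder set"
  assumes "finite K"
  shows "bij_betw (\<lambda>k. card {x \<in> K. x \<le> k}) K {1..card K}"
proof -
  let ?g = "\<lambda>k. card {x \<in> K. x \<le> k}"
  have inj: "inj_on ?g K"
  proof (rule linorder_inj_onI')
    fix x y assume "x \<in> K" "y \<in> K" "x < y"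
    then show "?g x \<noteq> ?g y" using card_le_strict[OF assms, of y x] by simp
  qed
  have "?g ` K \<subseteq> {1..card K}"
  proof clarify
    fix k assume "k \<in> K"
    then have "{x \<in> K. x \<le> k} \<noteq> {}" by auto
    then have "?g k > 0" using assms by (simp add: card_gt_0_iff)
    moreover have "?g k \<le> card K" using assms by (intro card_mono) auto
    ultimately show "?g k \<in> {1..card K}" by simp
  qed
  moreover have "card (?g ` K) = card {1..card K}" using inj by (simp add: card_image)
  ultimately have "?g ` K = {1..card K}" by (intro card_subset_eq) auto
  then show ?thesis using inj by (simp add: bij_betw_def)
qed

text \<open>
  If \<open>g\<close> of the first \<open>k - c (i - 1)\<close> points of column \<open>i\<close> lie in a cell that receives the proportion \<open>p\<close> of the column, then
  \<open>k\<close> is about \<open>c (i - 1) + g / p\<close>. Here \<open>C\<close> and \<open>s\<close> stand for the limits of the scaled left end and width of the column,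
  and \<open>A\<close> for the number of points in the cell. The same estimate serves rows.
\<close>

lemma position_estimate:
  assumes c: "cuts t n c" "i \<in> {1..t}" "k \<in> {1..n}" "block c k = i"
    and dev: "\<bar>real g - p * real (card {x \<in> {1..k}. block c x = i})\<bar> \<le> \<epsilon> * n"
    and p: "p > 0" and g: "g \<le> A" "0 < A"
  shows "\<bar>k / n - (C + g / A * s)\<bar> \<le> \<bar>c (i - 1) / n - C\<bar> + \<epsilon> / p + \<bar>A / (n * p) - s\<bar>"
proof -
  have n: "real n > 0" using c(3) by auto
  have k: "c (i - 1) < k" "k \<le> c i" using block_eq_iff[OF c(1-3)] c(4) by auto
  have "{x \<in> {1..k}. block c x = i} = {c (i - 1)<..min k (c i)}"
    using c(3) by (intro card_block[OF c(1,2)]) auto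
  then have "card {x \<in> {1..k}. block c x = i} = k - c (i - 1)"
    using k by (simp add: min_absorb1)
  then have "\<bar>real g - p * (real k - c (i - 1))\<bar> \<le> \<epsilon> * n"
    using dev k by (simp add: of_nat_diff)
  then have "\<bar>p * (real k - c (i - 1)) - real g\<bar> / (n * p) \<le> \<epsilon> * n / (n * p)"
    using n p by (intro divide_right_mono) (auto simp: abs_minus_commute)
  moreover have "\<bar>p * (real k - c (i - 1)) - real g\<bar> / (n * p) = \<bar>(real k - c (i - 1)) / n - g / (n * p)\<bar>"
  proof -
    have "(real k - c (i - 1)) / n - g / (n * p) = (p * (real k - c (i - 1)) - real g) / (n * p)"
      using n p by (simp add: diff_divide_distrib)
    then show ?thesis using n p by (simp add: abs_divide)
  qed
  ultimately have e2: "\<bar>(real k - c (i - 1)) / n - g / (n * p)\<bar> \<le> \<epsilon> / p"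
    using n by simp
  have "\<bar>g / A * (A / (n * p) - s)\<bar> \<le> 1 * \<bar>A / (n * p) - s\<bar>"
    unfolding abs_mult using g by (intro mult_right_mono) auto
  moreover have "k / n - (C + g / A * s) = (c (i - 1) / n - C) + ((real k - c (i - 1)) / n - g / (n * p)) +
      g / A * (A / (n * p) - s)"
    using g by (simp add: diff_divide_distrib right_diff_distrib)
  moreover have "\<bar>X\<bar> \<le> \<bar>u\<bar> + e + z" if "X = u + v + y" "\<bar>v\<bar> \<le> e" "\<bar>y\<bar> \<le> 1 * z" for X u v y e z :: real
    using that by linarith
  ultimately show ?thesis using e2 by blast
qed

lemma uniformly_continuous_unit_square:
  fixes f :: "real \<times> real \<Rightarrow> real"
  assumes "continuous_on UNIV f" "\<eta> > 0"
  obtains \<delta> where "\<delta> > 0" "\<And>x y x' y'. x \<in> {0..1} \<Longrightarrow> y \<in> {0..1} \<Longrightarrow> x' \<in> {0..1} \<Longrightarrow> y' \<in> {0..1} \<Longrightarrow>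
    \<bar>x - x'\<bar> < \<delta> \<Longrightarrow> \<bar>y - y'\<bar> < \<delta> \<Longrightarrow> \<bar>f (x, y) - f (x', y')\<bar> < \<eta>"
proof -
  have "uniformly_continuous_on ({0..1} \<times> {0..1}) f"
    by (intro compact_uniformly_continuous compact_Times continuous_on_subset[OF assms(1)]) auto
  then obtain d where d: "d > 0" "\<And>p p'. p \<in> {0..1} \<times> {0..1} \<Longrightarrow> p' \<in> {0..1} \<times> {0..1} \<Longrightarrow>
      dist p' p < d \<Longrightarrow> dist (f p') (f p) < \<eta>"
    using assms(2) unfolding uniformly_continuous_on_def by metis
  show ?thesis
  proof (rule that[of "d / 2"])
    fix x y x' y' :: real
    assume u: "x \<in> {0..1}" "y \<in> {0..1}" "x' \<in> {0..1}" "y' \<in> {0..1}" and close: "\<bar>x - x'\<bar> < d / 2" "\<bar>y - y'\<bar> < d / 2"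
    have "dist (x, y) (x', y') \<le> \<bar>x - x'\<bar> + \<bar>y - y'\<bar>"
      unfolding dist_Pair_Pair dist_real_def by (rule sqrt_sum_squares_le_sum_abs[THEN order_trans]) simp
    then have "dist (x, y) (x', y') < d" using close by linarith
    then have "dist (f (x, y)) (f (x', y')) < \<eta>" using u by (intro d(2)) auto
    then show "\<bar>f (x, y) - f (x', y')\<bar> < \<eta>" by (simp add: dist_real_def)
  qed (use d in simp)
qed

text \<open>
  Working along a sequence whose errors \<open>E\<close> tend to 0, not with a fixed error, turns the chains of estimates along
  the lines and along walks in the cell graph into sums of null sequences.
\<close>

locale spread_sequence =
  fixes M :: gridding_matrix and N :: "nat \<Rightarrow> nat" and E :: "nat \<Rightarrow> real"
    and \<sigma> :: "nat \<Rightarrow> nat \<Rightarrow> nat" and c r :: "nat \<Rightarrow> nat \<Rightarrow> nat"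
  assumes con: "connected_gridding_matrix M"
    and N_pos: "\<And>m. N m > 0" and N_lim: "filterlim N at_top sequentially" and E_lim: "E \<longlonglongrightarrow> 0"
    and perm: "\<And>m. \<sigma> m permutes {1..N m}" and gridding: "\<And>m. is_gridding M (N m) (\<sigma> m) (c m) (r m)"
    and spread: "\<And>m. evenly_spread M (N m) (block (c m)) (block (r m)) (E m) (\<sigma> m)"
begin

abbreviation "\<gamma> \<equiv> max_distribution M"
abbreviation "s \<equiv> col_sum M \<gamma>"
abbreviation "t \<equiv> row_sum M \<gamma>"

definition pts :: "nat \<Rightarrow> nat \<Rightarrow> nat \<Rightarrow> nat set" where
  "pts m i j = cell_points (N m) (block (c m)) (block (r m)) (\<sigma> m) i j"

definition npts :: "nat \<Rightarrow> nat \<Rightarrow> nat \<Rightarrow> nat" where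
  "npts m i j = card (pts m i j)"

lemma cuts: "cuts (ncols M) (N m) (c m)" "cuts (nrows M) (N m) (r m)"
  and monotone: "monotone_cells M (N m) (block (c m)) (block (r m)) (\<sigma> m)"
  using gridding[of m] is_gridding_iff[OF perm] by auto

lemma dist: "distribution_matrix M \<gamma>"
  using max_entropy_max_distribution[OF con] by (simp add: max_entropy_def)

lemma cell_pos:
  assumes "(i, j) \<in> nonblank_cells M"
  shows "\<gamma> i j > 0" "s i > 0" "t j > 0" "i \<in> {1..ncols M}" "j \<in> {1..nrows M}"
proof -
  show "\<gamma> i j > 0" by (rule max_entropy_pos[OF con max_entropy_max_distribution[OF con] assms])
  then show "s i > 0" "t j > 0" using le_sum_line[OF dist assms] by auto
qed (use assms in \<open>auto simp: nonblank_cells_def\<close>)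

lemma finite_pts [simp]: "finite (pts m i j)"
  by (simp add: pts_def cell_points_def)

lemma pts_blank:
  assumes "i \<in> {1..ncols M}" "j \<in> {1..nrows M}" "(i, j) \<notin> nonblank_cells M"
  shows "pts m i j = {}" "\<gamma> i j = 0"
  using assms monotone_cellsD(3)[OF monotone assms(1,2)] dist
  by (auto simp: pts_def nonblank_cells_def distribution_matrix_def)

lemma \<sigma>_mem: "k \<in> {1..N m} \<Longrightarrow> \<sigma> m k \<in> {1..N m}"
  using perm[of m] by (simp only: permutes_in_image)

lemma column_points:
  assumes "i \<in> {1..ncols M}"
  shows "{k \<in> {1..N m}. block (c m) k = i} = (\<Union>j\<in>{1..nrows M}. pts m i j)"
  using block_mem[OF cuts(2) \<sigma>_mem, of _ m] by (auto simp: pts_def cell_points_def)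

lemma column_card:
  assumes "i \<in> {1..ncols M}"
  shows "card {k \<in> {1..N m}. block (c m) k = i} = (\<Sum>j=1..nrows M. npts m i j)"
  unfolding column_points[OF assms] npts_def
  by (rule card_UN_disjoint) (auto simp: pts_def cell_points_def)

lemma \<sigma>_pts: "\<sigma> m ` pts m i j = {y \<in> {1..N m}. block (r m) y = j \<and> block (c m) (inv (\<sigma> m) y) = i}"
  unfolding pts_def by (rule image_cell_points[OF perm])

lemma card_\<sigma>_pts: "card (\<sigma> m ` pts m i j) = npts m i j"
  unfolding npts_def using permutes_inj[OF perm] by (intro card_image) (auto intro: inj_on_subset)

lemma row_card:
  assumes "j \<in> {1..nrows M}"
  shows "card {y \<in> {1..N m}. block (r m) y = j} = (\<Sum>i=1..ncols M. npts m i j)"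
proof -
  have "inv (\<sigma> m) y \<in> {1..N m}" if "y \<in> {1..N m}" for y
    using that permutes_in_image[OF permutes_inv[OF perm]] by blast
  then have "{y \<in> {1..N m}. block (r m) y = j} = (\<Union>i\<in>{1..ncols M}. \<sigma> m ` pts m i j)"
    unfolding \<sigma>_pts using block_mem[OF cuts(1)] by auto
  then have "card {y \<in> {1..N m}. block (r m) y = j} = (\<Sum>i=1..ncols M. card (\<sigma> m ` pts m i j))"
    by (simp only:) (rule card_UN_disjoint; auto simp: \<sigma>_pts)
  then show ?thesis by (simp add: card_\<sigma>_pts)
qed

lemma all_points: "{1..N m} = (\<Union>i\<in>{1..ncols M}. {k \<in> {1..N m}. block (c m) k = i})"
  using block_mem[OF cuts(1)] by auto

lemma sum_points:
  fixes h :: "nat \<Rightarrow> real"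
  shows "(\<Sum>k=1..N m. h k) = (\<Sum>i=1..ncols M. \<Sum>j=1..nrows M. \<Sum>k\<in>pts m i j. h k)"
proof -
  have "(\<Sum>k=1..N m. h k) = (\<Sum>i=1..ncols M. \<Sum>k | k \<in> {1..N m} \<and> block (c m) k = i. h k)"
    by (subst all_points, rule sum.UNION_disjoint) auto
  also have "\<dots> = (\<Sum>i=1..ncols M. \<Sum>j=1..nrows M. \<Sum>k\<in>pts m i j. h k)"
  proof (rule sum.cong[OF refl])
    fix i assume i: "i \<in> {1..ncols M}"
    show "(\<Sum>k | k \<in> {1..N m} \<and> block (c m) k = i. h k) = (\<Sum>j=1..nrows M. \<Sum>k\<in>pts m i j. h k)"
      unfolding column_points[OF i] by (rule sum.UNION_disjoint) (auto simp: pts_def cell_points_def)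
  qed
  finally show ?thesis .
qed

lemma total: "(\<Sum>i=1..ncols M. \<Sum>j=1..nrows M. real (npts m i j)) = N m"
  using sum_points[where m = m and h = "\<lambda>_. 1"] by (simp add: npts_def)

lemma cut_col:
  assumes "i \<le> ncols M"
  shows "real (c m i) = (\<Sum>i'=1..i. \<Sum>j=1..nrows M. real (npts m i' j))"
  using assms
proof (induction i)
  case 0
  then show ?case using cuts(1)[of m] by (simp add: cuts_def)
next
  case (Suc i)
  have i: "Suc i \<in> {1..ncols M}" using Suc.prems by simp
  have "{k \<in> {1..N m}. block (c m) k = Suc i} = {c m i<..c m (Suc i)}"
    using card_block[OF cuts(1) i order_refl] cuts_le[OF cuts(1) Suc.prems] by (simp add: min_absorb2)
  then have "c m (Suc i) - c m i = (\<Sum>j=1..nrows M. npts m (Suc i) j)" using column_card[OF i, of m] by simp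
  moreover have "c m i \<le> c m (Suc i)" using cuts(1)[of m] Suc.prems by (simp add: cuts_def)
  ultimately have "real (c m (Suc i)) = real (c m i) + (\<Sum>j=1..nrows M. real (npts m (Suc i) j))"
    by (metis le_add_diff_inverse of_nat_add of_nat_sum)
  then show ?case using Suc by simp
qed

lemma cut_row:
  assumes "j \<le> nrows M"
  shows "real (r m j) = (\<Sum>j'=1..j. \<Sum>i=1..ncols M. real (npts m i j'))"
  using assms
proof (induction j)
  case 0
  then show ?case using cuts(2)[of m] by (simp add: cuts_def)
next
  case (Suc j)
  have j: "Suc j \<in> {1..nrows M}" using Suc.prems by simp
  have "{y \<in> {1..N m}. block (r m) y = Suc j} = {r m j<..r m (Suc j)}"
    using card_block[OF cuts(2) j order_refl] cuts_le[OF cuts(2) Suc.prems] by (simp add: min_absorb2)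
  then have "r m (Suc j) - r m j = (\<Sum>i=1..ncols M. npts m i (Suc j))" using row_card[OF j, of m] by simp
  moreover have "r m j \<le> r m (Suc j)" using cuts(2)[of m] Suc.prems by (simp add: cuts_def)
  ultimately have "real (r m (Suc j)) = real (r m j) + (\<Sum>i=1..ncols M. real (npts m i (Suc j)))"
    by (metis le_add_diff_inverse of_nat_add of_nat_sum)
  then show ?case using Suc by simp
qed

subsection \<open>Convergence of the cell counts\<close>

lemma spreadD:
  assumes "(i, j) \<in> nonblank_cells M" "x \<le> N m"
  shows "\<bar>real (card {k \<in> {1..x}. block (c m) k = i \<and> block (r m) (\<sigma> m k) = j}) -
      \<gamma> i j / s i * real (card {k \<in> {1..x}. block (c m) k = i})\<bar> \<le> E m * N m"
    "\<bar>real (card {y \<in> {1..x}. block (r m) y = j \<and> block (c m) (inv (\<sigma> m) y) = i}) -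
      \<gamma> i j / t j * real (card {y \<in> {1..x}. block (r m) y = j})\<bar> \<le> E m * N m"
  using spread[of m] assms unfolding evenly_spread_def by auto

text \<open>
  The factor by which the number of points of a cell exceeds its expected value \<open>n \<gamma>\<^sub>i\<^sub>j\<close>.
\<close>

definition ratio :: "nat \<Rightarrow> nat \<Rightarrow> nat \<Rightarrow> real" where
  "ratio m i j = npts m i j / (N m * \<gamma> i j)"

text \<open>
  On a column, every cell has the same ratio as the column as a whole, in the limit; likewise on a row. This is
  even spread for the longest prefix.
\<close>

lemma ratio_line:
  assumes cell: "(i, j) \<in> nonblank_cells M"
  shows "(\<lambda>m. ratio m i j - (\<Sum>j=1..nrows M. real (npts m i j)) / (N m * s i)) \<longlonglongrightarrow> 0"
    "(\<lambda>m. ratio m i j - (\<Sum>i=1..ncols M. real (npts m i j)) / (N m * t j)) \<longlonglongrightarrow> 0"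
proof -
  note p = cell_pos[OF cell]
  have E\<gamma>: "(\<lambda>m. E m / \<gamma> i j) \<longlonglongrightarrow> 0"
    using tendsto_divide[OF E_lim tendsto_const, of "\<gamma> i j"] p by simp
  have bound: "\<bar>a / (n * \<gamma> i j) - b / (n * l)\<bar> \<le> e / \<gamma> i j"
    if "\<bar>a - \<gamma> i j / l * b\<bar> \<le> e * n" "l > 0" "n > 0" for a b e l n :: real
  proof -
    have "a / (n * \<gamma> i j) - b / (n * l) = (a - \<gamma> i j / l * b) / (n * \<gamma> i j)"
      using that p by (simp add: diff_divide_distrib)
    then have "\<bar>a / (n * \<gamma> i j) - b / (n * l)\<bar> = \<bar>a - \<gamma> i j / l * b\<bar> / (n * \<gamma> i j)"
      using that p by (simp add: abs_divide)
    also have "\<dots> \<le> e * n / (n * \<gamma> i j)"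
      using that p by (intro divide_right_mono) auto
    finally show ?thesis using that by simp
  qed
  have "\<bar>ratio m i j - (\<Sum>j=1..nrows M. real (npts m i j)) / (N m * s i)\<bar> \<le> E m / \<gamma> i j" for m
    unfolding ratio_def using spreadD(1)[OF cell order_refl, of m] column_card[OF p(4), of m] N_pos[of m] p
    by (intro bound) (auto simp: npts_def pts_def cell_points_def)
  then show "(\<lambda>m. ratio m i j - (\<Sum>j=1..nrows M. real (npts m i j)) / (N m * s i)) \<longlonglongrightarrow> 0"
    by (intro Lim_null_comparison[OF _ E\<gamma>]) auto
  have "\<bar>ratio m i j - (\<Sum>i=1..ncols M. real (npts m i j)) / (N m * t j)\<bar> \<le> E m / \<gamma> i j" for m
    unfolding ratio_def using spreadD(2)[OF cell order_refl, of m] row_card[OF p(5), of m] N_pos[of m] p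
      card_\<sigma>_pts[of m i j]
    by (intro bound) (auto simp: \<sigma>_pts)
  then show "(\<lambda>m. ratio m i j - (\<Sum>i=1..ncols M. real (npts m i j)) / (N m * t j)) \<longlonglongrightarrow> 0"
    by (intro Lim_null_comparison[OF _ E\<gamma>]) auto
qed

lemma ratio_diff:
  assumes "(i0, j0) \<in> nonblank_cells M" "(i1, j1) \<in> nonblank_cells M"
  shows "(\<lambda>m. ratio m i1 j1 - ratio m i0 j0) \<longlonglongrightarrow> 0"
proof (rule nonblank_walk_induct[where P = "\<lambda>i j. (\<lambda>m. ratio m i j - ratio m i0 j0) \<longlonglongrightarrow> 0", OF con assms(1) _ _ _ assms(2)])
  fix i j j' assume cells: "(i, j) \<in> nonblank_cells M" "(i, j') \<in> nonblank_cells M"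
    and IH: "(\<lambda>m. ratio m i j - ratio m i0 j0) \<longlonglongrightarrow> 0"
  show "(\<lambda>m. ratio m i j' - ratio m i0 j0) \<longlonglongrightarrow> 0"
    using tendsto_add[OF tendsto_diff[OF ratio_line(1)[OF cells(2)] ratio_line(1)[OF cells(1)]] IH] by simp
next
  fix i i' j assume cells: "(i, j) \<in> nonblank_cells M" "(i', j) \<in> nonblank_cells M"
    and IH: "(\<lambda>m. ratio m i j - ratio m i0 j0) \<longlonglongrightarrow> 0"
  show "(\<lambda>m. ratio m i' j - ratio m i0 j0) \<longlonglongrightarrow> 0"
    using tendsto_add[OF tendsto_diff[OF ratio_line(2)[OF cells(2)] ratio_line(2)[OF cells(1)]] IH] by simp
qed simp

text \<open>
  The average of the ratios with weights \<open>\<gamma>\<^sub>i\<^sub>j\<close> is 1, and in the limit they all agree.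
\<close>

lemma ratio_lim:
  assumes cell: "(i0, j0) \<in> nonblank_cells M"
  shows "(\<lambda>m. ratio m i0 j0) \<longlonglongrightarrow> 1"
proof -
  have "(\<lambda>m. \<Sum>i=1..ncols M. \<Sum>j=1..nrows M. \<gamma> i j * (ratio m i j - ratio m i0 j0)) \<longlonglongrightarrow>
      (\<Sum>i=1..ncols M. \<Sum>j=1..nrows M. 0)"
  proof (intro tendsto_sum)
    fix i j assume ij: "i \<in> {1..ncols M}" "j \<in> {1..nrows M}"
    show "(\<lambda>m. \<gamma> i j * (ratio m i j - ratio m i0 j0)) \<longlonglongrightarrow> 0"
    proof (cases "(i, j) \<in> nonblank_cells M")
      case True
      then show ?thesis using tendsto_mult_left[OF ratio_diff[OF cell True], of "\<gamma> i j"] by simp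
    qed (simp add: pts_blank[OF ij])
  qed
  moreover have "(\<Sum>i=1..ncols M. \<Sum>j=1..nrows M. \<gamma> i j * (ratio m i j - ratio m i0 j0)) = 1 - ratio m i0 j0" for m
  proof -
    have "(\<Sum>i=1..ncols M. \<Sum>j=1..nrows M. \<gamma> i j * ratio m i j) = (\<Sum>i=1..ncols M. \<Sum>j=1..nrows M. npts m i j / N m)"
    proof (intro sum.cong refl)
      fix i j assume ij: "i \<in> {1..ncols M}" "j \<in> {1..nrows M}"
      show "\<gamma> i j * ratio m i j = npts m i j / N m"
      proof (cases "(i, j) \<in> nonblank_cells M")
        case True
        then show ?thesis using cell_pos(1)[OF True] by (simp add: ratio_def)
      qed (simp add: pts_blank[OF ij] npts_def)
    qed
    also have "\<dots> = 1"
      using total[of m] N_pos[of m] by (simp flip: sum_divide_distrib)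
    finally have "(\<Sum>i=1..ncols M. \<Sum>j=1..nrows M. \<gamma> i j * ratio m i j) = 1" .
    moreover have "(\<Sum>i=1..ncols M. \<Sum>j=1..nrows M. \<gamma> i j * ratio m i0 j0) = 1 * ratio m i0 j0"
      using dist unfolding sum_distrib_right[symmetric] distribution_matrix_def by simp
    ultimately show ?thesis by (simp add: right_diff_distrib sum_subtractf)
  qed
  ultimately have "(\<lambda>m. 1 - ratio m i0 j0) \<longlonglongrightarrow> 0" by simp
  from tendsto_diff[OF tendsto_const[of 1] this] show ?thesis by simp
qed

lemma npts_lim:
  assumes ij: "i \<in> {1..ncols M}" "j \<in> {1..nrows M}"
  shows "(\<lambda>m. npts m i j / N m) \<longlonglongrightarrow> \<gamma> i j"
proof (cases "(i, j) \<in> nonblank_cells M")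
  case True
  then show ?thesis
    using tendsto_mult_left[OF ratio_lim[OF True], of "\<gamma> i j"] cell_pos(1)[OF True] by (simp add: ratio_def)
qed (simp add: pts_blank[OF ij] npts_def)

lemma cut_lim:
  "i \<le> ncols M \<Longrightarrow> (\<lambda>m. c m i / N m) \<longlonglongrightarrow> col_bound M i"
  "j \<le> nrows M \<Longrightarrow> (\<lambda>m. r m j / N m) \<longlonglongrightarrow> row_bound M j"
proof -
  show "(\<lambda>m. c m i / N m) \<longlonglongrightarrow> col_bound M i" if "i \<le> ncols M"
    unfolding cut_col[OF that] col_bound_def col_sum_def sum_divide_distrib
    using that by (intro tendsto_sum npts_lim) auto
  show "(\<lambda>m. r m j / N m) \<longlonglongrightarrow> row_bound M j" if "j \<le> nrows M"
    unfolding cut_row[OF that] row_bound_def row_sum_def sum_divide_distrib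
    using that by (intro tendsto_sum npts_lim) auto
qed

subsection \<open>Convergence inside a cell\<close>

text \<open>
  The point of \<open>L(i, j)\<close> with parameter \<open>x\<close>, written relative to the lower left corner of the cell.
\<close>

definition segment_point :: "nat \<Rightarrow> nat \<Rightarrow> real \<Rightarrow> real \<times> real" where
  "segment_point i j x = (col_bound M (i - 1) + x * s i,
     if entry M i j = Increasing then row_bound M (j - 1) + x * t j else row_bound M (j - 1) + (1 - x) * t j)"

lemma cell_integral:
  assumes "i > 0" "j > 0" "f \<in> borel_measurable borel"
  shows "(LINT x|cell_measure M (i, j). f x) = (LINT x|uniform_measure lborel {0..1}. (f (segment_point i j x) :: real))"
proof -
  define P where "P = (if entry M i j = Increasing then grid_point M (i - 1) (j - 1) else grid_point M (i - 1) j)"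
  define Q where "Q = (if entry M i j = Increasing then grid_point M i j else grid_point M i (j - 1))"
  have "cell_measure M (i, j) = segment_measure P Q"
    by (simp add: cell_measure_def P_def Q_def)
  moreover have "linepath P Q x = segment_point i j x" for x
    using bound_step(1)[OF assms(1), of M] bound_step(2)[OF assms(2), of M]
    by (simp add: linepath_def P_def Q_def segment_point_def grid_point_eq algebra_simps)
  ultimately show ?thesis using assms(3) by (simp add: segment_measure(3))
qed

lemma segment_point_unit:
  assumes "(i, j) \<in> nonblank_cells M" "x \<in> {0..1}"
  shows "fst (segment_point i j x) \<in> {0..1}" "snd (segment_point i j x) \<in> {0..1}"
proof -
  note p = cell_pos[OF assms(1)]
  have u: "col_bound M (i - 1) \<in> {0..1}" "col_bound M (i - 1) + s i \<in> {0..1}"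
      "row_bound M (j - 1) \<in> {0..1}" "row_bound M (j - 1) + t j \<in> {0..1}"
    using bounds_unit(1)[OF dist, of "i - 1"] bounds_unit(1)[OF dist, of i]
      bounds_unit(2)[OF dist, of "j - 1"] bounds_unit(2)[OF dist, of j]
      bound_step(1)[of i M] bound_step(2)[of j M] p by auto
  have m: "0 \<le> y * l \<and> y * l \<le> l" if "y \<in> {0..1}" "l > 0" for y l :: real
    using that by (auto intro: mult_left_le_one_le)
  have mx: "0 \<le> x * s i \<and> x * s i \<le> s i" "0 \<le> x * t j \<and> x * t j \<le> t j"
    "0 \<le> (1 - x) * t j \<and> (1 - x) * t j \<le> t j"
    using assms(2) p(2,3) by (auto intro!: m)
  show "fst (segment_point i j x) \<in> {0..1}"
    using u(1,2) mx(1) unfolding segment_point_def fst_conv atLeastAtMost_iff by linarith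
  show "snd (segment_point i j x) \<in> {0..1}"
    using u(3,4) mx(2,3) unfolding segment_point_def snd_conv atLeastAtMost_iff
    by (cases "entry M i j = Increasing") (simp_all only: simp_thms if_True if_False, linarith+)
qed

definition rank :: "nat \<Rightarrow> nat \<Rightarrow> nat \<Rightarrow> nat \<Rightarrow> nat" where
  "rank m i j k = card {x \<in> pts m i j. x \<le> k}"

definition err_x :: "nat \<Rightarrow> nat \<Rightarrow> nat \<Rightarrow> real" where
  "err_x m i j = \<bar>c m (i - 1) / N m - col_bound M (i - 1)\<bar> + E m / (\<gamma> i j / s i) +
     \<bar>npts m i j / (N m * (\<gamma> i j / s i)) - s i\<bar>"

text \<open>
  The last term accounts for decreasing cells, where the ranks from the left and from below add up to the
  number of points plus one.
\<close>

definition err_y :: "nat \<Rightarrow> nat \<Rightarrow> nat \<Rightarrow> real" where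
  "err_y m i j = \<bar>r m (j - 1) / N m - row_bound M (j - 1)\<bar> + E m / (\<gamma> i j / t j) +
     \<bar>npts m i j / (N m * (\<gamma> i j / t j)) - t j\<bar> + t j / npts m i j"

lemma npts_filterlim:
  assumes "(i, j) \<in> nonblank_cells M"
  shows "filterlim (\<lambda>m. npts m i j) at_top sequentially"
proof -
  note p = cell_pos[OF assms]
  have "filterlim (\<lambda>m. real (N m)) at_top sequentially"
    using N_lim by (rule filterlim_compose[OF filterlim_real_sequentially])
  then have "filterlim (\<lambda>m. (npts m i j / N m) * real (N m)) at_top sequentially"
    by (rule filterlim_tendsto_pos_mult_at_top[OF npts_lim[OF p(4,5)] p(1)])
  then have "filterlim (\<lambda>m. real (npts m i j)) at_top sequentially"
    using N_pos by simp
  then show ?thesis by (simp add: filterlim_sequentially_iff_filterlim_real)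
qed

lemma err_lim:
  assumes "(i, j) \<in> nonblank_cells M"
  shows "(\<lambda>m. err_x m i j) \<longlonglongrightarrow> 0" "(\<lambda>m. err_y m i j) \<longlonglongrightarrow> 0"
proof -
  note p = cell_pos[OF assms]
  have inv: "(\<lambda>m. npts m i j / (N m * (\<gamma> i j / l)) - l) \<longlonglongrightarrow> 0" if "l > 0" for l
    using tendsto_diff[OF tendsto_mult_right[OF npts_lim[OF p(4,5)], of "l / \<gamma> i j"] tendsto_const[of l]] p that
    by simp
  have "filterlim (\<lambda>m. real (npts m i j)) at_top sequentially"
    using npts_filterlim[OF assms] by (rule filterlim_compose[OF filterlim_real_sequentially])
  then have tA: "(\<lambda>m. t j / npts m i j) \<longlonglongrightarrow> 0"
    by (intro tendsto_divide_0[OF tendsto_const] filterlim_at_top_imp_at_infinity)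
  have le: "i - 1 \<le> ncols M" "j - 1 \<le> nrows M" using p(4,5) by auto
  have cx: "(\<lambda>m. c m (i - 1) / N m - col_bound M (i - 1)) \<longlonglongrightarrow> 0"
    using tendsto_diff[OF cut_lim(1)[OF le(1)] tendsto_const[of "col_bound M (i - 1)"]] by simp
  have ry: "(\<lambda>m. r m (j - 1) / N m - row_bound M (j - 1)) \<longlonglongrightarrow> 0"
    using tendsto_diff[OF cut_lim(2)[OF le(2)] tendsto_const[of "row_bound M (j - 1)"]] by simp
  have El: "(\<lambda>m. E m / l) \<longlonglongrightarrow> 0" if "l > 0" for l
    using tendsto_divide[OF E_lim tendsto_const, of l] that by simp
  have "(\<lambda>m. err_x m i j) \<longlonglongrightarrow> \<bar>0\<bar> + 0 + \<bar>0\<bar>"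
    unfolding err_x_def using p by (intro tendsto_add tendsto_rabs cx inv El) auto
  then show "(\<lambda>m. err_x m i j) \<longlonglongrightarrow> 0" by simp
  have "(\<lambda>m. err_y m i j) \<longlonglongrightarrow> \<bar>0\<bar> + 0 + \<bar>0\<bar> + 0"
    unfolding err_y_def using p by (intro tendsto_add tendsto_rabs ry inv El tA) auto
  then show "(\<lambda>m. err_y m i j) \<longlonglongrightarrow> 0" by simp
qed

lemma point_close:
  assumes cell: "(i, j) \<in> nonblank_cells M" and k: "k \<in> pts m i j"
  shows "\<bar>k / N m - fst (segment_point i j (rank m i j k / npts m i j))\<bar> \<le> err_x m i j"
    "\<bar>\<sigma> m k / N m - snd (segment_point i j (rank m i j k / npts m i j))\<bar> \<le> err_y m i j"
proof -
  note p = cell_pos[OF cell]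
  have kN: "k \<in> {1..N m}" "block (c m) k = i" "block (r m) (\<sigma> m k) = j"
    using k by (auto simp: pts_def cell_points_def)
  have A0: "npts m i j > 0" using k by (auto simp: npts_def card_gt_0_iff)
  have rank_le: "rank m i j k \<le> npts m i j"
    unfolding rank_def npts_def by (rule card_mono) auto
  have rank_eq: "rank m i j k = card {x \<in> {1..k}. block (c m) x = i \<and> block (r m) (\<sigma> m x) = j}"
    unfolding rank_def by (rule arg_cong[of _ _ card]) (use kN in \<open>auto simp: pts_def cell_points_def\<close>)
  have "\<bar>real (rank m i j k) - \<gamma> i j / s i * real (card {x \<in> {1..k}. block (c m) x = i})\<bar> \<le> E m * N m"
    unfolding rank_eq by (rule spreadD(1)[OF cell]) (use kN in auto)
  from position_estimate[OF cuts(1) p(4) kN(1,2) this _ rank_le A0]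
  show "\<bar>k / N m - fst (segment_point i j (rank m i j k / npts m i j))\<bar> \<le> err_x m i j"
    using p by (simp add: segment_point_def err_x_def)
  define y where "y = \<sigma> m k"
  define g where "g = card {z \<in> \<sigma> m ` pts m i j. z \<le> y}"
  have yN: "y \<in> {1..N m}" "block (r m) y = j" using \<sigma>_mem[OF kN(1)] kN(3) by (auto simp: y_def)
  have g_le: "g \<le> npts m i j"
    unfolding g_def card_\<sigma>_pts[symmetric] by (rule card_mono) auto
  have g_eq: "g = card {z \<in> {1..y}. block (r m) z = j \<and> block (c m) (inv (\<sigma> m) z) = i}"
    unfolding g_def \<sigma>_pts by (rule arg_cong[of _ _ card]) (use yN in auto)
  have "\<bar>real g - \<gamma> i j / t j * real (card {z \<in> {1..y}. block (r m) z = j})\<bar> \<le> E m * N m"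
    unfolding g_eq by (rule spreadD(2)[OF cell]) (use yN in auto)
  from position_estimate[OF cuts(2) p(5) yN this _ g_le A0]
  have est: "\<bar>y / N m - (row_bound M (j - 1) + g / npts m i j * t j)\<bar> \<le> err_y m i j - t j / npts m i j"
    using p by (simp add: err_y_def)
  have tA: "0 \<le> t j / npts m i j" using p by simp
  show "\<bar>\<sigma> m k / N m - snd (segment_point i j (rank m i j k / npts m i j))\<bar> \<le> err_y m i j"
  proof (cases "entry M i j = Increasing")
    case True
    have "g = rank m i j k"
      unfolding g_def rank_def y_def pts_def
      by (rule card_le_image_strict_mono[OF monotone_cellsD(1)[OF monotone p(4,5) True]]) (use k in \<open>simp add: pts_def\<close>)
    then show ?thesis using est tA True by (simp add: segment_point_def y_def)
  next
    case False
    have "entry M i j = Decreasing"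
      using False cell by (cases "entry M i j") (auto simp: nonblank_cells_def)
    then have "g + rank m i j k = npts m i j + 1"
      unfolding g_def rank_def y_def npts_def pts_def
      by (intro card_le_image_strict_antimono monotone_cellsD(2)[OF monotone p(4,5)])
         (use k in \<open>simp_all add: pts_def cell_points_def\<close>)
    then have g: "real g = real (npts m i j) + 1 - real (rank m i j k)" by linarith
    have "g / npts m i j * t j = (1 - rank m i j k / npts m i j) * t j + t j / npts m i j"
      unfolding g using A0 by (simp add: field_simps)
    moreover have "\<bar>v - (R + W)\<bar> \<le> e" if "\<bar>v - (R + G)\<bar> \<le> e - a" "G = W + a" "0 \<le> a" for v R W G e a :: real
      using that by linarith
    ultimately have "\<bar>y / N m - (row_bound M (j - 1) + (1 - rank m i j k / npts m i j) * t j)\<bar> \<le> err_y m i j"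
      using est tA by blast
    then show ?thesis using False by (simp add: segment_point_def y_def)
  qed
qed

context
  fixes f :: "real \<times> real \<Rightarrow> real" and B :: real
  assumes f: "continuous_on UNIV f" and bound: "\<And>x. \<bar>f x\<bar> \<le> B"
begin

lemma f_measurable: "f \<in> borel_measurable borel"
  using f by (rule borel_measurable_continuous_onI)

text \<open>
  The ranks of the points of a cell run through \<open>1, ..., a\<close>, so replacing each point by the point of \<open>L(i, j)\<close> with parameter
  \<open>rank / a\<close> turns the sum into a Riemann sum, at a cost controlled by uniform continuity.
\<close>

lemma cell_sum_lim:
  assumes cell: "(i, j) \<in> nonblank_cells M"
  shows "(\<lambda>m. (\<Sum>k\<in>pts m i j. f (k / N m, \<sigma> m k / N m)) / N m) \<longlonglongrightarrow>
    \<gamma> i j * (LINT x|cell_measure M (i, j). f x)"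
proof -
  note p = cell_pos[OF cell]
  define \<phi> where "\<phi> = (\<lambda>x. f (segment_point i j x))"
  have "continuous_on UNIV (segment_point i j)"
    unfolding segment_point_def by (cases "entry M i j = Increasing") (auto intro!: continuous_intros)
  then have \<phi>: "continuous_on UNIV \<phi>"
    unfolding \<phi>_def by (rule continuous_on_compose2[OF f]) auto
  have I: "(LINT x|cell_measure M (i, j). f x) = (LINT x|uniform_measure lborel {0..1}. \<phi> x)"
    unfolding \<phi>_def by (rule cell_integral) (use p f_measurable in auto)
  define R where "R = (\<lambda>m. \<Sum>l=1..npts m i j. \<phi> (real l / npts m i j))"
  have "(\<lambda>m. R m / npts m i j) \<longlonglongrightarrow> (LINT x|uniform_measure lborel {0..1}. \<phi> x)"
    unfolding R_def using filterlim_compose[OF riemann_sums_converge[OF \<phi>] npts_filterlim[OF cell]] .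
  from tendsto_mult[OF npts_lim[OF p(4,5)] this]
  have R: "(\<lambda>m. R m / N m) \<longlonglongrightarrow> \<gamma> i j * (LINT x|cell_measure M (i, j). f x)"
  proof (subst I, elim Lim_transform_eventually)
    show "\<forall>\<^sub>F m in sequentially. npts m i j / N m * (R m / npts m i j) = R m / N m"
      by (rule always_eventually) (auto simp: R_def)
  qed
  have reindex: "R m = (\<Sum>k\<in>pts m i j. \<phi> (real (rank m i j k) / npts m i j))" for m
  proof -
    have "bij_betw (rank m i j) (pts m i j) {1..npts m i j}"
      using rank_bij[OF finite_pts] unfolding rank_def[abs_def] npts_def .
    then show ?thesis unfolding R_def by (rule sum.reindex_bij_betw[symmetric])
  qed
  have "(\<lambda>m. (\<Sum>k\<in>pts m i j. f (k / N m, \<sigma> m k / N m)) / N m - R m / N m) \<longlonglongrightarrow> 0"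
  proof (rule LIMSEQ_I)
    fix \<eta> :: real assume "\<eta> > 0"
    then obtain \<delta> where \<delta>: "\<delta> > 0" "\<And>x y x' y'. x \<in> {0..1} \<Longrightarrow> y \<in> {0..1} \<Longrightarrow> x' \<in> {0..1} \<Longrightarrow> y' \<in> {0..1} \<Longrightarrow>
        \<bar>x - x'\<bar> < \<delta> \<Longrightarrow> \<bar>y - y'\<bar> < \<delta> \<Longrightarrow> \<bar>f (x, y) - f (x', y')\<bar> < \<eta> / 2"
      using uniformly_continuous_unit_square[OF f, of "\<eta> / 2"] by auto
    have "\<forall>\<^sub>F m in sequentially. err_x m i j < \<delta> \<and> err_y m i j < \<delta>"
      using order_tendstoD(2)[OF err_lim(1)[OF cell] \<delta>(1)] order_tendstoD(2)[OF err_lim(2)[OF cell] \<delta>(1)]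
      by (rule eventually_conj)
    then obtain m0 where m0: "\<And>m. m \<ge> m0 \<Longrightarrow> err_x m i j < \<delta> \<and> err_y m i j < \<delta>"
      by (auto simp: eventually_sequentially)
    show "\<exists>no. \<forall>m\<ge>no. norm ((\<Sum>k\<in>pts m i j. f (k / N m, \<sigma> m k / N m)) / N m - R m / N m - 0) < \<eta>"
    proof (intro exI[of _ m0] allI impI)
      fix m assume m: "m \<ge> m0"
      have each: "\<bar>f (k / N m, \<sigma> m k / N m) - \<phi> (real (rank m i j k) / npts m i j)\<bar> \<le> \<eta> / 2" if k: "k \<in> pts m i j" for k
      proof -
        have kN: "k \<in> {1..N m}" using k by (auto simp: pts_def cell_points_def)
        have unit: "real x / N m \<in> {0..1}" if "x \<in> {1..N m}" for x using that N_pos[of m] by auto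
        define q where "q = segment_point i j (real (rank m i j k) / npts m i j)"
        have "rank m i j k \<le> npts m i j" unfolding rank_def npts_def by (rule card_mono) auto
        moreover have "npts m i j > 0" using k by (auto simp: npts_def card_gt_0_iff)
        ultimately have "real (rank m i j k) / npts m i j \<in> {0..1}" by simp
        then have "fst q \<in> {0..1}" "snd q \<in> {0..1}"
          unfolding q_def by (rule segment_point_unit[OF cell])+
        moreover have "\<bar>k / N m - fst q\<bar> < \<delta>" "\<bar>\<sigma> m k / N m - snd q\<bar> < \<delta>"
          using point_close[OF cell k] m0[OF m] unfolding q_def by linarith+
        ultimately have "\<bar>f (k / N m, \<sigma> m k / N m) - f (fst q, snd q)\<bar> < \<eta> / 2"
          by (intro \<delta>(2) unit kN \<sigma>_mem)
        then show ?thesis by (simp add: \<phi>_def q_def)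
      qed
      have "\<bar>(\<Sum>k\<in>pts m i j. f (k / N m, \<sigma> m k / N m)) - R m\<bar> \<le> (\<Sum>k\<in>pts m i j. \<eta> / 2)"
        unfolding reindex sum_subtractf[symmetric] by (rule order_trans[OF sum_abs sum_mono]) (rule each)
      also have "\<dots> \<le> N m * (\<eta> / 2)"
      proof -
        have "card (pts m i j) \<le> card {1..N m}" by (rule card_mono) (auto simp: pts_def cell_points_def)
        then show ?thesis using \<open>\<eta> > 0\<close> by (simp add: mult_right_mono)
      qed
      finally have "\<bar>(\<Sum>k\<in>pts m i j. f (k / N m, \<sigma> m k / N m)) - R m\<bar> / N m \<le> \<eta> / 2"
        using N_pos[of m] by (simp add: divide_le_eq mult.commute)
      then have "\<bar>(\<Sum>k\<in>pts m i j. f (k / N m, \<sigma> m k / N m)) - R m\<bar> / N m < \<eta>"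
        using \<open>\<eta> > 0\<close> by linarith
      then show "norm ((\<Sum>k\<in>pts m i j. f (k / N m, \<sigma> m k / N m)) / N m - R m / N m - 0) < \<eta>"
        by (simp add: abs_divide flip: diff_divide_distrib)
    qed
  qed
  from tendsto_add[OF this R] show ?thesis by simp
qed

theorem integral_perm_permuton_lim:
  "(\<lambda>m. LINT x|perm_permuton (N m) (\<sigma> m). f x) \<longlonglongrightarrow> (LINT x|limit_permuton M. f x)"
proof -
  define T where "T = (\<lambda>m. (\<Sum>k=1..N m. f (k / N m, \<sigma> m k / N m)) / N m)"
  have "(\<lambda>m. \<Sum>i=1..ncols M. \<Sum>j=1..nrows M. (\<Sum>k\<in>pts m i j. f (k / N m, \<sigma> m k / N m)) / N m) \<longlonglongrightarrow>
      (\<Sum>i=1..ncols M. \<Sum>j=1..nrows M. \<gamma> i j * (LINT x|cell_measure M (i, j). f x))"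
  proof (intro tendsto_sum)
    fix i j assume ij: "i \<in> {1..ncols M}" "j \<in> {1..nrows M}"
    show "(\<lambda>m. (\<Sum>k\<in>pts m i j. f (k / N m, \<sigma> m k / N m)) / N m) \<longlonglongrightarrow> \<gamma> i j * (LINT x|cell_measure M (i, j). f x)"
      using cell_sum_lim pts_blank[OF ij] by (cases "(i, j) \<in> nonblank_cells M") auto
  qed
  then have T: "T \<longlonglongrightarrow> (LINT x|limit_permuton M. f x)"
    unfolding T_def integral_limit_permuton[OF dist f_measurable bound] sum_points
    by (simp add: sum_divide_distrib)
  have "(\<lambda>m. (LINT x|perm_permuton (N m) (\<sigma> m). f x) - T m) \<longlonglongrightarrow> 0"
  proof (rule LIMSEQ_I)
    fix \<eta> :: real assume "\<eta> > 0"
    then obtain \<delta> where \<delta>: "\<delta> > 0" "\<And>x y x' y'. x \<in> {0..1} \<Longrightarrow> y \<in> {0..1} \<Longrightarrow> x' \<in> {0..1} \<Longrightarrow> y' \<in> {0..1} \<Longrightarrow>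
        \<bar>x - x'\<bar> < \<delta> \<Longrightarrow> \<bar>y - y'\<bar> < \<delta> \<Longrightarrow> \<bar>f (x, y) - f (x', y')\<bar> < \<eta> / 2"
      using uniformly_continuous_unit_square[OF f, of "\<eta> / 2"] by auto
    have "(\<lambda>m. 1 / real (N m)) \<longlonglongrightarrow> 0"
      using filterlim_compose[OF lim_const_over_n N_lim, of 1] by simp
    from order_tendstoD(2)[OF this \<delta>(1)]
    obtain m0 where m0: "\<And>m. m \<ge> m0 \<Longrightarrow> 1 / real (N m) < \<delta>"
      unfolding eventually_sequentially by blast
    show "\<exists>no. \<forall>m\<ge>no. norm ((LINT x|perm_permuton (N m) (\<sigma> m). f x) - T m - 0) < \<eta>"
    proof (intro exI[of _ m0] allI impI)
      fix m assume m: "m \<ge> m0"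
      have "\<bar>(LINT x|perm_permuton (N m) (\<sigma> m). f x) - T m\<bar> \<le> \<eta> / 2"
        unfolding T_def using m0[OF m]
        by (intro integral_perm_permuton_approx[where B = B] N_pos perm f_measurable bound less_imp_le[OF \<delta>(2)]) auto
      then show "norm ((LINT x|perm_permuton (N m) (\<sigma> m). f x) - T m - 0) < \<eta>"
        using \<open>\<eta> > 0\<close> by simp
    qed
  qed
  from tendsto_add[OF this T] show ?thesis by simp
qed

end

end

section \<open>Convergence in distribution\<close>

text \<open>
  Otherwise there are counterexamples of growing length with \<open>\<epsilon> = 1 / (m + 1)\<close>, and they form a sequence that
  contradicts \<open>integral_perm_permuton_lim\<close>.
\<close>

lemma spread_permutations_close:
  fixes f :: "real \<times> real \<Rightarrow> real" and \<eta> :: real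
  assumes con: "connected_gridding_matrix M" and f: "continuous_on UNIV f" and bound: "\<And>x. \<bar>f x\<bar> \<le> B"
    and \<eta>: "\<eta> > 0"
  shows "\<exists>\<epsilon> n0. 0 < \<epsilon> \<and> \<epsilon> \<le> 1 \<and> (\<forall>n\<ge>n0. \<forall>\<sigma>. \<sigma> permutes {1..n} \<longrightarrow> spread_permutation M n \<epsilon> \<sigma> \<longrightarrow>
    \<bar>(LINT x|perm_permuton n \<sigma>. f x) - (LINT x|limit_permuton M. f x)\<bar> < \<eta>)"
proof (rule ccontr)
  assume contra: "\<not> ?thesis"
  define bad where "bad = (\<lambda>m n \<sigma> c r. n \<ge> Suc m \<and> \<sigma> permutes {1..n} \<and> is_gridding M n \<sigma> c r \<and>
    evenly_spread M n (block c) (block r) (1 / real (Suc m)) \<sigma> \<and>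
    \<bar>(LINT x|perm_permuton n \<sigma>. f x) - (LINT x|limit_permuton M. f x)\<bar> \<ge> \<eta>)"
  have "\<exists>n \<sigma> c r. bad m n \<sigma> c r" for m
  proof (rule ccontr)
    assume none: "\<not> (\<exists>n \<sigma> c r. bad m n \<sigma> c r)"
    have "\<forall>n\<ge>Suc m. \<forall>\<sigma>. \<sigma> permutes {1..n} \<longrightarrow> spread_permutation M n (1 / real (Suc m)) \<sigma> \<longrightarrow>
        \<bar>(LINT x|perm_permuton n \<sigma>. f x) - (LINT x|limit_permuton M. f x)\<bar> < \<eta>"
      using none unfolding bad_def spread_permutation_def not_le[symmetric] by blast
    moreover have "0 < 1 / real (Suc m)" "1 / real (Suc m) \<le> 1" by simp_all
    ultimately show False using contra by blast
  qed
  then obtain N \<sigma> c r where bad: "\<And>m. bad m (N m) (\<sigma> m) (c m) (r m)" by metis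
  interpret spread_sequence M N "\<lambda>m. 1 / real (Suc m)" \<sigma> c r
  proof
    show "N m > 0" for m using bad[of m] by (auto simp: bad_def)
    show "filterlim N at_top sequentially"
      using bad by (intro filterlim_at_top_mono[OF filterlim_ident] always_eventually) (auto simp: bad_def Suc_le_eq intro: less_imp_le)
    show "(\<lambda>m. 1 / real (Suc m)) \<longlonglongrightarrow> 0" by (rule LIMSEQ_Suc[OF lim_1_over_n])
  qed (use bad con in \<open>auto simp: bad_def\<close>)
  have "\<forall>\<^sub>F m in sequentially. dist (LINT x|perm_permuton (N m) (\<sigma> m). f x) (LINT x|limit_permuton M. f x) < \<eta>"
    using integral_perm_permuton_lim[OF f bound] \<eta> by (rule tendstoD)
  then obtain m where "\<bar>(LINT x|perm_permuton (N m) (\<sigma> m). f x) - (LINT x|limit_permuton M. f x)\<bar> < \<eta>"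
    by (auto simp: eventually_sequentially dist_real_def)
  then show False using bad[of m] by (simp add: bad_def)
qed

lemma far_fraction_tendsto_0:
  fixes f :: "real \<times> real \<Rightarrow> real" and \<eta> :: real
  assumes con: "connected_gridding_matrix M" and f: "continuous_on UNIV f" and bound: "\<And>x. \<bar>f x\<bar> \<le> B"
    and \<eta>: "\<eta> > 0"
  shows "(\<lambda>n. card {\<sigma> \<in> Grid M n. \<bar>(LINT x|perm_permuton n \<sigma>. f x) - (LINT x|limit_permuton M. f x)\<bar> \<ge> \<eta>} /
    card (Grid M n)) \<longlonglongrightarrow> 0"
proof -
  obtain \<epsilon> n0 where \<epsilon>: "0 < \<epsilon>" "\<epsilon> \<le> 1" and close: "\<And>n \<sigma>. n \<ge> n0 \<Longrightarrow> \<sigma> permutes {1..n} \<Longrightarrow>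
      spread_permutation M n \<epsilon> \<sigma> \<Longrightarrow> \<bar>(LINT x|perm_permuton n \<sigma>. f x) - (LINT x|limit_permuton M. f x)\<bar> < \<eta>"
    using spread_permutations_close[OF assms] by metis
  show ?thesis
  proof (rule tendsto_sandwich[OF _ _ tendsto_const uneven_fraction_tendsto_0[OF con \<epsilon>]])
    show "\<forall>\<^sub>F n in sequentially.
        card {\<sigma> \<in> Grid M n. \<bar>(LINT x|perm_permuton n \<sigma>. f x) - (LINT x|limit_permuton M. f x)\<bar> \<ge> \<eta>} / card (Grid M n)
        \<le> card {\<sigma> \<in> Grid M n. \<not> spread_permutation M n \<epsilon> \<sigma>} / card (Grid M n)"
    proof (rule eventually_sequentiallyI[of n0])
      fix n assume n: "n \<ge> n0"
      have "{\<sigma> \<in> Grid M n. \<bar>(LINT x|perm_permuton n \<sigma>. f x) - (LINT x|limit_permuton M. f x)\<bar> \<ge> \<eta>} \<subseteq>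
          {\<sigma> \<in> Grid M n. \<not> spread_permutation M n \<epsilon> \<sigma>}"
        using close[OF n] unfolding Grid_def not_less[symmetric] by blast
      then have "card {\<sigma> \<in> Grid M n. \<bar>(LINT x|perm_permuton n \<sigma>. f x) - (LINT x|limit_permuton M. f x)\<bar> \<ge> \<eta>} \<le>
          card {\<sigma> \<in> Grid M n. \<not> spread_permutation M n \<epsilon> \<sigma>}"
        using finite_Grid[of M n] by (intro card_mono) auto
      then show "card {\<sigma> \<in> Grid M n. \<bar>(LINT x|perm_permuton n \<sigma>. f x) - (LINT x|limit_permuton M. f x)\<bar> \<ge> \<eta>} /
          card (Grid M n) \<le> card {\<sigma> \<in> Grid M n. \<not> spread_permutation M n \<epsilon> \<sigma>} / card (Grid M n)"
        by (intro divide_right_mono) auto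
    qed
  qed simp
qed

lemma topspace_weak_permuton_topology: "topspace weak_permuton_topology = {\<mu>. permuton \<mu>}"
  by (simp add: weak_permuton_topology_def topspace_pullback_topology)

text \<open>
  The preimage of the ball around \<open>F \<mu>\<close> is open in an initial topology over a product space. A basic open set of
  the product restricts finitely many coordinates, each of which is the integral of a test function.
\<close>

lemma weak_neighbourhood:
  assumes F: "continuous_map weak_permuton_topology euclideanreal F" and \<mu>: "permuton \<mu>" and e: "e > 0"
  shows "\<exists>(\<F> :: ((real \<times> real) \<Rightarrow>\<^sub>C real) set) \<eta>. finite \<F> \<and> \<eta> > 0 \<and> (\<forall>\<nu>. permuton \<nu> \<longrightarrow>
    (\<forall>f\<in>\<F>. \<bar>(LINT x|\<nu>. apply_bcontfun f x) - (LINT x|\<mu>. apply_bcontfun f x)\<bar> < \<eta>) \<longrightarrow> \<bar>F \<nu> - F \<mu>\<bar> < e)"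
proof -
  define \<Phi> where "\<Phi> = (\<lambda>\<mu> (f :: (real \<times> real) \<Rightarrow>\<^sub>C real). LINT x|\<mu>. apply_bcontfun f x)"
  have "openin weak_permuton_topology {\<nu> \<in> topspace weak_permuton_topology. F \<nu> \<in> ball (F \<mu>) e}"
    by (rule openin_continuous_map_preimage[OF F]) simp
  then obtain U where U: "open U" "{\<nu> \<in> topspace weak_permuton_topology. F \<nu> \<in> ball (F \<mu>) e} = \<Phi> -` U \<inter> {\<nu>. permuton \<nu>}"
    unfolding weak_permuton_topology_def openin_pullback_topology \<Phi>_def[symmetric] by auto
  have "\<mu> \<in> {\<nu> \<in> topspace weak_permuton_topology. F \<nu> \<in> ball (F \<mu>) e}"
    using \<mu> e by (simp add: topspace_weak_permuton_topology)
  then have "\<Phi> \<mu> \<in> U" unfolding U(2) by simp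
  moreover have "openin (product_topology (\<lambda>_. euclidean) UNIV) U"
    using U(1) by (simp add: euclidean_product_topology)
  ultimately have "\<exists>X. \<Phi> \<mu> \<in> (\<Pi>\<^sub>E f\<in>UNIV. X f) \<and> (\<forall>f. openin euclidean (X f)) \<and>
      finite {f. X f \<noteq> topspace euclidean} \<and> (\<Pi>\<^sub>E f\<in>UNIV. X f) \<subseteq> U"
    by (intro product_topology_open_contains_basis)
  then obtain X where X: "\<Phi> \<mu> \<in> (\<Pi>\<^sub>E f\<in>UNIV. X f)" "\<And>f. openin euclidean (X f)"
      "finite {f. X f \<noteq> topspace euclidean}" "(\<Pi>\<^sub>E f\<in>UNIV. X f) \<subseteq> U"
    by blast
  define \<F> where "\<F> = {f. X f \<noteq> UNIV}"
  have fin: "finite \<F>" using X(3) by (simp add: \<F>_def)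
  have "\<exists>\<eta>>0. ball (\<Phi> \<mu> f) \<eta> \<subseteq> X f" for f
    using PiE_mem[OF X(1), of f] X(2)[of f] open_contains_ball[of "X f"] by auto
  then obtain \<eta> where \<eta>: "\<And>f. \<eta> f > 0" "\<And>f. ball (\<Phi> \<mu> f) (\<eta> f) \<subseteq> X f" by metis
  define \<eta>' where "\<eta>' = Min (insert 1 (\<eta> ` \<F>))"
  have \<eta>': "\<eta>' > 0" "\<And>f. f \<in> \<F> \<Longrightarrow> \<eta>' \<le> \<eta> f"
    using fin \<eta>(1) by (auto simp: \<eta>'_def)
  have "\<bar>F \<nu> - F \<mu>\<bar> < e" if \<nu>: "permuton \<nu>" and close: "\<forall>f\<in>\<F>. \<bar>\<Phi> \<nu> f - \<Phi> \<mu> f\<bar> < \<eta>'" for \<nu>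
  proof -
    have "\<Phi> \<nu> f \<in> X f" for f
    proof (cases "f \<in> \<F>")
      case True
      then have "\<bar>\<Phi> \<nu> f - \<Phi> \<mu> f\<bar> < \<eta> f" using close \<eta>'(2)[OF True] by force
      then show ?thesis using \<eta>(2)[of f] by (auto simp: dist_real_def abs_minus_commute)
    qed (simp add: \<F>_def)
    then have "\<nu> \<in> \<Phi> -` U \<inter> {\<nu>. permuton \<nu>}" using X(4) \<nu> by (auto simp: PiE_iff)
    then show ?thesis unfolding U(2)[symmetric] by (simp add: dist_real_def abs_minus_commute)
  qed
  then show ?thesis using fin \<eta>'(1) unfolding \<Phi>_def by blast
qed

theorem theorem3p10:
  fixes M :: gridding_matrix
  assumes "connected_gridding_matrix M"
  shows "converges_in_distribution weak_permuton_topology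
           (\<lambda>n. map_pmf (perm_permuton (Suc n)) (pmf_of_set (Grid M (Suc n))))
           (return_pmf (limit_permuton M))"
  unfolding converges_in_distribution_def
proof (intro conjI allI impI)
  note con = assms
  have G: "Grid M n \<noteq> {}" "finite (Grid M n)" for n
    using con Grid_nonempty finite_Grid by (auto simp: connected_gridding_matrix_def)
  have perm: "permuton (perm_permuton (Suc n) \<sigma>)" if "\<sigma> \<in> Grid M (Suc n)" for n \<sigma>
    using that permuton_perm_permuton[of "Suc n" \<sigma>] by (simp add: Grid_def)
  have lim: "permuton (limit_permuton M)"
    using permuton_limit_permuton max_entropy_max_distribution[OF con] by (simp add: max_entropy_def)
  show "set_pmf (map_pmf (perm_permuton (Suc n)) (pmf_of_set (Grid M (Suc n)))) \<subseteq> topspace weak_permuton_topology" for n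
    using perm by (auto simp: topspace_weak_permuton_topology set_pmf_of_set[OF G])
  show "set_pmf (return_pmf (limit_permuton M)) \<subseteq> topspace weak_permuton_topology"
    using lim by (simp add: topspace_weak_permuton_topology)
  fix F :: "(real \<times> real) measure \<Rightarrow> real"
  assume "continuous_map weak_permuton_topology euclideanreal F \<and> bounded (F ` topspace weak_permuton_topology)"
  then have F: "continuous_map weak_permuton_topology euclideanreal F"
    and "\<exists>B. \<forall>\<nu>. permuton \<nu> \<longrightarrow> \<bar>F \<nu>\<bar> \<le> B"
    by (auto simp: bounded_iff topspace_weak_permuton_topology)
  then obtain B where B: "\<And>\<nu>. permuton \<nu> \<Longrightarrow> \<bar>F \<nu>\<bar> \<le> B" by auto
  let ?\<mu> = "limit_permuton M"
  have B0: "B \<ge> 0" using B[OF lim] by simp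
  have "(\<lambda>n. (\<Sum>\<sigma>\<in>Grid M (Suc n). F (perm_permuton (Suc n) \<sigma>)) / card (Grid M (Suc n))) \<longlonglongrightarrow> F ?\<mu>"
  proof (rule LIMSEQ_I)
    fix e :: real assume e: "e > 0"
    then obtain \<F> :: "((real \<times> real) \<Rightarrow>\<^sub>C real) set" and \<eta> where \<F>: "finite \<F>" "\<eta> > 0"
      and close: "\<And>\<nu>. permuton \<nu> \<Longrightarrow> \<forall>f\<in>\<F>. \<bar>(LINT x|\<nu>. apply_bcontfun f x) - (LINT x|?\<mu>. apply_bcontfun f x)\<bar> < \<eta> \<Longrightarrow>
        \<bar>F \<nu> - F ?\<mu>\<bar> < e / 2"
      using weak_neighbourhood[OF F lim, of "e / 2"] by (metis half_gt_zero)
    define far where "far = (\<lambda>n f. {\<sigma> \<in> Grid M n.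
      \<bar>(LINT x|perm_permuton n \<sigma>. apply_bcontfun f x) - (LINT x|?\<mu>. apply_bcontfun f x)\<bar> \<ge> \<eta>})"
    define d where "d = (\<lambda>n. \<Sum>f\<in>\<F>. card (far n f) / card (Grid M n))"
    have "d \<longlonglongrightarrow> (\<Sum>f\<in>\<F>. 0)"
      unfolding d_def
    proof (rule tendsto_sum)
      fix f :: "(real \<times> real) \<Rightarrow>\<^sub>C real"
      obtain b where "\<And>x. \<bar>apply_bcontfun f x\<bar> \<le> b"
        using bounded_apply_bcontfun[of f] by (auto simp: bounded_iff)
      then show "(\<lambda>n. card (far n f) / card (Grid M n)) \<longlonglongrightarrow> 0"
        unfolding far_def by (intro far_fraction_tendsto_0 con continuous_on_apply_bcontfun \<F>(2))
    qed
    then have "(\<lambda>n. e / 2 + 2 * B * d (Suc n)) \<longlonglongrightarrow> e / 2 + 2 * B * (\<Sum>f\<in>\<F>. 0)"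
      by (intro tendsto_intros LIMSEQ_Suc)
    then have "\<forall>\<^sub>F n in sequentially. e / 2 + 2 * B * d (Suc n) < e"
      by (rule order_tendstoD) (use e in simp)
    then obtain n0 where n0: "\<And>n. n \<ge> n0 \<Longrightarrow> e / 2 + 2 * B * d (Suc n) < e"
      by (auto simp: eventually_sequentially)
    show "\<exists>n0. \<forall>n\<ge>n0. norm ((\<Sum>\<sigma>\<in>Grid M (Suc n). F (perm_permuton (Suc n) \<sigma>)) / card (Grid M (Suc n)) - F ?\<mu>) < e"
    proof (intro exI[of _ n0] allI impI)
      fix n assume n: "n \<ge> n0"
      let ?G = "Grid M (Suc n)"
      have cG: "real (card ?G) > 0" using G by (simp add: card_gt_0_iff)
      \<comment> \<open>either all test integrals are close, or \<open>\<sigma>\<close> is counted in the sum at least once\<close>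
      have each: "\<bar>F (perm_permuton (Suc n) \<sigma>) - F ?\<mu>\<bar> \<le> e / 2 + 2 * B * (\<Sum>f\<in>\<F>. of_bool (\<sigma> \<in> far (Suc n) f))"
        if \<sigma>: "\<sigma> \<in> ?G" for \<sigma>
      proof (cases "\<exists>f\<in>\<F>. \<sigma> \<in> far (Suc n) f")
        case True
        then obtain f where f: "f \<in> \<F>" "\<sigma> \<in> far (Suc n) f" by blast
        then have "1 \<le> (\<Sum>f\<in>\<F>. of_bool (\<sigma> \<in> far (Suc n) f) :: real)"
          using member_le_sum[of f \<F> "\<lambda>f. of_bool (\<sigma> \<in> far (Suc n) f) :: real"] \<F>(1) by simp
        then have "2 * B * 1 \<le> 2 * B * (\<Sum>f\<in>\<F>. of_bool (\<sigma> \<in> far (Suc n) f))"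
          using B0 by (intro mult_left_mono) auto
        then show ?thesis using B[OF perm[OF \<sigma>]] B[OF lim] e by linarith
      next
        case False
        then have "\<bar>F (perm_permuton (Suc n) \<sigma>) - F ?\<mu>\<bar> < e / 2"
          using \<sigma> by (intro close perm) (auto simp: far_def not_le)
        moreover have "0 \<le> 2 * B * (\<Sum>f\<in>\<F>. of_bool (\<sigma> \<in> far (Suc n) f))"
          using B0 by (intro mult_nonneg_nonneg sum_nonneg) auto
        ultimately show ?thesis by linarith
      qed
      have "(\<Sum>\<sigma>\<in>?G. F (perm_permuton (Suc n) \<sigma>)) / card ?G - F ?\<mu> =
          (\<Sum>\<sigma>\<in>?G. F (perm_permuton (Suc n) \<sigma>) - F ?\<mu>) / card ?G"
        using cG by (simp add: sum_subtractf diff_divide_distrib)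
      also have "\<bar>\<dots>\<bar> \<le> (\<Sum>\<sigma>\<in>?G. e / 2 + 2 * B * (\<Sum>f\<in>\<F>. of_bool (\<sigma> \<in> far (Suc n) f))) / card ?G"
        unfolding abs_divide abs_of_nat
        by (intro divide_right_mono order_trans[OF sum_abs sum_mono] each) auto
      also have "\<dots> = e / 2 + 2 * B * d (Suc n)"
      proof -
        have "(\<Sum>\<sigma>\<in>?G. \<Sum>f\<in>\<F>. of_bool (\<sigma> \<in> far (Suc n) f)) = (\<Sum>f\<in>\<F>. \<Sum>\<sigma>\<in>?G. of_bool (\<sigma> \<in> far (Suc n) f) :: real)"
          by (rule sum.swap)
        also have "\<dots> = (\<Sum>f\<in>\<F>. real (card (far (Suc n) f)))"
        proof (rule sum.cong[OF refl])
          fix f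
          have "?G \<inter> {\<sigma>. \<sigma> \<in> far (Suc n) f} = far (Suc n) f" by (auto simp: far_def)
          then show "(\<Sum>\<sigma>\<in>?G. of_bool (\<sigma> \<in> far (Suc n) f)) = real (card (far (Suc n) f))"
            using G(2) by simp
        qed
        also have "\<dots> = card ?G * d (Suc n)"
          using cG by (simp add: d_def flip: sum_divide_distrib)
        finally have "(\<Sum>\<sigma>\<in>?G. \<Sum>f\<in>\<F>. of_bool (\<sigma> \<in> far (Suc n) f)) = card ?G * d (Suc n)" .
        then show ?thesis
          using cG by (simp add: sum.distrib add_divide_distrib flip: sum_distrib_left)
      qed
      also have "\<dots> < e" by (rule n0[OF n])
      finally show "norm ((\<Sum>\<sigma>\<in>?G. F (perm_permuton (Suc n) \<sigma>)) / card ?G - F ?\<mu>) < e" by simp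
    qed
  qed
  then show "(\<lambda>n. measure_pmf.expectation (map_pmf (perm_permuton (Suc n)) (pmf_of_set (Grid M (Suc n)))) F)
      \<longlonglongrightarrow> measure_pmf.expectation (return_pmf (limit_permuton M)) F"
    using G by (simp add: integral_pmf_of_set)
qed

end
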